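(* Let $a\in BC(\mathbf{R})$ with $a(x)\ge 0$, and suppose there exist constants $L>0$ and $\varepsilon_1>0$ such that $a(x)\ge \varepsilon_1$ for $|x|\ge L$. Let $V\in BC^1(\mathbf{R})$ with $V(x)>0$ for all $x\in\mathbf{R}$ and $V'(x)x\le 0$ for all $x\in\mathbf{R}$. Then there exists a constant $C^*>0$ (depending only on $L$) such that, if $V(0)<(4C^* )^{-1}$, the following holds: for every initial data $[u_0,u_1]\in \big(H^1(\mathbf{R})\cap L^2(\mathbf{R},w)\big)\times L^2(\mathbf{R},w)$, the weak solution $u$ of \[u_{tt}-u_{xx}+V(x)u+a(x)u_t=0\ \ ((t,x)\in(0,\infty)\times\mathbf{R}),\qquad u(0,x)=u_0(x),\ u_t(0,x)=u_1(x),\] satisfies, for all $t\ge 0$, \[\|u(t,\cdot)\|\le C I_0,\qquad E_u(t)\le C I_0^2(1+t)^{-1},\] with some constant $C>0$ independent of $t$ and of the data, where for $\mu\in\{1,2\}$ \[I_0^\mu:=\|u_0\|_{H^1}^\mu+\|u_1\|^\mu+\Big\|\frac{u_1+a(\cdot)u_0}{\sqrt{V(\cdot)}}\Big\|^\mu .\]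
   Context: $\|\cdot\|$ denotes the $L^2(\mathbf{R})$-norm. $BC(\mathbf{R})$ is the space of bounded continuous functions on $\mathbf{R}$ and $BC^1(\mathbf{R})=\{f: f,f'\in BC(\mathbf{R})\}$. The weight is $w(x):=1+V(x)^{-1}$ and $L^2(\mathbf{R},w):=\{u\in L^2(\mathbf{R}):\int_{\mathbf{R}}|u|^2w\,dx<\infty\}$. The total energy is $E_u(t)=\frac12\big(\|u_t(t,\cdot)\|^2+\|u_x(t,\cdot)\|^2+\|\sqrt{V(\cdot)}u(t,\cdot)\|^2\big)$. For such data the problem has a unique weak solution $u\in C([0,\infty);H^1(\mathbf{R}))\cap C^1([0,\infty);L^2(\mathbf{R}))$. *)

theory Defs
  imports "HOL-Analysis.Analysis"
begin

text \<open>Real-valued functions on the line; L^2 is taken w.r.t. Lebesgue measure,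
  elements represented by Borel measurable functions (a.e. classes).\<close>

definition L2 :: "(real \<Rightarrow> real) \<Rightarrow> bool" where
  "L2 f \<longleftrightarrow> f \<in> borel_measurable lborel \<and> integrable lborel (\<lambda>x. (f x)^2)"

definition L2norm :: "(real \<Rightarrow> real) \<Rightarrow> real" where
  "L2norm f = sqrt (LINT x|lborel. (f x)^2)"

definition BC :: "(real \<Rightarrow> real) \<Rightarrow> bool" where
  "BC f \<longleftrightarrow> continuous_on UNIV f \<and> bounded (range f)"

definition BC1 :: "(real \<Rightarrow> real) \<Rightarrow> bool" where
  "BC1 f \<longleftrightarrow> BC f \<and> (\<forall>x. f differentiable (at x)) \<and> BC (deriv f)"

definition weight :: "(real \<Rightarrow> real) \<Rightarrow> real \<Rightarrow> real" where
  "weight V x = 1 + inverse (V x)"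

definition L2w :: "(real \<Rightarrow> real) \<Rightarrow> (real \<Rightarrow> real) \<Rightarrow> bool" where
  "L2w V f \<longleftrightarrow> L2 f \<and> integrable lborel (\<lambda>x. (f x)^2 * weight V x)"

definition test_fun :: "(real \<Rightarrow> real) \<Rightarrow> bool" where
  "test_fun \<phi> \<longleftrightarrow> (\<forall>n x. ((deriv ^^ n) \<phi>) differentiable (at x))
                  \<and> (\<exists>R. \<forall>x. R \<le> \<bar>x\<bar> \<longrightarrow> \<phi> x = 0)"

definition has_weak_deriv :: "(real \<Rightarrow> real) \<Rightarrow> (real \<Rightarrow> real) \<Rightarrow> bool" where
  "has_weak_deriv f g \<longleftrightarrow> (\<forall>\<phi>. test_fun \<phi> \<longrightarrow>
      (LINT x|lborel. f x * deriv \<phi> x) = - (LINT x|lborel. g x * \<phi> x))"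

definition H1 :: "(real \<Rightarrow> real) \<Rightarrow> (real \<Rightarrow> real) \<Rightarrow> bool" where
  "H1 f df \<longleftrightarrow> L2 f \<and> L2 df \<and> has_weak_deriv f df"

definition H1norm :: "(real \<Rightarrow> real) \<Rightarrow> (real \<Rightarrow> real) \<Rightarrow> real" where
  "H1norm f df = sqrt ((L2norm f)^2 + (L2norm df)^2)"

text \<open>Weak solution u \<in> C([0,\<infinity>);H^1) \<inter> C^1([0,\<infinity>);L^2) of
  u_tt - u_xx + V u + a u_t = 0, u(0)=u0, u_t(0)=u1.
  Here u t is u(t,.), ux t its weak x-derivative, ut t its time derivative in L^2.
  The equation holds in the weak sense: for every test function \<phi> and t>0,
  d/dt <u_t,\<phi>> = -<u_x,\<phi>'> - <V u,\<phi>> - <a u_t,\<phi>>.\<close>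
definition weak_solution ::
  "(real \<Rightarrow> real) \<Rightarrow> (real \<Rightarrow> real) \<Rightarrow> (real \<Rightarrow> real) \<Rightarrow> (real \<Rightarrow> real)
   \<Rightarrow> (real \<Rightarrow> real \<Rightarrow> real) \<Rightarrow> (real \<Rightarrow> real \<Rightarrow> real) \<Rightarrow> (real \<Rightarrow> real \<Rightarrow> real) \<Rightarrow> bool" where
  "weak_solution V a u0 u1 u ut ux \<longleftrightarrow>
     (\<forall>t\<ge>0. H1 (u t) (ux t) \<and> L2 (ut t))
   \<and> (\<forall>t\<ge>0. ((\<lambda>s. L2norm (\<lambda>x. u s x - u t x) + L2norm (\<lambda>x. ux s x - ux t x))
              \<longlongrightarrow> 0) (at t within {0..}))
   \<and> (\<forall>t\<ge>0. ((\<lambda>s. L2norm (\<lambda>x. (u s x - u t x) / (s - t) - ut t x))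
              \<longlongrightarrow> 0) (at t within {0..}))
   \<and> (\<forall>t\<ge>0. ((\<lambda>s. L2norm (\<lambda>x. ut s x - ut t x)) \<longlongrightarrow> 0) (at t within {0..}))
   \<and> (\<forall>\<phi>. test_fun \<phi> \<longrightarrow> (\<forall>t>0.
        ((\<lambda>s. LINT x|lborel. ut s x * \<phi> x) has_real_derivative
           (- (LINT x|lborel. ux t x * deriv \<phi> x)
            - (LINT x|lborel. V x * u t x * \<phi> x)
            - (LINT x|lborel. a x * ut t x * \<phi> x))) (at t)))
   \<and> L2norm (\<lambda>x. u 0 x - u0 x) = 0
   \<and> L2norm (\<lambda>x. ut 0 x - u1 x) = 0"

definition energy ::
  "(real \<Rightarrow> real) \<Rightarrow> (real \<Rightarrow> real \<Rightarrow> real) \<Rightarrow> (real \<Rightarrow> real \<Rightarrow> real) \<Rightarrow> (real \<Rightarrow> real \<Rightarrow> real)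
   \<Rightarrow> real \<Rightarrow> real" where
  "energy V u ut ux t = (1/2) * ((L2norm (ut t))^2 + (L2norm (ux t))^2
                                 + (L2norm (\<lambda>x. sqrt (V x) * u t x))^2)"

definition I0pow ::
  "nat \<Rightarrow> (real \<Rightarrow> real) \<Rightarrow> (real \<Rightarrow> real) \<Rightarrow> (real \<Rightarrow> real) \<Rightarrow> (real \<Rightarrow> real)
   \<Rightarrow> (real \<Rightarrow> real) \<Rightarrow> real" where
  "I0pow \<mu> V a u0 du0 u1 = (H1norm u0 du0)^\<mu> + (L2norm u1)^\<mu>
      + (L2norm (\<lambda>x. (u1 x + a x * u0 x) / sqrt (V x)))^\<mu>"

end

(* All energy identities are computed in the Hilbert space L^2. Besides u itself one uses its time
   integral v, which solves u_t - v_xx + V v + a u = u_1 + a u_0; testing with u = v_t and writing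
   u_1 + a u_0 = sqrt V * q gives |u(t)|^2 / 2 + int_0^t (a u, u) <= |u_0|^2 / 2 + |q|^2. Then
   (u, u_t) + (a u, u) / 2 + lam (u_t, arctan(x) u_x) has derivative at most - E up to
   (a u_t, u_t), (a u, u) and the integral of V u^2 over |x| <= L; the latter is absorbed by
   a Poincare inequality on [-L, 2 L] and the smallness of V(0). Adding multiples of the energy and
   of the functional for v yields Lambda with Lambda' <= - E / 2, so that
   t E / 2 + Lambda is nonincreasing. The computation needs second derivatives of u; it is
   carried out for the difference quotients (f(t+d) - f(t)) / d of the time integrals, which solve
   the same equation exactly because the coefficients do not depend on t, and d -> 0 at the end. *)

theory Submission
  imports Defs "HOL-Computational_Algebra.Polynomial"
begin

section \<open>Smooth test functions\<close>

text \<open>The damping is effective only for \<bar>x\<bar> \<ge> L, and V may tend to 0 at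
  infinity, so neither it nor the energy alone controls u in L^2. On [-L, L] the multiplier arctan
  takes over. It is bounded, so its functional is controlled by the energy (that of x u_x would not
  be); its derivative is positive, which supplies the missing kinetic term; and arctan(x) V'(x)
  \<le> 0 by the sign of V'(x) x, so that only V arctan' is left with an unfavourable sign. The
  Poincare inequality trades this remainder for u_x, with a constant made of L alone, and for u on
  [L, 2 L], where a is bounded below. The lower bound of a and its supremum therefore enter only the
  multiples of the two monotone functionals, and C* depends on L only. The weight in the data is
  there because the source u_1 + a u_0 is paired with v, of which only sqrt V * v is under control.
  Time integrals and their quotients take values in L^2, and integrating continuous maps needs
  completeness; this is why L^2 is built as a type with a Banach space structure.\<close>

definition smooth :: "(real \<Rightarrow> real) \<Rightarrow> bool" where
  "smooth f \<longleftrightarrow> (\<forall>n x. ((deriv ^^ n) f) differentiable (at x))"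

text \<open>A property that entails differentiability and passes to the derivative holds along all
  iterated derivatives. Closure proofs then need a class of functions stable under
  \<open>deriv\<close> instead of formulas for the n-th derivative.\<close>

lemma smooth_coinduct:
  assumes "P f" and "\<And>f. P f \<Longrightarrow> (\<forall>x. f differentiable (at x)) \<and> P (deriv f)"
  shows "smooth f"
proof -
  have "P ((deriv ^^ n) f)" for n
    by (induction n) (use assms in auto)
  then show ?thesis
    using assms(2) unfolding smooth_def by blast
qed

lemma smooth_differentiable: "smooth f \<Longrightarrow> f differentiable (at x)"
  unfolding smooth_def by (metis funpow_0)

lemma smooth_deriv: "smooth f \<Longrightarrow> smooth (deriv f)"
  unfolding smooth_def by (metis funpow_Suc_right o_apply)

lemma smooth_DERIV: "smooth f \<Longrightarrow> (f has_real_derivative deriv f x) (at x)"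
  using smooth_differentiable real_differentiable_def DERIV_deriv_iff_real_differentiable by blast

lemma smooth_continuous: "smooth f \<Longrightarrow> continuous_on S f"
  by (meson DERIV_continuous_on has_field_derivative_at_within smooth_DERIV)

lemma smooth_antiderivative:
  assumes "\<And>x. (F has_real_derivative f x) (at x)" "smooth f"
  shows "smooth F"
proof (rule smooth_coinduct[where P = "\<lambda>g. g = F \<or> smooth g"])
  have "deriv F = f"
    using assms(1) DERIV_imp_deriv by blast
  then show "(\<forall>x. g differentiable at x) \<and> (deriv g = F \<or> smooth (deriv g))"
    if "g = F \<or> smooth g" for g
    using that assms smooth_deriv smooth_differentiable real_differentiable_def by blast
qed simp

lemma smooth_add_scaled:
  assumes "smooth f" "smooth g" shows "smooth (\<lambda>x. f x + c * g x)"
proof (rule smooth_coinduct[where P = "\<lambda>h. \<exists>f g. smooth f \<and> smooth g \<and> h = (\<lambda>x. f x + c * g x)"])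
  fix h assume "\<exists>f g. smooth f \<and> smooth g \<and> h = (\<lambda>x. f x + c * g x)"
  then obtain f g where fg: "smooth f" "smooth g" and h: "h = (\<lambda>x. f x + c * g x)"
    by blast
  have *: "(h has_real_derivative deriv f x + c * deriv g x) (at x)" for x
    unfolding h by (intro DERIV_add DERIV_cmult smooth_DERIV fg)
  then have "deriv h = (\<lambda>x. deriv f x + c * deriv g x)"
    using DERIV_imp_deriv by blast
  then show "(\<forall>x. h differentiable at x) \<and>
      (\<exists>f g. smooth f \<and> smooth g \<and> deriv h = (\<lambda>x. f x + c * g x))"
    using * fg smooth_deriv real_differentiable_def by blast
qed (use assms in auto)

text \<open>The product rule leads out of the products of two smooth functions; their finite sums
  are stable under differentiation and serve as the coinduction invariant.\<close>

inductive smooth_alg :: "(real \<Rightarrow> real) \<Rightarrow> bool" where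
  prod: "smooth f \<Longrightarrow> smooth g \<Longrightarrow> smooth_alg (\<lambda>x. f x * g x)"
| sum: "smooth_alg f \<Longrightarrow> smooth_alg g \<Longrightarrow> smooth_alg (\<lambda>x. f x + g x)"

lemma smooth_mult:
  assumes "smooth f" "smooth g" shows "smooth (\<lambda>x. f x * g x)"
proof (rule smooth_coinduct[where P = smooth_alg])
  fix h assume "smooth_alg h"
  then have "\<exists>h'. smooth_alg h' \<and> (\<forall>x. (h has_real_derivative h' x) (at x))"
  proof induction
    case (prod f g)
    have "((\<lambda>x. f x * g x) has_real_derivative deriv f x * g x + f x * deriv g x) (at x)" for x
      using DERIV_mult[OF smooth_DERIV[OF prod(1)] smooth_DERIV[OF prod(2)], of x] by (simp add: mult.commute)
    moreover have "smooth_alg (\<lambda>x. deriv f x * g x + f x * deriv g x)"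
      by (intro smooth_alg.intros smooth_deriv prod)
    ultimately show ?case by blast
  next
    case (sum f g)
    then obtain f' g' where *: "smooth_alg f'" "\<And>x. (f has_real_derivative f' x) (at x)"
      "smooth_alg g'" "\<And>x. (g has_real_derivative g' x) (at x)"
      by blast
    then have "((\<lambda>x. f x + g x) has_real_derivative f' x + g' x) (at x)" for x
      by (intro derivative_eq_intros) auto
    then show ?case
      using smooth_alg.sum[OF *(1,3)] by blast
  qed
  then obtain h' where h': "smooth_alg h'" "\<And>x. (h has_real_derivative h' x) (at x)"
    by blast
  then have "deriv h = h'"
    using DERIV_imp_deriv by blast
  then show "(\<forall>x. h differentiable at x) \<and> smooth_alg (deriv h)"
    using h' real_differentiable_def by blast
qed (use assms in \<open>simp add: smooth_alg.prod\<close>)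

lemma smooth_affine:
  assumes "smooth f" shows "smooth (\<lambda>x. f (a * x + b))"
proof -
  \<comment> \<open>The free factor \<open>c\<close> absorbs the factor \<open>a\<close> that the
    chain rule produces at each differentiation.\<close>
  have "smooth (\<lambda>x. c * f (a * x + b))" for c
  proof (rule smooth_coinduct[where P = "\<lambda>h. \<exists>f c. smooth f \<and> h = (\<lambda>x. c * f (a * x + b))"])
    fix h assume "\<exists>f c. smooth f \<and> h = (\<lambda>x. c * f (a * x + b))"
    then obtain f c where f: "smooth f" and h: "h = (\<lambda>x. c * f (a * x + b))"
      by blast
    have *: "(h has_real_derivative (c * a) * deriv f (a * x + b)) (at x)" for x
      unfolding h by (rule derivative_eq_intros DERIV_chain2[OF smooth_DERIV[OF f]] refl | simp)+
    then have "deriv h = (\<lambda>x. (c * a) * deriv f (a * x + b))"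
      using DERIV_imp_deriv by blast
    then show "(\<forall>x. h differentiable at x) \<and> (\<exists>f c. smooth f \<and> deriv h = (\<lambda>x. c * f (a * x + b)))"
      using * f smooth_deriv real_differentiable_def by blast
  qed (use assms in auto)
  from this[of 1] show ?thesis by simp
qed

text \<open>\<open>p(1/y) exp (-1/y)\<close> has derivative \<open>q(1/y) exp (-1/y)\<close> with \<open>q = X\<^sup>2 (p - p')\<close>.\<close>

definition flat :: "real poly \<Rightarrow> real \<Rightarrow> real" where
  "flat p y = (if y > 0 then poly p (1 / y) * exp (- (1 / y)) else 0)"

lemma poly_exp_tendsto_0: "((\<lambda>t::real. poly p t * exp (- t)) \<longlongrightarrow> 0) at_top"
proof -
  have "(\<lambda>t::real. poly p t * exp (- t)) = (\<lambda>t. \<Sum>i\<le>degree p. coeff p i * (t ^ i / exp t))"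
    by (auto simp: poly_altdef exp_minus sum_distrib_right sum_divide_distrib field_simps)
  moreover have "((\<lambda>t::real. \<Sum>i\<le>degree p. coeff p i * (t ^ i / exp t)) \<longlongrightarrow> 0) at_top"
    by (intro tendsto_null_sum tendsto_mult_right_zero tendsto_power_div_exp_0)
  ultimately show ?thesis by simp
qed

lemma flat_DERIV: "(flat p has_real_derivative flat ([:0,0,1:] * (p - pderiv p)) y) (at y)"
proof -
  consider "y < 0" | "y > 0" | "y = 0" by linarith
  then show ?thesis
  proof cases
    case 1
    have "((\<lambda>_. 0) has_real_derivative 0) (at y)" by simp
    then have "(flat p has_real_derivative 0) (at y)"
      by (rule has_field_derivative_transform_within_open[where S = "{..<0}"])
         (use 1 in \<open>auto simp: flat_def\<close>)
    then show ?thesis using 1 by (simp add: flat_def)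
  next
    case 2
    have "((\<lambda>y. poly p (1 / y) * exp (- (1 / y))) has_real_derivative
        (poly (pderiv p) (1/y) * (- (1 / y^2))) * exp (- (1 / y)) + poly p (1/y) * (exp (- (1/y)) * (1 / y^2))) (at y)"
      by (rule derivative_eq_intros DERIV_chain2[OF poly_DERIV] refl | use 2 in \<open>simp add: power2_eq_square field_simps\<close>)+
    moreover have "(poly (pderiv p) (1/y) * (- (1 / y^2))) * exp (- (1 / y)) + poly p (1/y) * (exp (- (1/y)) * (1 / y^2))
        = flat ([:0,0,1:] * (p - pderiv p)) y"
      using 2 by (simp add: flat_def power2_eq_square field_simps)
    ultimately have "((\<lambda>y. poly p (1 / y) * exp (- (1 / y))) has_real_derivative flat ([:0,0,1:] * (p - pderiv p)) y) (at y)"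
      by simp
    then show ?thesis
      by (rule has_field_derivative_transform_within_open[where S = "{0<..}"])
         (use 2 in \<open>auto simp: flat_def\<close>)
  next
    case 3
    have "((\<lambda>h. flat p h / h) \<longlongrightarrow> 0) (at_left 0)"
      by (rule tendsto_eventually) (auto simp: eventually_at_filter flat_def)
    moreover have "((\<lambda>h. flat p h / h) \<longlongrightarrow> 0) (at_right 0)"
    proof -
      \<comment> \<open>With \<open>t = 1 / h\<close> the quotient \<open>flat p h / h\<close> is
        \<open>t * poly p t * exp (- t)\<close>, hence the shifted polynomial
        \<open>pCons 0 p\<close>.\<close>
      have "((\<lambda>h::real. poly (pCons 0 p) (inverse h) * exp (- inverse h)) \<longlongrightarrow> 0) (at_right 0)"
        by (rule filterlim_compose[OF poly_exp_tendsto_0 filterlim_inverse_at_top_right])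
      then show ?thesis
        by (rule Lim_transform_eventually)
           (auto simp: eventually_at_filter flat_def field_simps)
    qed
    ultimately have "((\<lambda>h. flat p h / h) \<longlongrightarrow> 0) (at 0)"
      using filterlim_split_at by blast
    then show ?thesis
      using 3 by (simp add: flat_def has_field_derivative_iff)
  qed
qed

lemma smooth_flat: "smooth (flat p)"
proof (rule smooth_coinduct[where P = "\<lambda>f. \<exists>p. f = flat p"])
  fix f assume "\<exists>p. f = flat p"
  then obtain p where f: "f = flat p" by blast
  have "deriv f = flat ([:0,0,1:] * (p - pderiv p))"
    unfolding f using flat_DERIV DERIV_imp_deriv by blast
  then show "(\<forall>x. f differentiable at x) \<and> (\<exists>p. deriv f = flat p)"
    using f flat_DERIV real_differentiable_def by blast
qed auto

text \<open>\<open>flat 1 y\<close> is \<open>exp (- (1 / y))\<close> for positive \<open>y\<close>.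
  The factor \<open>Suc n\<close>, positive from the start, steepens both edges, so that the bumps
  approach the indicator of the open interval from below.\<close>

definition bump :: "real \<Rightarrow> real \<Rightarrow> nat \<Rightarrow> real \<Rightarrow> real" where
  "bump a b n x = flat 1 (real (Suc n) * (x - a)) * flat 1 (real (Suc n) * (b - x))"

lemma test_fun_alt: "test_fun \<phi> \<longleftrightarrow> smooth \<phi> \<and> (\<exists>R. \<forall>x. R \<le> \<bar>x\<bar> \<longrightarrow> \<phi> x = 0)"
  by (auto simp: test_fun_def smooth_def)

lemma bump_nonneg: "0 \<le> bump a b n x"
  and bump_le: "bump a b n x \<le> indicator {a..b} x"
proof -
  have flat: "0 \<le> flat 1 y" "flat 1 y \<le> 1" "y < 0 \<Longrightarrow> flat 1 y = 0" for y
    by (auto simp: flat_def)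
  show "0 \<le> bump a b n x"
    by (simp add: bump_def flat)
  show "bump a b n x \<le> indicator {a..b} x"
  proof (cases "x \<in> {a..b}")
    case True
    then show ?thesis by (simp add: bump_def flat mult_le_one)
  next
    case False
    then have "real (Suc n) * (x - a) < 0 \<or> real (Suc n) * (b - x) < 0"
      by (auto simp: mult_less_0_iff)
    then show ?thesis using False flat(3) by (auto simp: bump_def)
  qed
qed

lemma bump_pos: "a < x \<Longrightarrow> x < b \<Longrightarrow> 0 < bump a b n x"
  by (auto simp: bump_def flat_def zero_less_mult_iff)

lemma bump_tendsto: "(\<lambda>n. bump a b n x) \<longlonglongrightarrow> indicator {a<..<b} x"
proof (cases "x \<in> {a<..<b}")
  case True
  have lim: "(\<lambda>n. 1 / (real (Suc n) * c)) \<longlonglongrightarrow> 0" if "c > 0" for c :: real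
  proof -
    have "(\<lambda>n. (1 / c) * inverse (real (Suc n))) \<longlonglongrightarrow> (1 / c) * 0"
      by (intro tendsto_intros LIMSEQ_inverse_real_of_nat)
    then show ?thesis by (simp add: field_simps)
  qed
  have "(\<lambda>n. exp (- (1 / (real (Suc n) * (x - a)))) * exp (- (1 / (real (Suc n) * (b - x)))))
      \<longlonglongrightarrow> exp (- 0) * exp (- 0)"
    by (intro tendsto_intros lim) (use True in auto)
  moreover have "bump a b n x = exp (- (1 / (real (Suc n) * (x - a)))) * exp (- (1 / (real (Suc n) * (b - x))))" for n
    using True by (simp add: bump_def flat_def zero_less_mult_iff del: of_nat_Suc)
  ultimately show ?thesis using True by (simp del: of_nat_Suc)
next
  case False
  then have "bump a b n x = 0" for n
    by (auto simp: bump_def flat_def zero_less_mult_iff)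
  then show ?thesis using False by simp
qed

lemma test_fun_bump: "test_fun (bump a b n)"
proof -
  have "smooth (\<lambda>x. flat 1 (real (Suc n) * x + - (real (Suc n) * a)) * flat 1 (- real (Suc n) * x + real (Suc n) * b))"
    by (intro smooth_mult smooth_affine smooth_flat)
  also have "(\<lambda>x. flat 1 (real (Suc n) * x + - (real (Suc n) * a)) * flat 1 (- real (Suc n) * x + real (Suc n) * b)) = bump a b n"
    by (auto simp: bump_def algebra_simps)
  finally have "smooth (bump a b n)" .
  moreover have "bump a b n x = 0" if "\<bar>a\<bar> + \<bar>b\<bar> + 1 \<le> \<bar>x\<bar>" for x
  proof -
    have "x \<notin> {a..b}" using that by auto
    then show ?thesis
      using bump_nonneg[of a b n x] bump_le[of a b n x] by simp
  qed
  ultimately show ?thesis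
    unfolding test_fun_alt by blast
qed

section \<open>Calculus of compactly supported test functions\<close>

lemma test_fun_smooth: "test_fun \<phi> \<Longrightarrow> smooth \<phi>"
  by (simp add: test_fun_alt)

lemma test_fun_supp:
  assumes "test_fun \<phi>" obtains R where "R > 0" "\<And>x. R \<le> \<bar>x\<bar> \<Longrightarrow> \<phi> x = 0"
proof -
  obtain R where "\<forall>x. R \<le> \<bar>x\<bar> \<longrightarrow> \<phi> x = 0"
    using assms test_fun_def by blast
  then show ?thesis
    by (intro that[of "max R 1"]) auto
qed

lemma test_fun_add_scaled:
  assumes "test_fun f" "test_fun g" shows "test_fun (\<lambda>x. f x + c * g x)"
proof -
  obtain R S where "\<And>x. R \<le> \<bar>x\<bar> \<Longrightarrow> f x = 0" "\<And>x. S \<le> \<bar>x\<bar> \<Longrightarrow> g x = 0"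
    using assms test_fun_supp by metis
  then have "\<forall>x. max R S \<le> \<bar>x\<bar> \<longrightarrow> f x + c * g x = 0" by simp
  then show ?thesis
    using assms smooth_add_scaled unfolding test_fun_alt by blast
qed

lemma test_fun_deriv:
  assumes "test_fun f" shows "test_fun (deriv f)"
proof -
  obtain R where R: "R > 0" "\<And>x. R \<le> \<bar>x\<bar> \<Longrightarrow> f x = 0"
    using assms test_fun_supp by metis
  have "deriv f x = 0" if "R + 1 \<le> \<bar>x\<bar>" for x
  proof -
    have "((\<lambda>_. 0) has_real_derivative 0) (at x)" by simp
    then have "(f has_real_derivative 0) (at x)"
      by (rule has_field_derivative_transform_within_open[where S = "- {-R..R}"])
         (use that R in auto)
    then show ?thesis by (rule DERIV_imp_deriv)
  qed
  then show ?thesis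
    using assms smooth_deriv unfolding test_fun_alt by blast
qed

lemma test_fun_integrable:
  assumes "test_fun f" shows "integrable lborel f"
proof -
  obtain R where R: "R > 0" "\<And>x. R \<le> \<bar>x\<bar> \<Longrightarrow> f x = 0"
    using assms test_fun_supp by metis
  have "set_integrable lborel {-R..R} f"
    by (intro borel_integrable_atLeastAtMost') (simp add: assms smooth_continuous test_fun_smooth)
  moreover have "(\<lambda>x. indicator {-R..R} x *\<^sub>R f x) = f"
    using R(2) by (force simp: indicator_def)
  ultimately show ?thesis by (simp add: set_integrable_def)
qed

text \<open>A primitive is constant on either side of the support. Normalised to vanish on the left,
  it equals the total integral on the right, so mean zero is what gives it compact support.\<close>

lemma test_fun_antiderivative:
  assumes "test_fun f" "(LINT x|lborel. f x) = 0"
  obtains F where "test_fun F" "deriv F = f"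
proof -
  obtain R where R: "R > 0" "\<And>x. R \<le> \<bar>x\<bar> \<Longrightarrow> f x = 0"
    using assms test_fun_supp by metis
  have "\<exists>F. \<forall>x::real. -\<infinity> < ereal x \<longrightarrow> ereal x < \<infinity> \<longrightarrow> (F has_vector_derivative f x) (at x)"
    by (rule einterval_antiderivative)
       (use assms smooth_continuous[of f UNIV] in \<open>auto simp: test_fun_smooth continuous_on_eq_continuous_at\<close>)
  then obtain G where G: "\<And>x. (G has_real_derivative f x) (at x)"
    by (auto simp: has_real_derivative_iff_has_vector_derivative)
  define F where "F x = G x - G (- R)" for x
  have F: "(F has_real_derivative f x) (at x)" for x
    unfolding F_def by (rule derivative_eq_intros G refl | simp)+
  have ftc: "F b - F a = (LINT x|lborel. indicator {a..b} x *\<^sub>R f x)" if "a \<le> b" for a b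
    by (rule integral_FTC_atLeastAtMost[symmetric])
      (use that F assms smooth_continuous in \<open>auto simp: test_fun_smooth
         simp flip: has_real_derivative_iff_has_vector_derivative intro: has_field_derivative_at_within\<close>)
  have F0: "F (- R) = 0" by (simp add: F_def)
  have "F x = 0" if "R \<le> \<bar>x\<bar>" for x
  proof (cases "x \<le> 0")
    case True
    have "indicator {x..-R} y *\<^sub>R f y = 0" for y
      using R(1) by (auto simp: indicator_def R(2))
    moreover have "F (-R) - F x = (LINT y|lborel. indicator {x..-R} y *\<^sub>R f y)"
      using that True by (intro ftc) auto
    ultimately have "F (-R) - F x = 0"
      by (simp only: Bochner_Integration.integral_zero)
    then show ?thesis using F0 by simp
  next
    case False
    have out: "f y = 0" if "y \<notin> {-R..x}" for y
      using that \<open>R \<le> \<bar>x\<bar>\<close> False by (intro R(2)) auto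
    have "F x - F (-R) = (LINT y|lborel. indicator {-R..x} y *\<^sub>R f y)"
      using that False R(1) by (intro ftc) auto
    also have "\<dots> = (LINT y|lborel. f y)"
      by (intro Bochner_Integration.integral_cong) (use out in \<open>auto simp: indicator_def\<close>)
    finally show ?thesis using F0 assms(2) by simp
  qed
  moreover have "smooth F"
    using smooth_antiderivative F assms test_fun_smooth by blast
  moreover have "deriv F = f"
    using F DERIV_imp_deriv by blast
  ultimately show ?thesis
    using that test_fun_alt by blast
qed

section \<open>Absolutely continuous functions and weak derivatives\<close>

text \<open>The bound on \<open>h\<close> is asked only where \<open>f\<close> does not vanish, so
  that a merely locally bounded \<open>h\<close> may multiply an integrand cut off to an
  interval.\<close>

lemma integrable_mult_bounded:
  fixes f h :: "'a \<Rightarrow> real"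
  assumes "integrable M f" "h \<in> borel_measurable M" "\<And>x. f x \<noteq> 0 \<Longrightarrow> \<bar>h x\<bar> \<le> B"
  shows "integrable M (\<lambda>x. h x * f x)"
proof (rule Bochner_Integration.integrable_bound[of M "\<lambda>x. B * f x"])
  show "AE x in M. norm (h x * f x) \<le> norm (B * f x)"
  proof (rule AE_I2)
    fix x show "norm (h x * f x) \<le> norm (B * f x)"
      using assms(3)[of x] by (cases "f x = 0") (auto simp: abs_mult intro!: mult_right_mono)
  qed
qed (use assms in auto)

text \<open>Local absolute continuity, with the fundamental theorem of calculus taken as the
  definition. It admits a locally integrable \<open>f\<close> that need not be a pointwise
  derivative, and it singles out the continuous representative of a weakly differentiable
  function.\<close>

definition has_ac_deriv :: "(real \<Rightarrow> real) \<Rightarrow> (real \<Rightarrow> real) \<Rightarrow> bool" where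
  "has_ac_deriv F f \<longleftrightarrow> (\<forall>a b. a \<le> b \<longrightarrow>
     set_integrable lborel {a..b} f \<and> F b - F a = (LINT x:{a..b}|lborel. f x))"

lemma ac_integrable: "has_ac_deriv F f \<Longrightarrow> set_integrable lborel {a..b} f"
  unfolding has_ac_deriv_def by (cases "a \<le> b") (auto simp: set_integrable_def)

lemma ac_increment: "has_ac_deriv F f \<Longrightarrow> a \<le> b \<Longrightarrow> F b - F a = (LINT x:{a..b}|lborel. f x)"
  by (simp add: has_ac_deriv_def)

lemma ac_continuous:
  assumes "has_ac_deriv F f" shows "continuous_on S F"
proof -
  have "isCont F x" for x
  proof -
    have "f integrable_on {x-1..x+1}"
      using assms ac_integrable set_borel_integral_eq_integral(1) by blast
    then have "continuous_on {x-1..x+1} (\<lambda>y. F (x-1) + integral {x-1..y} f)"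
      by (intro continuous_intros indefinite_integral_continuous_1)
    moreover have "F (x-1) + integral {x-1..y} f = F y" if "y \<in> {x-1..x+1}" for y
      using ac_increment[OF assms, of "x-1" y] ac_integrable[OF assms, of "x-1" y] that
      by (simp add: set_borel_integral_eq_integral(2))
    ultimately have "continuous_on {x-1..x+1} F"
      by (rule continuous_on_eq)
    then show ?thesis
      by (rule continuous_on_interior) simp
  qed
  then show ?thesis
    by (simp add: continuous_at_imp_continuous_on)
qed

lemma ac_measurable: "has_ac_deriv F f \<Longrightarrow> F \<in> borel_measurable borel"
  by (simp add: ac_continuous borel_measurable_continuous_onI)

lemma set_integrable_mult_continuous:
  fixes f h :: "real \<Rightarrow> real"
  assumes "set_integrable lborel {a..b} f" "continuous_on UNIV h"
  shows "set_integrable lborel {a..b} (\<lambda>x. h x * f x)"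
proof -
  have "compact (h ` {a..b})"
    by (intro compact_continuous_image continuous_on_subset[OF assms(2)]) auto
  then obtain B where B: "\<And>x. x \<in> {a..b} \<Longrightarrow> \<bar>h x\<bar> \<le> B"
    by (meson bounded_real compact_imp_bounded image_eqI)
  have "integrable lborel (\<lambda>x. h x * (indicator {a..b} x *\<^sub>R f x))"
    by (rule integrable_mult_bounded[where B = B])
       (use assms B in \<open>auto simp: set_integrable_def indicator_def borel_measurable_continuous_onI split: if_splits\<close>)
  then show ?thesis
    by (simp add: set_integrable_def mult_ac)
qed

text \<open>Fubini on the square: the product of the two increments is the double integral of
  \<open>f x * g y\<close>. Cut along the diagonal, the triangle \<open>y \<le> x\<close> gives the
  integral of \<open>(G - G a) f\<close> and the triangle \<open>x < y\<close> that of
  \<open>(F - F a) g\<close>; expanding both yields the product rule.\<close>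

lemma ac_mult:
  assumes F: "has_ac_deriv F f" and G: "has_ac_deriv G g"
  shows "has_ac_deriv (\<lambda>x. F x * G x) (\<lambda>x. G x * f x + F x * g x)"
  unfolding has_ac_deriv_def
proof (intro allI impI conjI)
  fix a b :: real assume "a \<le> b"
  have int1: "set_integrable lborel {a..b} (\<lambda>x. G x * f x)"
    by (intro set_integrable_mult_continuous ac_integrable[OF F] ac_continuous[OF G])
  have int2: "set_integrable lborel {a..b} (\<lambda>x. F x * g x)"
    by (intro set_integrable_mult_continuous ac_integrable[OF G] ac_continuous[OF F])
  show "set_integrable lborel {a..b} (\<lambda>x. G x * f x + F x * g x)"
    using set_integral_add(1)[OF int1 int2] .
  define f1 where "f1 = (\<lambda>x. indicator {a..b} x *\<^sub>R f x)"
  define g1 where "g1 = (\<lambda>x. indicator {a..b} x *\<^sub>R g x)"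
  have f1: "integrable lborel f1" and g1: "integrable lborel g1"
    using ac_integrable[OF F] ac_integrable[OF G] by (auto simp: f1_def g1_def set_integrable_def)
  note [measurable] = borel_measurable_integrable[OF f1] borel_measurable_integrable[OF g1]
  have Fx: "F x - F a = (LINT y|lborel. indicator {..x} y * f1 y)" if "x \<in> {a..b}" for x
    using ac_increment[OF F, of a x] that
    by (auto simp: set_lebesgue_integral_def f1_def indicator_def intro!: Bochner_Integration.integral_cong)
  have Gx: "G x - G a = (LINT y|lborel. indicator {..x} y * g1 y)" if "x \<in> {a..b}" for x
    using ac_increment[OF G, of a x] that
    by (auto simp: set_lebesgue_integral_def g1_def indicator_def intro!: Bochner_Integration.integral_cong)
  have prod: "integrable (lborel \<Otimes>\<^sub>M lborel) (\<lambda>(x, y). f1 x * g1 y)"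
  proof (rule lborel_pair.Fubini_integrable)
    show "integrable lborel (\<lambda>x. LINT y|lborel. norm (case (x, y) of (x, y) \<Rightarrow> f1 x * g1 y))"
      using f1 by (simp add: abs_mult)
  qed (use g1 in simp_all)
  \<comment> \<open>The order of integration is exchanged only on the triangle \<open>x < y\<close>,
    so integrability is recorded for this cut-off.\<close>
  have half: "integrable (lborel \<Otimes>\<^sub>M lborel) (\<lambda>(x, y). indicator {..<y} x * (f1 x * g1 y))"
  proof -
    have [measurable]: "{p::real \<times> real. fst p < snd p} \<in> sets (borel \<Otimes>\<^sub>M borel)"
      unfolding borel_prod by (intro borel_open open_Collect_less continuous_intros)
    have "integrable (lborel \<Otimes>\<^sub>M lborel) (\<lambda>p. indicator {p. fst p < snd p} p * (case p of (x, y) \<Rightarrow> f1 x * g1 y))"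
      by (rule integrable_mult_bounded[OF prod, where B = 1]) (auto simp: indicator_def)
    moreover have "(\<lambda>p. indicator {p. fst p < snd p} p * (case p of (x, y) \<Rightarrow> f1 x * g1 y))
        = (\<lambda>(x, y). indicator {..<y} x * (f1 x * g1 y))"
      by (auto simp: indicator_def)
    ultimately show ?thesis by simp
  qed
  have cut: "integrable lborel (\<lambda>y. indicator A y * h y)" if "integrable lborel h" "A \<in> sets borel"
    for A and h :: "real \<Rightarrow> real"
    using that integrable_mult_indicator[of A lborel h] by simp
  have inner: "f1 x * (LINT y|lborel. indicator {x<..} y * g1 y)
      = (LINT y|lborel. indicator {..<y} x * (f1 x * g1 y))" for x
    unfolding Bochner_Integration.integral_mult_right_zero[symmetric]
    by (intro Bochner_Integration.integral_cong refl) (auto simp: indicator_def)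
  have "(F b - F a) * (G b - G a) = (LINT x|lborel. f1 x * (LINT y|lborel. g1 y))"
    using ac_increment[OF F \<open>a \<le> b\<close>] ac_increment[OF G \<open>a \<le> b\<close>]
    by (simp add: f1_def g1_def set_lebesgue_integral_def)
  also have "\<dots> = (LINT x|lborel. f1 x * (LINT y|lborel. indicator {..x} y * g1 y)
      + f1 x * (LINT y|lborel. indicator {x<..} y * g1 y))"
  proof -
    have "(LINT y|lborel. g1 y) = (LINT y|lborel. indicator {..x} y * g1 y) + (LINT y|lborel. indicator {x<..} y * g1 y)" for x
    proof -
      have "(LINT y|lborel. g1 y) = (LINT y|lborel. indicator {..x} y * g1 y + indicator {x<..} y * g1 y)"
        by (intro Bochner_Integration.integral_cong refl) (auto simp: indicator_def)
      then show ?thesis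
        by (simp add: cut[OF g1])
    qed
    then have "f1 x * (LINT y|lborel. g1 y) = f1 x * (LINT y|lborel. indicator {..x} y * g1 y)
      + f1 x * (LINT y|lborel. indicator {x<..} y * g1 y)" for x
      by (metis distrib_left)
    then show ?thesis
      by (simp only:)
  qed
  also have "\<dots> = (LINT x|lborel. f1 x * (LINT y|lborel. indicator {..x} y * g1 y))
      + (LINT x|lborel. f1 x * (LINT y|lborel. indicator {x<..} y * g1 y))"
  proof (rule Bochner_Integration.integral_add)
    have eq: "f1 x * (LINT y|lborel. indicator {..x} y * g1 y) = (G x - G a) * f1 x" for x
      using Gx[of x] by (cases "x \<in> {a..b}") (auto simp: f1_def)
    have *: "integrable lborel (\<lambda>x. (G x - G a) * f1 x)"
      using set_integrable_mult_continuous[OF ac_integrable[OF F], of "\<lambda>x. G x - G a" a b]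
        ac_continuous[OF G] by (simp add: set_integrable_def f1_def mult_ac continuous_on_diff)
    then show "integrable lborel (\<lambda>x. f1 x * (LINT y|lborel. indicator {..x} y * g1 y))"
      unfolding eq .
    have "integrable lborel (\<lambda>x. LINT y|lborel. indicator {..<y} x * (f1 x * g1 y))"
      by (rule lborel_pair.integrable_fst[OF half])
    then show "integrable lborel (\<lambda>x. f1 x * (LINT y|lborel. indicator {x<..} y * g1 y))"
      unfolding inner .
  qed
  also have "(LINT x|lborel. f1 x * (LINT y|lborel. indicator {..x} y * g1 y))
      = (LINT x:{a..b}|lborel. (G x - G a) * f x)"
    unfolding set_lebesgue_integral_def
    by (intro Bochner_Integration.integral_cong refl) (auto simp: f1_def indicator_def Gx split: if_splits)
  also have "(LINT x|lborel. f1 x * (LINT y|lborel. indicator {x<..} y * g1 y))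
      = (LINT x|lborel. LINT y|lborel. indicator {..<y} x * (f1 x * g1 y))"
    unfolding inner ..
  also have "\<dots> = (LINT y|lborel. LINT x|lborel. indicator {..<y} x * (f1 x * g1 y))"
    by (rule lborel_pair.Fubini_integral[OF half, symmetric])
  also have "\<dots> = (LINT y|lborel. g1 y * (LINT x|lborel. indicator {..y} x * f1 x))"
  proof (intro Bochner_Integration.integral_cong refl)
    fix y
    \<comment> \<open>\<open>{..<y}\<close> and \<open>{..y}\<close> differ by a null set; the
      closed half-line is the one that \<open>Fx\<close> evaluates.\<close>
    have "(LINT x|lborel. indicator {..<y} x * (f1 x * g1 y)) = (LINT x|lborel. indicator {..y} x * (f1 x * g1 y))"
    proof (rule integral_cong_AE)
      show "AE x in lborel. indicator {..<y} x * (f1 x * g1 y) = indicator {..y} x * (f1 x * g1 y)"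
        using AE_lborel_singleton[of y] by eventually_elim (auto simp: indicator_def)
    qed simp_all
    also have "\<dots> = (LINT x|lborel. g1 y * (indicator {..y} x * f1 x))"
      by (intro Bochner_Integration.integral_cong refl) simp
    finally show "(LINT x|lborel. indicator {..<y} x * (f1 x * g1 y)) = g1 y * (LINT x|lborel. indicator {..y} x * f1 x)"
      by (simp only: Bochner_Integration.integral_mult_right_zero)
  qed
  also have "\<dots> = (LINT x:{a..b}|lborel. (F x - F a) * g x)"
    unfolding set_lebesgue_integral_def
    by (intro Bochner_Integration.integral_cong refl) (auto simp: g1_def indicator_def Fx split: if_splits)
  also have "(LINT x:{a..b}|lborel. (G x - G a) * f x) = (LINT x:{a..b}|lborel. G x * f x) - G a * (F b - F a)"
    using int1 ac_integrable[OF F, of a b] ac_increment[OF F \<open>a \<le> b\<close>] by (simp add: left_diff_distrib set_integral_diff)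
  also have "(LINT x:{a..b}|lborel. (F x - F a) * g x) = (LINT x:{a..b}|lborel. F x * g x) - F a * (G b - G a)"
    using int2 ac_integrable[OF G, of a b] ac_increment[OF G \<open>a \<le> b\<close>] by (simp add: left_diff_distrib set_integral_diff)
  finally show "F b * G b - F a * G a = (LINT x:{a..b}|lborel. G x * f x + F x * g x)"
    using int1 int2 by (simp add: set_integral_add algebra_simps)
qed

lemma ac_DERIV:
  assumes "\<And>x. (F has_real_derivative f x) (at x)" "continuous_on UNIV f"
  shows "has_ac_deriv F f"
  unfolding has_ac_deriv_def
proof (intro allI impI conjI)
  fix a b :: real assume "a \<le> b"
  have c: "continuous_on {a..b} f"
    using assms(2) continuous_on_subset by blast
  then show "set_integrable lborel {a..b} f"
    by (rule borel_integrable_atLeastAtMost')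
  show "F b - F a = (LINT x:{a..b}|lborel. f x)"
    unfolding set_lebesgue_integral_def
    by (rule integral_FTC_atLeastAtMost[symmetric])
      (use \<open>a \<le> b\<close> c assms(1) in \<open>auto simp flip: has_real_derivative_iff_has_vector_derivative
         intro: has_field_derivative_at_within\<close>)
qed

lemma ac_add: "has_ac_deriv F f \<Longrightarrow> has_ac_deriv G g \<Longrightarrow> has_ac_deriv (\<lambda>x. F x + G x) (\<lambda>x. f x + g x)"
  unfolding has_ac_deriv_def by (auto simp: set_integral_add add_diff_add)

lemma ac_const: "has_ac_deriv (\<lambda>x. c) (\<lambda>x. 0)"
  by (rule ac_DERIV) auto

section \<open>Primitives, the fundamental lemma and regularity of weakly differentiable
  functions\<close>

lemma ac_exists:
  fixes g :: "real \<Rightarrow> real"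
  assumes g: "\<And>a b. set_integrable lborel {a..b} g"
  shows "\<exists>G. has_ac_deriv G g"
proof
  have *: "interval_lebesgue_integrable lborel (ereal a) (ereal b) g" for a b
    using g[of a b] g[of b a] by (auto simp: interval_lebesgue_integrable_def einterval_eq_Icc intro: set_integrable_subset)
  have "(LBINT x=0..a. g x) + (LBINT x=a..b. g x) = (LBINT x=0..b. g x)" for a b :: real
    unfolding zero_ereal_def by (rule interval_integral_sum) (simp add: * flip: ereal_min ereal_max)
  then show "has_ac_deriv (\<lambda>x. LBINT y=0..ereal x. g y) g"
    unfolding has_ac_deriv_def using g interval_integral_Icc by (metis add_diff_cancel_left')
qed

text \<open>The symmetric increments \<open>D x = K x - K (- x)\<close> tend to the integral
  \<open>l\<close> of \<open>k\<close> by dominated convergence. If \<open>l\<close> were nonzero,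
  \<open>\<bar>D\<bar>\<close> would exceed \<open>\<bar>l\<bar> / 2\<close> on a half-line,
  although \<open>D\<close> is integrable. This is how boundary terms at infinity disappear without
  pointwise decay of \<open>K\<close>.\<close>

lemma ac_integral_zero:
  assumes K: "has_ac_deriv K k" "integrable lborel K" "integrable lborel k"
  shows "(LINT x|lborel. k x) = 0"
proof (rule ccontr)
  define l where "l = (LINT x|lborel. k x)"
  define D where "D x = K x - K (- x)" for x
  assume "(LINT x|lborel. k x) \<noteq> 0"
  then have l: "\<bar>l\<bar> > 0" by (simp add: l_def)
  have "((\<lambda>x. LINT y|lborel. indicator {-x..x} y *\<^sub>R k y) \<longlongrightarrow> l) at_top"
    unfolding l_def
  proof (rule integral_dominated_convergence_at_top[where w = "\<lambda>y. \<bar>k y\<bar>"])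
    show "AE y in lborel. ((\<lambda>x. indicator {-x..x} y *\<^sub>R k y) \<longlongrightarrow> k y) at_top"
    proof (rule AE_I2, rule tendsto_eventually)
      fix y show "\<forall>\<^sub>F x in at_top. indicator {-x..x} y *\<^sub>R k y = k y"
        using eventually_ge_at_top[of "\<bar>y\<bar>"] by eventually_elim (auto simp: indicator_def)
    qed
  qed (use K in \<open>auto simp: indicator_def\<close>)
  moreover have "\<forall>\<^sub>F x in at_top. (LINT y|lborel. indicator {-x..x} y *\<^sub>R k y) = D x"
    using eventually_ge_at_top[of 0]
    by eventually_elim (use ac_increment[OF K(1)] in \<open>auto simp: D_def set_lebesgue_integral_def\<close>)
  ultimately have "(D \<longlongrightarrow> l) at_top"
    by (rule Lim_transform_eventually)
  then have "\<forall>\<^sub>F x in at_top. dist (D x) l < \<bar>l\<bar> / 2"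
    by (rule tendstoD) (use l in simp)
  then obtain N where N: "\<And>x. x \<ge> N \<Longrightarrow> dist (D x) l < \<bar>l\<bar> / 2"
    by (auto simp: eventually_at_top_linorder)
  have intD: "integrable lborel D"
    unfolding D_def using lborel_integrable_real_affine[OF K(2), of "-1" 0]
    by (intro Bochner_Integration.integrable_diff K) auto
  have "real n * (\<bar>l\<bar> / 2) \<le> (LINT x|lborel. \<bar>D x\<bar>)" for n :: nat
  proof -
    have "real n * (\<bar>l\<bar> / 2) = (LINT x|lborel. indicator {N..N+n} x * (\<bar>l\<bar> / 2))"
      by simp
    also have "\<dots> \<le> (LINT x|lborel. \<bar>D x\<bar>)"
    proof (rule integral_mono)
      fix x show "indicator {N..N+n} x * (\<bar>l\<bar> / 2) \<le> \<bar>D x\<bar>"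
        using N[of x] by (cases "x \<in> {N..N+n}") (auto simp: dist_real_def abs_if split: if_splits)
    qed (use intD in auto)
    finally show ?thesis .
  qed
  moreover obtain n :: nat where "(LINT x|lborel. \<bar>D x\<bar>) < real n * (\<bar>l\<bar> / 2)"
    using l reals_Archimedean3[of "\<bar>l\<bar> / 2"] by auto
  ultimately show False by (meson not_le)
qed

text \<open>After truncation to \<open>[-N, N]\<close>, the sets over which the integral vanishes
  contain the closed intervals and are stable under complements and countable disjoint unions, hence
  are all Borel sets; a function with this property is zero almost everywhere.\<close>

lemma AE_zero_if_interval_integrals_zero:
  fixes k :: "real \<Rightarrow> real"
  assumes k: "\<And>a b. set_integrable lborel {a..b} k"
    and zero: "\<And>a b. a \<le> b \<Longrightarrow> (LINT x:{a..b}|lborel. k x) = 0"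
  shows "AE x in lborel. k x = 0"
proof -
  have "AE x in lborel. indicator {-real N..real N} x * k x = 0" for N
  proof -
    define h where "h x = indicator {-real N..real N} x * k x" for x
    have h: "integrable lborel h"
      using k[of "-real N" "real N"] by (simp add: h_def[abs_def] set_integrable_def)
    have sh: "set_integrable lborel A h" if "A \<in> sets borel" for A
      using integrable_mult_indicator[of A lborel h] h that by (simp add: set_integrable_def)
    have Icc: "(LINT x:{a..b}|lborel. h x) = 0" for a b
    proof -
      have "(LINT x:{a..b}|lborel. h x) = (LINT x:{max a (-real N)..min b (real N)}|lborel. k x)"
        unfolding set_lebesgue_integral_def h_def
        by (intro Bochner_Integration.integral_cong refl) (auto simp: indicator_def)
      also have "\<dots> = 0"
        using zero[of "max a (-real N)" "min b (real N)"]
        by (cases "max a (-real N) \<le> min b (real N)") (simp_all add: set_lebesgue_integral_def)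
      finally show ?thesis .
    qed
    \<comment> \<open>The vanishing total integral is what lets the induction pass to
      complements.\<close>
    have all: "(LINT x|lborel. h x) = 0"
      using Icc[of "-real N" "real N"]
      by (simp add: set_lebesgue_integral_def h_def flip: mult.assoc indicator_inter_arith)
    have "(LINT x:A|lborel. h x) = 0" if "A \<in> sets borel" for A
      using that
    proof (induction rule: borel_set_induct)
      case (compl A)
      have "(LINT x:A \<union> - A|lborel. h x) = (LINT x:A|lborel. h x) + (LINT x:- A|lborel. h x)"
        by (rule set_integral_Un) (use sh compl in auto)
      then show ?case using compl all by (simp add: set_lebesgue_integral_def)
    next
      case (union f)
      have "(LINT x:(\<Union>i. f i)|lborel. h x) = (\<Sum>i. LINT x:f i|lborel. h x)"
        by (rule lebesgue_integral_countable_add) (use union in \<open>auto simp: disjoint_family_on_def intro!: sh\<close>)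
      then show ?case using union by simp
    qed (simp_all add: Icc, simp add: set_lebesgue_integral_def)
    then have "AE x in lborel. h x = 0"
      by (intro density_unique_real h) (auto simp: set_lebesgue_integral_def)
    then show ?thesis by (simp add: h_def)
  qed
  then have "AE x in lborel. \<forall>N. indicator {-real N..real N} x * k x = 0"
    unfolding AE_all_countable by (rule allI)
  then show ?thesis
  proof eventually_elim
    case (elim x)
    obtain N :: nat where "\<bar>x\<bar> \<le> real N" using real_arch_simple by blast
    then show ?case using elim[rule_format, of N] by (auto simp: indicator_def split: if_splits)
  qed
qed

lemma integrable_mult_test_fun:
  fixes k :: "real \<Rightarrow> real"
  assumes k: "\<And>a b. set_integrable lborel {a..b} k" and "test_fun \<phi>"
  shows "integrable lborel (\<lambda>x. k x * \<phi> x)"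
proof -
  obtain R where R: "R > 0" "\<And>x. R \<le> \<bar>x\<bar> \<Longrightarrow> \<phi> x = 0"
    using assms test_fun_supp by metis
  have "set_integrable lborel {-R..R} (\<lambda>x. \<phi> x * k x)"
    using assms by (intro set_integrable_mult_continuous smooth_continuous test_fun_smooth)
  moreover have "(\<lambda>x. indicator {-R..R} x *\<^sub>R (\<phi> x * k x)) = (\<lambda>x. k x * \<phi> x)"
    using R(2) by (force simp: indicator_def)
  ultimately show ?thesis by (simp add: set_integrable_def)
qed

text \<open>Bumps converge to the indicator of an open interval and are dominated by that of the
  closed one, so testing with them determines all interval integrals of \<open>k\<close>.\<close>

lemma fundamental_lemma:
  fixes k :: "real \<Rightarrow> real"
  assumes k: "\<And>a b. set_integrable lborel {a..b} k"
    and zero: "\<And>\<phi>. test_fun \<phi> \<Longrightarrow> (LINT x|lborel. k x * \<phi> x) = 0"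
  shows "AE x in lborel. k x = 0"
proof (rule AE_zero_if_interval_integrals_zero[OF k])
  fix a b :: real assume "a \<le> b"
  have ki: "integrable lborel (\<lambda>x. indicator {a..b} x *\<^sub>R k x)"
    using k by (simp add: set_integrable_def)
  have ki': "integrable lborel (\<lambda>x. indicator {a<..<b} x *\<^sub>R k x)"
    using set_integrable_subset[OF k[of a b], of "{a<..<b}"]
    by (auto simp: set_integrable_def greaterThanLessThan_subseteq_atLeastAtMost_iff)
  have "(\<lambda>n. LINT x|lborel. k x * bump a b n x) \<longlonglongrightarrow> (LINT x|lborel. indicator {a<..<b} x *\<^sub>R k x)"
  proof (rule integral_dominated_convergence[where w = "\<lambda>x. norm (indicator {a..b} x *\<^sub>R k x)"])
    show "AE x in lborel. (\<lambda>n. k x * bump a b n x) \<longlonglongrightarrow> indicator {a<..<b} x *\<^sub>R k x"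
      using tendsto_mult_left[OF bump_tendsto] by (auto simp: mult.commute)
    show "AE x in lborel. norm (k x * bump a b n x) \<le> norm (indicator {a..b} x *\<^sub>R k x)" for n
    proof (rule AE_I2)
      fix x
      have "\<bar>bump a b n x\<bar> \<le> \<bar>indicator {a..b} x\<bar>"
        using bump_le[of a b n x] bump_nonneg[of a b n x] by simp
      then show "norm (k x * bump a b n x) \<le> norm (indicator {a..b} x *\<^sub>R k x)"
        by (simp add: abs_mult mult.commute mult_left_mono)
    qed
    show "(\<lambda>x. k x * bump a b n x) \<in> borel_measurable lborel" for n
      using integrable_mult_test_fun[OF k test_fun_bump] by (rule borel_measurable_integrable)
  qed (use ki ki' in auto)
  then have "(LINT x|lborel. indicator {a<..<b} x *\<^sub>R k x) = 0"
    by (simp add: zero test_fun_bump LIMSEQ_const_iff)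
  moreover have "(LINT x:{a..b}|lborel. k x) = (LINT x:{a<..<b}|lborel. k x)"
    by (rule set_integral_discrete_difference[where X = "{a, b}"]) auto
  ultimately show "(LINT x:{a..b}|lborel. k x) = 0"
    by (simp add: set_lebesgue_integral_def)
qed

text \<open>The du Bois-Reymond argument: for a primitive \<open>G\<close> of \<open>g\<close>, the
  difference \<open>k = f - G\<close> is orthogonal to the derivatives of test functions, that is to
  the test functions of mean zero. Subtracting a multiple of one fixed bump gives any test function
  mean zero, whence \<open>k\<close> is constant almost everywhere.\<close>

lemma has_weak_deriv_ac:
  assumes f: "\<And>a b. set_integrable lborel {a..b} f" and g: "\<And>a b. set_integrable lborel {a..b} g"
    and weak: "has_weak_deriv f g"
  shows "\<exists>F. has_ac_deriv F g \<and> (AE x in lborel. f x = F x)"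
proof -
  obtain G where G: "has_ac_deriv G g" using ac_exists[OF g] by blast
  have Gi: "set_integrable lborel {a..b} G" for a b
    by (intro borel_integrable_atLeastAtMost' ac_continuous[OF G])
  define k where "k x = f x - G x" for x
  have k: "set_integrable lborel {a..b} k" for a b
    unfolding k_def by (intro set_integral_diff f Gi)
  have kd: "(LINT x|lborel. k x * deriv \<phi> x) = 0" if \<phi>: "test_fun \<phi>" for \<phi>
  proof -
    have "has_ac_deriv (\<lambda>x. G x * \<phi> x) (\<lambda>x. \<phi> x * g x + G x * deriv \<phi> x)"
      using \<phi> by (intro ac_mult G ac_DERIV smooth_DERIV smooth_continuous smooth_deriv test_fun_smooth)
    moreover have i: "integrable lborel (\<lambda>x. g x * \<phi> x)" "integrable lborel (\<lambda>x. G x * deriv \<phi> x)"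
      "integrable lborel (\<lambda>x. f x * deriv \<phi> x)"
      using \<phi> by (intro integrable_mult_test_fun f g Gi test_fun_deriv; assumption)+
    ultimately have "(LINT x|lborel. \<phi> x * g x + G x * deriv \<phi> x) = 0"
      by (intro ac_integral_zero[OF _ integrable_mult_test_fun[OF Gi \<phi>]]
            Bochner_Integration.integrable_add) (simp_all add: mult.commute[of "\<phi> _"])
    then have "(LINT x|lborel. g x * \<phi> x) + (LINT x|lborel. G x * deriv \<phi> x) = 0"
      using i by (simp add: mult.commute)
    then show ?thesis
      using weak \<phi> i by (simp add: has_weak_deriv_def k_def left_diff_distrib)
  qed
  define \<rho>0 where "\<rho>0 = bump 0 1 0"
  have \<rho>0: "test_fun \<rho>0" by (simp add: \<rho>0_def test_fun_bump)
  define m where "m = (LINT x|lborel. \<rho>0 x)"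
  have "m \<noteq> 0"
  proof
    assume "m = 0"
    then have "AE x in lborel. \<rho>0 x = 0"
      using integral_nonneg_eq_0_iff_AE[OF test_fun_integrable[OF \<rho>0]]
      by (simp add: m_def \<rho>0_def bump_nonneg)
    then have "AE x in lborel. x \<notin> {0<..<1::real}"
      by eventually_elim (use bump_pos[of 0 _ 1 0] in \<open>force simp: \<rho>0_def\<close>)
    then have "{0<..<1::real} \<in> null_sets lborel"
      by (simp add: AE_iff_null_sets)
    then show False by (simp add: null_sets_def)
  qed
  \<comment> \<open>The value of the constant is forced by testing \<open>k\<close> with the bump
    itself.\<close>
  define c where "c = (LINT x|lborel. k x * \<rho>0 x) / m"
  have "AE x in lborel. k x - c = 0"
  proof (rule fundamental_lemma)
    show "set_integrable lborel {a..b} (\<lambda>x. k x - c)" for a b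
      by (intro set_integral_diff k borel_integrable_atLeastAtMost') auto
    fix \<eta> assume \<eta>: "test_fun \<eta>"
    define e where "e = (LINT x|lborel. \<eta> x)"
    define \<zeta> where "\<zeta> x = \<eta> x + (- e / m) * \<rho>0 x" for x
    have \<zeta>: "test_fun \<zeta>"
      unfolding \<zeta>_def by (intro test_fun_add_scaled \<eta> \<rho>0)
    have "(LINT x|lborel. \<zeta> x) = e + (- e / m) * m"
      unfolding \<zeta>_def e_def m_def
      by (subst Bochner_Integration.integral_add) (auto simp: test_fun_integrable \<eta> \<rho>0)
    then obtain \<phi> where "test_fun \<phi>" "deriv \<phi> = \<zeta>"
      using test_fun_antiderivative[OF \<zeta>] \<open>m \<noteq> 0\<close> by auto
    then have "0 = (LINT x|lborel. k x * \<zeta> x)" using kd by auto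
    also have "\<dots> = (LINT x|lborel. k x * \<eta> x + (- e / m) * (k x * \<rho>0 x))"
      by (simp add: \<zeta>_def algebra_simps)
    also have "\<dots> = (LINT x|lborel. k x * \<eta> x) - c * e"
      by (subst Bochner_Integration.integral_add)
         (auto simp: integrable_mult_test_fun[OF k] \<eta> \<rho>0 c_def)
    also have "\<dots> = (LINT x|lborel. (k x - c) * \<eta> x)"
      using test_fun_integrable[OF \<eta>] integrable_mult_test_fun[OF k \<eta>]
      by (simp add: left_diff_distrib e_def)
    finally show "(LINT x|lborel. (k x - c) * \<eta> x) = 0" by simp
  qed
  then have "AE x in lborel. f x = G x + c"
    by eventually_elim (simp add: k_def)
  moreover have "has_ac_deriv (\<lambda>x. G x + c) g"
    using ac_add[OF G ac_const[of c]] by simp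
  ultimately show ?thesis by blast
qed

section \<open>Closure properties of square-integrable functions\<close>

lemma L2_integrable_mult:
  assumes "L2 f" "L2 g" shows "integrable lborel (\<lambda>x. f x * g x)"
proof (rule Bochner_Integration.integrable_bound)
  show "integrable lborel (\<lambda>x. (f x)\<^sup>2 + (g x)\<^sup>2)"
    using assms by (auto simp: L2_def)
  show "AE x in lborel. norm (f x * g x) \<le> norm ((f x)\<^sup>2 + (g x)\<^sup>2)"
  proof (rule AE_I2)
    fix x
    have "2 * (\<bar>f x\<bar> * \<bar>g x\<bar>) \<le> (f x)\<^sup>2 + (g x)\<^sup>2"
      using sum_squares_bound[of "\<bar>f x\<bar>" "\<bar>g x\<bar>"] by (simp add: mult.assoc)
    moreover have "0 \<le> \<bar>f x\<bar> * \<bar>g x\<bar>" by simp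
    ultimately have "\<bar>f x\<bar> * \<bar>g x\<bar> \<le> (f x)\<^sup>2 + (g x)\<^sup>2"
      by linarith
    then show "norm (f x * g x) \<le> norm ((f x)\<^sup>2 + (g x)\<^sup>2)"
      by (simp add: abs_mult)
  qed
qed (use assms in \<open>auto simp: L2_def\<close>)

lemma L2_add: assumes "L2 f" "L2 g" shows "L2 (\<lambda>x. f x + g x)"
  using L2_integrable_mult[OF assms] assms by (auto simp: L2_def power2_sum mult.assoc)

lemma L2_mult_bounded:
  assumes "L2 f" "b \<in> borel_measurable lborel" "\<And>x. \<bar>b x\<bar> \<le> B"
  shows "L2 (\<lambda>x. b x * f x)"
proof -
  have "integrable lborel (\<lambda>x. (b x)\<^sup>2 * (f x)\<^sup>2)"
  proof (rule integrable_mult_bounded[where B = "B\<^sup>2"])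
    show "\<bar>(b x)\<^sup>2\<bar> \<le> B\<^sup>2" for x
      using power_mono[OF assms(3), of x 2] by simp
  qed (use assms in \<open>auto simp: L2_def\<close>)
  then show ?thesis
    using assms by (auto simp: L2_def power_mult_distrib)
qed

lemma L2_scale: assumes "L2 f" shows "L2 (\<lambda>x. c * f x)"
  using assms by (intro L2_mult_bounded[where B = "\<bar>c\<bar>"]) auto

lemma L2_diff: assumes "L2 f" "L2 g" shows "L2 (\<lambda>x. f x - g x)"
  using L2_add[OF assms(1) L2_scale[OF assms(2), of "-1"]] by simp

lemma L2_zero: "L2 (\<lambda>x. 0)"
  by (simp add: L2_def)

lemma L2_cong_AE:
  assumes "L2 f" "g \<in> borel_measurable lborel" "AE x in lborel. f x = g x" shows "L2 g"
proof -
  have "integrable lborel (\<lambda>x. (g x)\<^sup>2)"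
    by (rule integrable_cong_AE_imp[of _ "\<lambda>x. (f x)\<^sup>2"]) (use assms in \<open>auto simp: L2_def\<close>)
  then show ?thesis using assms(2) by (simp add: L2_def)
qed

lemma integrable_indicator_Icc [simp]: "integrable lborel (indicator {a..b} :: real \<Rightarrow> real)"
  using integrable_real_indicator[of "{a..b}" lborel] by (simp add: emeasure_lborel_Icc_eq)

lemma L2_indicator: "L2 (indicator {a..b})"
  by (auto simp: L2_def power2_eq_square simp flip: indicator_inter_arith)

lemma L2_set_integrable:
  assumes "L2 f" shows "set_integrable lborel {a..b} f"
  using L2_integrable_mult[OF L2_indicator assms] by (simp add: set_integrable_def)

lemma L2_test_fun:
  assumes "test_fun \<phi>" shows "L2 \<phi>"
proof -
  have "integrable lborel (\<lambda>x. \<phi> x * \<phi> x)"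
    using assms smooth_continuous test_fun_smooth
    by (intro integrable_mult_test_fun borel_integrable_atLeastAtMost') blast+
  then show ?thesis
    using borel_measurable_integrable[OF test_fun_integrable[OF assms]]
    by (simp add: L2_def power2_eq_square)
qed

section \<open>Integration by parts, multipliers and a Poincare inequality in H^1\<close>

lemma H1_ac: "H1 f g \<Longrightarrow> \<exists>F. has_ac_deriv F g \<and> L2 F \<and> (AE x in lborel. f x = F x)"
  using has_weak_deriv_ac[of f g] L2_set_integrable L2_cong_AE ac_measurable
  unfolding H1_def by (metis measurable_lborel2 measurable_lborel1)

text \<open>The product of the two continuous representatives is integrable together with its
  density, so the integral of that density over the line vanishes.\<close>

lemma H1_skew:
  assumes "H1 f df" "H1 g dg"
  shows "(LINT x|lborel. df x * g x) = - (LINT x|lborel. f x * dg x)"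
proof -
  obtain F where F: "has_ac_deriv F df" "L2 F" and Fae: "AE x in lborel. f x = F x" using H1_ac assms by blast
  obtain G where G: "has_ac_deriv G dg" "L2 G" and Gae: "AE x in lborel. g x = G x" using H1_ac assms by blast
  have L2: "L2 f" "L2 df" "L2 g" "L2 dg" using assms by (auto simp: H1_def)
  have [measurable]: "f \<in> borel_measurable lborel" "df \<in> borel_measurable lborel" "g \<in> borel_measurable lborel"
    "dg \<in> borel_measurable lborel" "F \<in> borel_measurable lborel" "G \<in> borel_measurable lborel"
    using L2 F G by (auto simp: L2_def)
  have i: "integrable lborel (\<lambda>x. G x * df x)" "integrable lborel (\<lambda>x. F x * dg x)"
    by (intro L2_integrable_mult F G L2)+
  have "(LINT x|lborel. G x * df x + F x * dg x) = 0"
    by (rule ac_integral_zero[OF ac_mult[OF F(1) G(1)]])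
       (intro L2_integrable_mult F G Bochner_Integration.integrable_add i)+
  moreover have "(LINT x|lborel. df x * g x) = (LINT x|lborel. G x * df x)"
    by (rule integral_cong_AE) (use Gae in \<open>auto simp: mult.commute\<close>)
  moreover have "(LINT x|lborel. f x * dg x) = (LINT x|lborel. F x * dg x)"
    by (rule integral_cong_AE) (use Fae in auto)
  ultimately show ?thesis using i by simp
qed

text \<open>The density of \<open>m F^2\<close> integrates to zero over the line. Boundedness of
  \<open>m\<close> and \<open>m'\<close> keeps every term integrable when \<open>f\<close> and
  \<open>df\<close> are only square-integrable.\<close>

lemma H1_multiplier:
  assumes "H1 f df" and m: "\<And>x. (m has_real_derivative m' x) (at x)" "continuous_on UNIV m'"
    and bd: "\<And>x. \<bar>m x\<bar> \<le> B" "\<And>x. \<bar>m' x\<bar> \<le> B"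
  shows "2 * (LINT x|lborel. m x * f x * df x) = - (LINT x|lborel. m' x * f x * f x)"
proof -
  obtain F where F: "has_ac_deriv F df" "L2 F" and Fae: "AE x in lborel. f x = F x" using H1_ac assms by blast
  have L2: "L2 f" "L2 df" using assms by (auto simp: H1_def)
  have "continuous_on UNIV m"
    using DERIV_continuous_on m(1) has_field_derivative_at_within by blast
  then have [measurable]: "m \<in> borel_measurable lborel" "m' \<in> borel_measurable lborel"
    using m(2) by (auto simp: borel_measurable_continuous_onI)
  have [measurable]: "f \<in> borel_measurable lborel" "df \<in> borel_measurable lborel" "F \<in> borel_measurable lborel"
    using L2 F by (auto simp: L2_def)
  have mF: "L2 (\<lambda>x. m x * F x)" "L2 (\<lambda>x. m' x * F x)"
    using L2_mult_bounded[OF F(2) _ bd(1)] L2_mult_bounded[OF F(2) _ bd(2)] by auto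
  have i1: "integrable lborel (\<lambda>x. m x * F x * df x)" and i2: "integrable lborel (\<lambda>x. m' x * F x * F x)"
    by (intro L2_integrable_mult mF L2 F)+
  have "has_ac_deriv (\<lambda>x. m x * (F x * F x)) (\<lambda>x. (F x * F x) * m' x + m x * (F x * df x + F x * df x))"
    by (intro ac_mult ac_DERIV m F)
  then have "(LINT x|lborel. (F x * F x) * m' x + m x * (F x * df x + F x * df x)) = 0"
  proof (rule ac_integral_zero)
    show "integrable lborel (\<lambda>x. m x * (F x * F x))"
      using L2_integrable_mult[OF mF(1) F(2)] by (simp add: mult.assoc)
    show "integrable lborel (\<lambda>x. (F x * F x) * m' x + m x * (F x * df x + F x * df x))"
      using Bochner_Integration.integrable_add[OF i2 Bochner_Integration.integrable_add[OF i1 i1]]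
      by (simp add: algebra_simps)
  qed
  also have "(\<lambda>x. (F x * F x) * m' x + m x * (F x * df x + F x * df x)) = (\<lambda>x. m' x * F x * F x + 2 * (m x * F x * df x))"
    by (auto simp: algebra_simps)
  finally have "(LINT x|lborel. m' x * F x * F x) + 2 * (LINT x|lborel. m x * F x * df x) = 0"
    using i1 i2 by simp
  moreover have "(LINT x|lborel. m x * f x * df x) = (LINT x|lborel. m x * F x * df x)"
    by (rule integral_cong_AE) (use Fae in auto)
  moreover have "(LINT x|lborel. m' x * f x * f x) = (LINT x|lborel. m' x * F x * F x)"
    by (rule integral_cong_AE) (use Fae in auto)
  ultimately show ?thesis by simp
qed

text \<open>Cauchy-Schwarz against an indicator: the integral of
  \<open>(g - c * indicator)^2\<close> is a nonnegative quadratic in \<open>c\<close>, evaluated at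
  its minimiser \<open>I / (b - a)\<close>.\<close>

lemma set_integral_square_le:
  assumes "L2 g" "a \<le> b"
  shows "(LINT x:{a..b}|lborel. g x)\<^sup>2 \<le> (b - a) * (LINT x|lborel. (g x)\<^sup>2)"
proof -
  define I where "I = (LINT x:{a..b}|lborel. g x)"
  define D where "D = (LINT x|lborel. (g x)\<^sup>2)"
  have g2: "integrable lborel (\<lambda>x. (g x)\<^sup>2)" using assms by (simp add: L2_def)
  have gi: "integrable lborel (\<lambda>x. indicator {a..b} x * g x)"
    using L2_set_integrable[OF assms(1)] by (simp add: set_integrable_def)
  have quad: "0 \<le> D - 2 * c * I + c\<^sup>2 * (b - a)" for c
  proof -
    have "0 \<le> (LINT x|lborel. (g x)\<^sup>2 - 2 * c * (indicator {a..b} x * g x) + c\<^sup>2 * indicator {a..b} x)"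
    proof (rule Bochner_Integration.integral_nonneg)
      fix x
      have "0 \<le> (g x - c * indicator {a..b} x)\<^sup>2" by simp
      also have "\<dots> = (g x)\<^sup>2 - 2 * c * (indicator {a..b} x * g x) + c\<^sup>2 * indicator {a..b} x"
        by (simp add: power2_diff power_mult_distrib indicator_def)
      finally show "0 \<le> (g x)\<^sup>2 - 2 * c * (indicator {a..b} x * g x) + c\<^sup>2 * indicator {a..b} x" .
    qed
    also have "\<dots> = D - 2 * c * I + c\<^sup>2 * (b - a)"
      using g2 gi assms(2) by (simp add: D_def I_def set_lebesgue_integral_def)
    finally show ?thesis .
  qed
  have "I\<^sup>2 \<le> (b - a) * D"
  \<comment> \<open>For \<open>a = b\<close> the minimiser would be a division by zero; there
    \<open>I\<close> is an integral over a single point.\<close>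
  proof (cases "a = b")
    case True
    have "{b..b} = {b}" by auto
    then have "I = 0"
      unfolding I_def True
      using set_integral_discrete_difference[of "{b}" "{b}" "{}" lborel g]
      by (simp add: set_lebesgue_integral_def)
    then show ?thesis by (simp add: True)
  next
    case False
    define c where "c = I / (b - a)"
    have I: "I = (b - a) * c" using False by (simp add: c_def)
    have "0 \<le> (b - a) * (D - 2 * c * I + c\<^sup>2 * (b - a))"
      using quad[of c] assms(2) by (intro mult_nonneg_nonneg) auto
    also have "\<dots> = (b - a) * D - I\<^sup>2"
      unfolding I by (simp add: algebra_simps power2_eq_square)
    finally show ?thesis by simp
  qed
  then show ?thesis by (simp add: I_def D_def)
qed

text \<open>A point of \<open>[-L, L]\<close> and one of \<open>[L, 2 L]\<close> are at most
  \<open>3 L\<close> apart, so \<open>(F x)^2 \<le> 2 (F y)^2 + 6 L D\<close>. Integrating over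
  \<open>y\<close>, on a length \<open>L\<close>, and over \<open>x\<close>, on a length
  \<open>2 L\<close>, produces the factors 4 and \<open>12 L^2\<close>. The reference interval is
  chosen where the damping is effective.\<close>

lemma H1_poincare:
  assumes "H1 f df" "L > 0"
  shows "(LINT x|lborel. indicator {-L..L} x * f x * f x)
    \<le> 4 * (LINT x|lborel. indicator {L..2*L} x * f x * f x) + 12 * L\<^sup>2 * (LINT x|lborel. df x * df x)"
proof -
  obtain F where F: "has_ac_deriv F df" "L2 F" and Fae: "AE x in lborel. f x = F x" using H1_ac assms by blast
  have L2: "L2 f" "L2 df" using assms by (auto simp: H1_def)
  have [measurable]: "f \<in> borel_measurable lborel" "F \<in> borel_measurable lborel"
    using L2 F by (auto simp: L2_def)
  define D where "D = (LINT x|lborel. df x * df x)"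
  define S where "S = (LINT x|lborel. indicator {L..2*L} x * (F x)\<^sup>2)"
  define T where "T = (LINT x|lborel. indicator {-L..L} x * (F x)\<^sup>2)"
  have D: "0 \<le> D" unfolding D_def by simp
  have i: "integrable lborel (\<lambda>x. indicator {a..b} x * (F x)\<^sup>2)" for a b
    by (rule integrable_mult_bounded[where B = 1]) (use F in \<open>auto simp: L2_def indicator_def\<close>)
  have pt: "(F x)\<^sup>2 \<le> 2 * (F y)\<^sup>2 + 6 * L * D" if "x \<in> {-L..L}" "y \<in> {L..2*L}" for x y
  proof -
    have "(F y - F x)\<^sup>2 \<le> (y - x) * D"
      using set_integral_square_le[OF L2(2), of x y] ac_increment[OF F(1), of x y] that
      by (simp add: D_def power2_eq_square)
    also have "\<dots> \<le> 3 * L * D"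
      using that D by (intro mult_right_mono) auto
    finally have "(F y - F x)\<^sup>2 \<le> 3 * L * D" .
    \<comment> \<open>The right side minus the left is the square of
      \<open>2 * F y - F x\<close>.\<close>
    moreover have "(F x)\<^sup>2 \<le> 2 * (F y)\<^sup>2 + 2 * (F y - F x)\<^sup>2"
      using zero_le_power2[of "2 * F y - F x"] by (simp add: power2_eq_square algebra_simps)
    ultimately show ?thesis by simp
  qed
  have px: "L * (F x)\<^sup>2 \<le> 2 * S + 6 * L\<^sup>2 * D" if x: "x \<in> {-L..L}" for x
  proof -

    have "L * (F x)\<^sup>2 = (LINT y|lborel. indicator {L..2*L} y * (F x)\<^sup>2)"
      using assms(2) by simp
    also have "\<dots> \<le> (LINT y|lborel. 2 * (indicator {L..2*L} y * (F y)\<^sup>2) + indicator {L..2*L} y * (6 * L * D))"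
    proof (rule integral_mono)
      fix y
      show "indicator {L..2*L} y * (F x)\<^sup>2 \<le> 2 * (indicator {L..2*L} y * (F y)\<^sup>2) + indicator {L..2*L} y * (6 * L * D)"
        using pt[OF x, of y] by (simp add: indicator_def)
    qed (auto intro!: i Bochner_Integration.integrable_add integrable_mult_right)
    also have "\<dots> = 2 * S + 6 * L\<^sup>2 * D"
      using assms(2) i by (simp add: S_def power2_eq_square)
    finally show ?thesis .
  qed
  have "L * T = (LINT x|lborel. L * (indicator {-L..L} x * (F x)\<^sup>2))"
    by (simp add: T_def)
  also have "\<dots> \<le> (LINT x|lborel. indicator {-L..L} x * (2 * S + 6 * L\<^sup>2 * D))"
  proof (rule integral_mono)
    fix x
    show "L * (indicator {-L..L} x * (F x)\<^sup>2) \<le> indicator {-L..L} x * (2 * S + 6 * L\<^sup>2 * D)"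
      using px[of x] by (simp add: indicator_def)
  qed (auto intro!: i integrable_mult_right)
  also have "\<dots> = L * (4 * S + 12 * L\<^sup>2 * D)"
    using assms(2) by (simp add: algebra_simps)
  finally have "T \<le> 4 * S + 12 * L\<^sup>2 * D"
    using assms(2) by simp
  moreover have "(LINT x|lborel. indicator {a..b} x * f x * f x) = (LINT x|lborel. indicator {a..b} x * (F x)\<^sup>2)" for a b
    by (rule integral_cong_AE) (use Fae in \<open>auto simp: power2_eq_square\<close>)
  ultimately show ?thesis by (simp add: T_def S_def D_def)
qed

text \<open>The zero set of the continuous representative is closed and of full measure, hence the
  whole line; its increments, which are the integrals of \<open>g\<close> over intervals, then
  vanish.\<close>

lemma weak_deriv_zero:
  assumes "H1 f g" "AE x in lborel. f x = 0"
  shows "AE x in lborel. g x = 0"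
proof -
  obtain F where F: "has_ac_deriv F g" and Fae: "AE x in lborel. f x = F x" using H1_ac assms by blast
  from Fae assms(2) have "AE x in lborel. F x = 0"
    by eventually_elim simp
  then have "AE x in lebesgue. x \<in> {x. F x = 0}"
    by (simp add: AE_completion)
  then have F0: "F x = 0" for x
    using mem_closed_if_AE_lebesgue[of "{x. F x = 0}"] ac_continuous[OF F]
    by (simp add: closed_Collect_eq)
  show ?thesis
    using ac_increment[OF F] F0 ac_integrable[OF F]
    by (intro AE_zero_if_interval_integrals_zero) auto
qed

section \<open>The Hilbert space of square-integrable functions\<close>

\<comment> \<open>The relation is reflexive only on square-integrable functions, so that the classes
  are the elements of L^2. As a type, L^2 can carry vector derivatives and integrals of functions of
  time.\<close>
quotient_type l2 = "real \<Rightarrow> real" / partial: "\<lambda>f g. L2 f \<and> L2 g \<and> (AE x in lborel. f x = g x)"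
proof (rule part_equivpI)
  show "\<exists>f. L2 f \<and> L2 f \<and> (AE x in lborel. f x = f x)"
    using L2_zero by auto
  show "symp (\<lambda>f g. L2 f \<and> L2 g \<and> (AE x in lborel. f x = g x))"
    by (auto simp: symp_def eq_commute)
  show "transp (\<lambda>f g. L2 f \<and> L2 g \<and> (AE x in lborel. f x = g x))"
    by (auto simp: transp_def)
qed

instantiation l2 :: real_inner
begin

lift_definition zero_l2 :: l2 is "\<lambda>x. 0"
  by (simp add: L2_zero)

lift_definition plus_l2 :: "l2 \<Rightarrow> l2 \<Rightarrow> l2" is "\<lambda>f g x. f x + g x"
  by (auto simp: L2_add)

lift_definition minus_l2 :: "l2 \<Rightarrow> l2 \<Rightarrow> l2" is "\<lambda>f g x. f x - g x"
  by (auto simp: L2_diff)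

lift_definition uminus_l2 :: "l2 \<Rightarrow> l2" is "\<lambda>f x. - f x"
  using L2_diff[OF L2_zero] by auto

lift_definition scaleR_l2 :: "real \<Rightarrow> l2 \<Rightarrow> l2" is "\<lambda>c f x. c * f x"
  by (auto simp: L2_scale)

lift_definition inner_l2 :: "l2 \<Rightarrow> l2 \<Rightarrow> real" is "\<lambda>f g. LINT x|lborel. f x * g x"
proof goal_cases
  case (1 f f' g g')
  then have [measurable]: "f \<in> borel_measurable borel" "f' \<in> borel_measurable borel"
    "g \<in> borel_measurable borel" "g' \<in> borel_measurable borel"
    by (auto simp: L2_def)
  from 1 have "AE x in lborel. f x = f' x" "AE x in lborel. g x = g' x" by auto
  then have "AE x in lborel. f x * g x = f' x * g' x"
    by eventually_elim simp
  then show ?case by (intro integral_cong_AE) auto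
qed

definition norm_l2 :: "l2 \<Rightarrow> real" where "norm_l2 u = sqrt (inner u u)"
definition dist_l2 :: "l2 \<Rightarrow> l2 \<Rightarrow> real" where "dist_l2 u v = norm (u - v)"
definition sgn_l2 :: "l2 \<Rightarrow> l2" where "sgn_l2 u = inverse (norm u) *\<^sub>R u"
definition uniformity_l2 :: "(l2 \<times> l2) filter"
  where "uniformity_l2 = (INF e\<in>{0<..}. principal {(x, y). dist x y < e})"
definition open_l2 :: "l2 set \<Rightarrow> bool"
  where "open_l2 U \<longleftrightarrow> (\<forall>x\<in>U. eventually (\<lambda>(x', y). x' = x \<longrightarrow> y \<in> U) uniformity)"

instance
proof
  fix a b c :: l2 and r s :: real
  show "a + b + c = a + (b + c)"
    by transfer (auto simp: L2_add add.assoc)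
  show "a + b = b + a"
    by transfer (auto simp: L2_add add.commute)
  show "0 + a = a"
    by transfer (auto simp: L2_add L2_zero)
  show "- a + a = 0"
    by transfer (auto simp: L2_zero)
  show "a - b = a + - b"
    by transfer (use L2_diff in auto)
  show "r *\<^sub>R (a + b) = r *\<^sub>R a + r *\<^sub>R b"
    by transfer (auto simp: L2_add L2_scale algebra_simps)
  show "(r + s) *\<^sub>R a = r *\<^sub>R a + s *\<^sub>R a"
    by transfer (auto simp: L2_add L2_scale algebra_simps)
  show "r *\<^sub>R s *\<^sub>R a = (r * s) *\<^sub>R a"
    by transfer (auto simp: L2_scale algebra_simps)
  show "1 *\<^sub>R a = a"
    by transfer auto
  show "dist a b = norm (a - b)" by (rule dist_l2_def)
  show "sgn a = inverse (norm a) *\<^sub>R a" by (rule sgn_l2_def)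
  show "uniformity = (INF e\<in>{0<..}. principal {(x, y :: l2). dist x y < e})" by (rule uniformity_l2_def)
  show "open U = (\<forall>x\<in>U. \<forall>\<^sub>F (x', y) in uniformity. x' = x \<longrightarrow> y \<in> U)" for U :: "l2 set"
    by (rule open_l2_def)
  show "inner a b = inner b a"
    by transfer (simp add: mult.commute)
  show "inner (a + b) c = inner a c + inner b c"
    by transfer (simp add: distrib_right L2_integrable_mult)
  show "inner (r *\<^sub>R a) b = r * inner a b"
    by transfer (simp add: mult.assoc)
  show "0 \<le> inner a a"
    by transfer simp
  show "inner a a = 0 \<longleftrightarrow> a = 0"
  proof transfer
    fix f assume f: "L2 f \<and> L2 f \<and> (AE x in lborel. f x = f x)"
    then have "(LINT x|lborel. f x * f x) = 0 \<longleftrightarrow> (AE x in lborel. f x * f x = 0)"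
      by (intro integral_nonneg_eq_0_iff_AE L2_integrable_mult) auto
    then show "(LINT x|lborel. f x * f x) = 0 \<longleftrightarrow> L2 f \<and> L2 (\<lambda>x. 0) \<and> (AE x in lborel. f x = 0)"
      using f by (simp add: L2_zero)
  qed
  show "norm a = sqrt (inner a a)" by (rule norm_l2_def)
qed

end

section \<open>Classes, representatives and completeness\<close>

lemma L2_rep: "L2 (rep_l2 u)"
  using Quotient3_rep_reflp[OF Quotient3_l2, of u] by simp

lemma abs_rep_l2 [simp]: "abs_l2 (rep_l2 u) = u"
  by (rule Quotient3_abs_rep[OF Quotient3_l2])

lemma abs_l2_eq_iff: "L2 f \<Longrightarrow> L2 g \<Longrightarrow> abs_l2 f = abs_l2 g \<longleftrightarrow> (AE x in lborel. f x = g x)"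
  using Quotient3_rel[OF Quotient3_l2, of f g] by simp

lemma rep_abs_l2: assumes "L2 f" shows "AE x in lborel. rep_l2 (abs_l2 f) x = f x"
  using abs_l2_eq_iff[OF L2_rep assms] abs_rep_l2 by blast

lemma abs_l2_cases: obtains f where "L2 f" "u = abs_l2 f"
  using L2_rep[of u] abs_rep_l2[of u] by metis

lemma abs_l2_simps:
  assumes "L2 f" "L2 g"
  shows "abs_l2 f + abs_l2 g = abs_l2 (\<lambda>x. f x + g x)"
    and "abs_l2 f - abs_l2 g = abs_l2 (\<lambda>x. f x - g x)"
    and "inner (abs_l2 f) (abs_l2 g) = (LINT x|lborel. f x * g x)"
  using assms by (simp_all add: plus_l2.abs_eq minus_l2.abs_eq inner_l2.abs_eq)

lemma scaleR_abs_l2: "L2 f \<Longrightarrow> c *\<^sub>R abs_l2 f = abs_l2 (\<lambda>x. c * f x)"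
  by (simp add: scaleR_l2.abs_eq)

lemma norm_abs_l2: "L2 f \<Longrightarrow> norm (abs_l2 f) = L2norm f"
  by (simp add: norm_eq_sqrt_inner abs_l2_simps L2norm_def power2_eq_square)

lemma dist_abs_l2: "L2 f \<Longrightarrow> L2 g \<Longrightarrow> dist (abs_l2 f) (abs_l2 g) = L2norm (\<lambda>x. f x - g x)"
  by (simp add: dist_norm abs_l2_simps norm_abs_l2 L2_diff)

lemma L2norm_square_nn:
  assumes "L2 f" shows "(\<integral>\<^sup>+x. ennreal ((f x)\<^sup>2) \<partial>lborel) = ennreal ((L2norm f)\<^sup>2)"
  using assms by (simp add: nn_integral_eq_integral L2norm_def L2_def)

text \<open>Riesz-Fischer: a subsequence with increments below \<open>(1/4)^k\<close> converges
  almost everywhere, and Fatou's lemma turns this into convergence in norm of the whole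
  sequence.\<close>

instance l2 :: complete_space
proof
  fix X :: "nat \<Rightarrow> l2" assume X: "Cauchy X"
  define f where "f n = rep_l2 (X n)" for n
  have f: "L2 (f n)" and Xf: "X n = abs_l2 (f n)" for n
    by (auto simp: f_def L2_rep)
  have [measurable]: "f n \<in> borel_measurable borel" for n
    using f by (simp add: L2_def)
  have dist: "dist (X m) (X n) = L2norm (\<lambda>x. f m x - f n x)" for m n
    unfolding Xf by (rule dist_abs_l2[OF f f])
  have "\<exists>N. \<forall>m\<ge>N. \<forall>n\<ge>N. dist (X m) (X n) < (1/4)^k" for k
    using X unfolding Cauchy_def by (meson zero_less_divide_1_iff zero_less_numeral zero_less_power)
  then obtain N where N: "\<And>k m n. m \<ge> N k \<Longrightarrow> n \<ge> N k \<Longrightarrow> dist (X m) (X n) < (1/4)^k"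
    by metis
  \<comment> \<open>Summing the indices makes \<open>r k\<close> and \<open>r (Suc k)\<close> both
    dominate \<open>N k\<close>; the added \<open>k\<close> makes \<open>r\<close> tend to
    infinity.\<close>
  define r where "r k = (\<Sum>i\<le>k. N i) + k" for k
  have rN: "N k \<le> r k" and rk: "k \<le> r k" for k
    using member_le_sum[of k "{..k}" N] by (auto simp: r_def)
  have rN': "N k \<le> r (Suc k)" for k
    by (rule order_trans[OF rN]) (simp add: r_def)
  define g where "g k x = f (r (Suc k)) x - f (r k) x" for k x
  have gL: "L2 (g k)" for k unfolding g_def by (intro L2_diff f)
  have [measurable]: "g k \<in> borel_measurable borel" for k
    using gL by (simp add: L2_def)
  have gnorm: "(L2norm (g k))\<^sup>2 \<le> ((1/4)^k)\<^sup>2" for k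
  proof -
    have "0 \<le> L2norm (g k)" by (simp add: L2norm_def)
    moreover have "L2norm (g k) < (1/4)^k"
      using N[OF rN' rN, of k] by (simp add: dist g_def[abs_def])
    ultimately show ?thesis by (intro power_mono) auto
  qed
  \<comment> \<open>The weights \<open>4^k\<close> turn square summability in the mean into absolute summability
     of \<open>g k x\<close> for almost every \<open>x\<close>.\<close>
  have "(\<integral>\<^sup>+x. (\<Sum>k. ennreal (4^k * (g k x)\<^sup>2)) \<partial>lborel) = (\<Sum>k. \<integral>\<^sup>+x. ennreal (4^k * (g k x)\<^sup>2) \<partial>lborel)"
    by (rule nn_integral_suminf) auto
  also have "\<dots> = (\<Sum>k. ennreal (4^k * (L2norm (g k))\<^sup>2))"
    by (simp add: ennreal_mult nn_integral_cmult L2norm_square_nn gL)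
  also have "\<dots> \<le> (\<Sum>k. ennreal ((1/4)^k))"
  proof (rule suminf_le)
    fix k
    have "(4::real)^k * (L2norm (g k))\<^sup>2 \<le> 4^k * ((1/4)^k)\<^sup>2"
      by (intro mult_left_mono gnorm) simp
    also have "\<dots> = (1/4)^k"
      by (simp add: power2_eq_square flip: mult.assoc power_mult_distrib)
    finally show "ennreal (4^k * (L2norm (g k))\<^sup>2) \<le> ennreal ((1/4)^k)"
      by (rule ennreal_leI)
  qed auto
  also have "\<dots> < \<infinity>"
    by (subst suminf_ennreal2) (auto simp: summable_geometric)
  finally have "AE x in lborel. (\<Sum>k. ennreal (4^k * (g k x)\<^sup>2)) \<noteq> \<infinity>"
    by (intro nn_integral_PInf_AE) auto
  \<comment> \<open>The terms of a convergent series are bounded, so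
    \<open>\<bar>g k x\<bar>\<close> is at most a constant times \<open>(1/2)^k\<close> and the
    telescoping sum converges.\<close>
  then have conv: "AE x in lborel. convergent (\<lambda>k. f (r k) x)"
  proof eventually_elim
    case (elim x)
    then have "summable (\<lambda>k. 4^k * (g k x)\<^sup>2)"
      by (intro summable_suminf_not_top) auto
    then have "Bseq (\<lambda>k. 4^k * (g k x)\<^sup>2)"
      by (intro convergent_imp_Bseq summable_LIMSEQ_zero[THEN convergentI])
    then obtain B where B: "\<And>k. 4^k * (g k x)\<^sup>2 \<le> B"
      by (auto simp: Bseq_def)
    have gk: "\<bar>g k x\<bar> \<le> (1 + B) * (1/2)^k" for k
    proof -
      have "(2^k * \<bar>g k x\<bar>)\<^sup>2 = 4^k * (g k x)\<^sup>2"
        unfolding power_mult_distrib power2_abs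
        by (simp add: power2_eq_square flip: power_mult_distrib)
      then have "(2^k * \<bar>g k x\<bar>)\<^sup>2 \<le> B"
        using B[of k] by simp
      moreover have "2 * (2^k * \<bar>g k x\<bar>) \<le> 1 + (2^k * \<bar>g k x\<bar>)\<^sup>2"
        using sum_squares_bound[of 1 "2^k * \<bar>g k x\<bar>"] by simp
      moreover have "0 \<le> 2^k * \<bar>g k x\<bar>" by simp
      ultimately have "2^k * \<bar>g k x\<bar> \<le> 1 + B"
        by linarith
      then show ?thesis by (simp add: field_simps power_divide)
    qed
    have "summable (\<lambda>k. g k x)"
    proof (rule summable_comparison_test')
      show "summable (\<lambda>k. (1 + B) * (1/2::real)^k)"
        by (intro summable_mult summable_geometric) simp
      show "norm (g k x) \<le> (1 + B) * (1/2)^k" if "0 \<le> k" for k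
        using gk[of k] by simp
    qed
    then have "convergent (\<lambda>n. f (r 0) x + (\<Sum>k<n. g k x))"
      by (intro convergent_add convergent_const) (simp add: summable_iff_convergent)
    moreover have "f (r 0) x + (\<Sum>k<n. g k x) = f (r n) x" for n
      by (induction n) (auto simp: g_def)
    ultimately show ?case by simp
  qed
  define F where "F x = lim (\<lambda>k. f (r k) x)" for x
  have [measurable]: "F \<in> borel_measurable borel"
    unfolding F_def by (rule borel_measurable_lim_metric) simp
  \<comment> \<open>Fatou with \<open>n\<close> fixed and the other index running along the
    subsequence; both the square-integrability of \<open>F - f n\<close> and the bound on its norm
    are read off from it.\<close>
  have bound: "(\<integral>\<^sup>+x. ennreal ((F x - f n x)\<^sup>2) \<partial>lborel) \<le> ennreal (e\<^sup>2)"
    if e: "\<And>m. m \<ge> n \<Longrightarrow> dist (X m) (X n) \<le> e" for n e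
  proof -
    have "AE x in lborel. liminf (\<lambda>k. ennreal ((f (r k) x - f n x)\<^sup>2)) = ennreal ((F x - f n x)\<^sup>2)"
      using conv
    proof eventually_elim
      case (elim x)
      then have "(\<lambda>k. f (r k) x) \<longlonglongrightarrow> F x"
        by (simp add: F_def convergent_LIMSEQ_iff)
      then have "(\<lambda>k. ennreal ((f (r k) x - f n x)\<^sup>2)) \<longlonglongrightarrow> ennreal ((F x - f n x)\<^sup>2)"
        by (intro tendsto_intros tendsto_ennrealI)
      then show ?case by (intro lim_imp_Liminf) auto
    qed
    then have "(\<integral>\<^sup>+x. ennreal ((F x - f n x)\<^sup>2) \<partial>lborel) = (\<integral>\<^sup>+x. liminf (\<lambda>k. ennreal ((f (r k) x - f n x)\<^sup>2)) \<partial>lborel)"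
      by (intro nn_integral_cong_AE) auto
    also have "\<dots> \<le> liminf (\<lambda>k. \<integral>\<^sup>+x. ennreal ((f (r k) x - f n x)\<^sup>2) \<partial>lborel)"
      by (intro nn_integral_liminf) auto
    also have "\<dots> \<le> limsup (\<lambda>k. \<integral>\<^sup>+x. ennreal ((f (r k) x - f n x)\<^sup>2) \<partial>lborel)"
      by (intro Liminf_le_Limsup) auto
    also have "\<dots> \<le> ennreal (e\<^sup>2)"
    proof (rule Limsup_bounded)
      show "\<forall>\<^sub>F k in sequentially. (\<integral>\<^sup>+x. ennreal ((f (r k) x - f n x)\<^sup>2) \<partial>lborel) \<le> ennreal (e\<^sup>2)"
        using eventually_ge_at_top[of n]
      proof eventually_elim
        case (elim k)
        then have "dist (X (r k)) (X n) \<le> e"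
          using rk[of k] e by simp
        then have "(L2norm (\<lambda>x. f (r k) x - f n x))\<^sup>2 \<le> e\<^sup>2"
          by (intro power_mono) (auto simp: dist L2norm_def)
        then show ?case
          by (subst L2norm_square_nn) (auto intro: L2_diff f ennreal_leI)
      qed
    qed
    finally show ?thesis .
  qed
  have diff: "L2 (\<lambda>x. F x - f n x)" and le: "L2norm (\<lambda>x. F x - f n x) \<le> e"
    if e: "\<And>m. m \<ge> n \<Longrightarrow> dist (X m) (X n) \<le> e" for n e
  proof -
    have "e \<ge> 0" using e[of n] by simp
    have "(\<integral>\<^sup>+x. ennreal ((F x - f n x)\<^sup>2) \<partial>lborel) < \<infinity>"
      using bound[OF e] by (auto intro: le_less_trans)
    then have "integrable lborel (\<lambda>x. (F x - f n x)\<^sup>2)"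
      by (intro integrableI_nonneg) auto
    then show L: "L2 (\<lambda>x. F x - f n x)"
      by (simp add: L2_def)
    have "(L2norm (\<lambda>x. F x - f n x))\<^sup>2 \<le> e\<^sup>2"
      using bound[OF e] L2norm_square_nn[OF L] by simp
    then show "L2norm (\<lambda>x. F x - f n x) \<le> e"
      using \<open>e \<ge> 0\<close> power2_le_imp_le by blast
  qed
  have "L2 F"
  proof -
    obtain n where "\<And>m. m \<ge> n \<Longrightarrow> dist (X m) (X n) \<le> 1"
      using X unfolding Cauchy_def by (meson less_eq_real_def order_refl zero_less_one)
    from L2_add[OF diff[OF this] f[of n]] show ?thesis by simp
  qed
  have "X \<longlonglongrightarrow> abs_l2 F"
  proof (rule metric_LIMSEQ_I)
    fix e :: real assume "e > 0"
    then obtain n0 where n0: "\<And>m n. m \<ge> n0 \<Longrightarrow> n \<ge> n0 \<Longrightarrow> dist (X m) (X n) < e/2"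
      using X unfolding Cauchy_def by (metis half_gt_zero)
    have "dist (X n) (abs_l2 F) < e" if "n \<ge> n0" for n
    proof -
      have "L2norm (\<lambda>x. F x - f n x) \<le> e/2"
        by (rule le) (use n0 that in \<open>auto intro: less_imp_le\<close>)
      then have "dist (abs_l2 F) (X n) \<le> e/2"
        unfolding Xf by (simp add: dist_abs_l2 \<open>L2 F\<close> f)
      then show ?thesis
        using \<open>e > 0\<close> by (simp add: dist_commute)
    qed
    then show "\<exists>no. \<forall>n\<ge>no. dist (X n) (abs_l2 F) < e" by blast
  qed
  then show "convergent X" by (rule convergentI)
qed

instance l2 :: banach ..

section \<open>Multiplication operators and weak derivatives on the Hilbert space\<close>

definition bdd_borel :: "(real \<Rightarrow> real) \<Rightarrow> bool" where
  "bdd_borel b \<longleftrightarrow> b \<in> borel_measurable borel \<and> bounded (range b)"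

lemma bdd_borelI: "b \<in> borel_measurable borel \<Longrightarrow> (\<And>x. \<bar>b x\<bar> \<le> B) \<Longrightarrow> bdd_borel b"
  unfolding bdd_borel_def by (auto simp: bounded_iff)

lemma bdd_borel_bound: assumes "bdd_borel b" obtains B where "B \<ge> 0" "\<And>x. \<bar>b x\<bar> \<le> B"
proof -
  obtain B where "\<And>x. \<bar>b x\<bar> \<le> B"
    using assms by (auto simp: bdd_borel_def bounded_iff)
  moreover from this[of 0] have "B \<ge> 0" by simp
  ultimately show ?thesis using that by blast
qed

lemma bdd_borel_mult: assumes "bdd_borel b" "bdd_borel c" shows "bdd_borel (\<lambda>x. b x * c x)"
proof -
  obtain B C where "B \<ge> 0" "\<And>x. \<bar>b x\<bar> \<le> B" "C \<ge> 0" "\<And>x. \<bar>c x\<bar> \<le> C"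
    using assms bdd_borel_bound by metis
  then show ?thesis
    using assms by (intro bdd_borelI[where B = "B * C"]) (auto simp: bdd_borel_def abs_mult intro: mult_mono)
qed

lemma bdd_borel_add: assumes "bdd_borel b" "bdd_borel c" shows "bdd_borel (\<lambda>x. b x + c x)"
proof -
  obtain B C where "B \<ge> 0" "\<And>x. \<bar>b x\<bar> \<le> B" "C \<ge> 0" "\<And>x. \<bar>c x\<bar> \<le> C"
    using assms bdd_borel_bound by metis
  then show ?thesis
    using assms by (intro bdd_borelI[where B = "B + C"]) (auto simp: bdd_borel_def intro: order_trans[OF abs_triangle_ineq] add_mono)
qed

lemma bdd_borel_const: "bdd_borel (\<lambda>x. c)"
  by (rule bdd_borelI[where B = "\<bar>c\<bar>"]) auto

lemma bdd_borel_indicator: "bdd_borel (indicator {a..b})"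
  by (rule bdd_borelI[where B = 1]) (auto simp: indicator_def)

lemma bdd_borel_BC: "BC b \<Longrightarrow> bdd_borel b"
  by (simp add: BC_def bdd_borel_def borel_measurable_continuous_onI)

lemma L2_bdd_borel: assumes "bdd_borel b" "L2 f" shows "L2 (\<lambda>x. b x * f x)"
proof -
  obtain B where "\<And>x. \<bar>b x\<bar> \<le> B" using assms bdd_borel_bound by metis
  with assms show ?thesis
    by (intro L2_mult_bounded) (auto simp: bdd_borel_def)
qed

text \<open>Outside the bounded Borel functions the value is 0, so that the operator lifts to
  classes as a total function of \<open>b\<close>.\<close>

lift_definition mulop :: "(real \<Rightarrow> real) \<Rightarrow> l2 \<Rightarrow> l2"
  is "\<lambda>b f x. if bdd_borel b then b x * f x else 0"
proof goal_cases
  case (1 b f g)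
  then show ?case by (cases "bdd_borel b") (auto simp: L2_bdd_borel L2_zero)
qed

lemma mulop_abs: "bdd_borel b \<Longrightarrow> L2 f \<Longrightarrow> mulop b (abs_l2 f) = abs_l2 (\<lambda>x. b x * f x)"
  by (simp add: mulop.abs_eq)

lemma inner_mulop: "bdd_borel b \<Longrightarrow> inner (mulop b u) v = (LINT x|lborel. b x * rep_l2 u x * rep_l2 v x)"
  using mulop_abs[OF _ L2_rep, of b u] abs_l2_simps(3)[OF L2_bdd_borel[OF _ L2_rep] L2_rep, of b u v] by simp

lemma inner_rep: "inner u v = (LINT x|lborel. rep_l2 u x * rep_l2 v x)"
  using abs_l2_simps(3)[OF L2_rep L2_rep] by simp

lemma mulop_self_adjoint: "bdd_borel b \<Longrightarrow> inner (mulop b u) v = inner u (mulop b v)"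
  by (simp add: inner_mulop inner_commute[of u] mult_ac)

lemma mulop_mulop: "bdd_borel b \<Longrightarrow> bdd_borel c \<Longrightarrow> mulop b (mulop c u) = mulop (\<lambda>x. b x * c x) u"
  by (cases u rule: abs_l2_cases) (simp add: mulop_abs L2_bdd_borel bdd_borel_mult mult.assoc)

lemma inner_mulop_integrable: "bdd_borel b \<Longrightarrow> integrable lborel (\<lambda>x. b x * rep_l2 u x * rep_l2 v x)"
  by (intro L2_integrable_mult L2_bdd_borel L2_rep)

lemma inner_mulop_mono:
  assumes "bdd_borel b" "bdd_borel c" "\<And>x. b x \<le> c x"
  shows "inner (mulop b u) u \<le> inner (mulop c u) u"
  unfolding inner_mulop[OF assms(1)] inner_mulop[OF assms(2)]
  by (intro integral_mono inner_mulop_integrable assms)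
     (use assms(3) in \<open>simp add: mult.assoc mult_right_mono\<close>)

lemma inner_mulop_add:
  "bdd_borel b \<Longrightarrow> bdd_borel c \<Longrightarrow> inner (mulop (\<lambda>x. b x + c x) u) v = inner (mulop b u) v + inner (mulop c u) v"
  by (simp add: inner_mulop bdd_borel_add inner_mulop_integrable distrib_right)

lemma inner_mulop_scale:
  "bdd_borel b \<Longrightarrow> inner (mulop (\<lambda>x. r * b x) u) v = r * inner (mulop b u) v"
  by (simp add: inner_mulop bdd_borel_mult bdd_borel_const mult.assoc)

lemma inner_mulop_const: "inner (mulop (\<lambda>x. r) u) v = r * inner u v"
  by (simp add: inner_mulop bdd_borel_const inner_rep[of u v] mult.assoc)

lemma norm_mulop_square: "bdd_borel b \<Longrightarrow> (norm (mulop b u))\<^sup>2 = inner (mulop (\<lambda>x. (b x)\<^sup>2) u) u"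
  unfolding power2_norm_eq_inner
  by (subst mulop_self_adjoint[symmetric]) (simp_all add: mulop_mulop power2_eq_square)

lemma norm_mulop_le:
  assumes "bdd_borel b" "\<And>x. \<bar>b x\<bar> \<le> B" shows "norm (mulop b u) \<le> B * norm u"
proof -
  have "B \<ge> 0" using assms(2)[of 0] by simp
  have "(norm (mulop b u))\<^sup>2 \<le> inner (mulop (\<lambda>x. B\<^sup>2) u) u"
    unfolding norm_mulop_square[OF assms(1)]
  proof (rule inner_mulop_mono)
    show "bdd_borel (\<lambda>x. (b x)\<^sup>2)"
      unfolding power2_eq_square by (intro bdd_borel_mult assms)
    show "(b x)\<^sup>2 \<le> B\<^sup>2" for x
      using power_mono[OF assms(2), of x 2] by simp
  qed (rule bdd_borel_const)
  also have "\<dots> = (B * norm u)\<^sup>2"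
    by (simp add: inner_mulop_const power_mult_distrib power2_norm_eq_inner)
  finally show ?thesis
    using \<open>B \<ge> 0\<close> by (simp add: power2_le_iff_abs_le)
qed

lemma bounded_linear_mulop: assumes "bdd_borel b" shows "bounded_linear (mulop b)"
proof -
  obtain B where B: "\<And>x. \<bar>b x\<bar> \<le> B" using assms bdd_borel_bound by metis
  show ?thesis
  proof (rule bounded_linear_intro[where K = B])
    fix u v :: l2 and r :: real
    show "mulop b (u + v) = mulop b u + mulop b v"
      by (cases u rule: abs_l2_cases, cases v rule: abs_l2_cases)
         (simp add: mulop_abs abs_l2_simps assms L2_add L2_bdd_borel distrib_left)
    show "mulop b (r *\<^sub>R u) = r *\<^sub>R mulop b u"
      by (cases u rule: abs_l2_cases)
         (simp add: mulop_abs scaleR_abs_l2 assms L2_scale L2_bdd_borel mult.left_commute)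
    show "norm (mulop b u) \<le> norm u * B"
      using norm_mulop_le[OF assms B] by (simp add: mult.commute)
  qed
qed

text \<open>The graph of the unbounded operator d/dx on L^2, kept as a relation so that membership
  in the domain and the value are asserted together. The wave equation then says that
  \<open>u_x\<close> has the weak derivative \<open>u_tt + V u + a u_t\<close>, without mention of a
  second derivative in x.\<close>

definition l2_weak_deriv :: "l2 \<Rightarrow> l2 \<Rightarrow> bool" where
  "l2_weak_deriv u v \<longleftrightarrow> (\<forall>\<phi>. test_fun \<phi> \<longrightarrow> inner u (abs_l2 (deriv \<phi>)) = - inner v (abs_l2 \<phi>))"

lemma l2_weak_deriv_abs: "L2 f \<Longrightarrow> L2 g \<Longrightarrow> l2_weak_deriv (abs_l2 f) (abs_l2 g) \<longleftrightarrow> has_weak_deriv f g"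
  unfolding l2_weak_deriv_def has_weak_deriv_def
  by (intro all_cong1 imp_cong refl) (simp add: abs_l2_simps L2_test_fun test_fun_deriv)

lemma l2_weak_deriv_H1: "l2_weak_deriv u v \<Longrightarrow> H1 (rep_l2 u) (rep_l2 v)"
  using l2_weak_deriv_abs[OF L2_rep L2_rep, of u v] by (simp add: H1_def L2_rep)

lemma l2_weak_deriv_diff: "l2_weak_deriv u v \<Longrightarrow> l2_weak_deriv u' v' \<Longrightarrow> l2_weak_deriv (u - u') (v - v')"
  by (simp add: l2_weak_deriv_def inner_diff_left)

lemma l2_weak_deriv_scale: "l2_weak_deriv u v \<Longrightarrow> l2_weak_deriv (r *\<^sub>R u) (r *\<^sub>R v)"
  by (simp add: l2_weak_deriv_def)

text \<open>Membership in the graph is tested against fixed vectors, and inner products with fixed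
  vectors commute with the integral; so unboundedness of the derivative does no harm.\<close>

lemma l2_weak_deriv_integral:
  fixes a b :: real
  assumes "\<And>s. s \<in> {a..b} \<Longrightarrow> l2_weak_deriv (f s) (g s)" "continuous_on {a..b} f" "continuous_on {a..b} g"
  shows "l2_weak_deriv (integral {a..b} f) (integral {a..b} g)"
  unfolding l2_weak_deriv_def
proof (intro allI impI)
  fix \<phi> assume \<phi>: "test_fun \<phi>"
  have i: "inner (integral {a..b} h) w = integral {a..b} (\<lambda>s. inner (h s) w)" if "continuous_on {a..b} h"
    for h :: "real \<Rightarrow> l2" and w :: l2
    using integral_linear[OF integrable_continuous_real[OF that] bounded_linear_inner_left, of w]
    by (simp add: o_def)
  have "integral {a..b} (\<lambda>s. inner (f s) (abs_l2 (deriv \<phi>))) = integral {a..b} (\<lambda>s. - inner (g s) (abs_l2 \<phi>))"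
    by (intro Henstock_Kurzweil_Integration.integral_cong) (use assms(1) \<phi> in \<open>auto simp: l2_weak_deriv_def\<close>)
  then show "inner (integral {a..b} f) (abs_l2 (deriv \<phi>)) = - inner (integral {a..b} g) (abs_l2 \<phi>)"
    by (simp add: i assms)
qed

lemma l2_weak_deriv_skew: "l2_weak_deriv u du \<Longrightarrow> l2_weak_deriv v dv \<Longrightarrow> inner du v = - inner u dv"
  using H1_skew[OF l2_weak_deriv_H1 l2_weak_deriv_H1] by (simp add: inner_rep)

lemma l2_weak_deriv_multiplier:
  assumes "l2_weak_deriv u du" and m: "\<And>x. (m has_real_derivative m' x) (at x)" "continuous_on UNIV m'"
    and bd: "bdd_borel m" "bdd_borel m'"
  shows "2 * inner (mulop m u) du = - inner (mulop m' u) u"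
proof -
  obtain B1 B2 where B: "B1 \<ge> 0" "\<And>x. \<bar>m x\<bar> \<le> B1" "B2 \<ge> 0" "\<And>x. \<bar>m' x\<bar> \<le> B2"
    using bd bdd_borel_bound by metis
  show ?thesis
    unfolding inner_mulop[OF bd(1)] inner_mulop[OF bd(2)]
  proof (rule H1_multiplier[OF l2_weak_deriv_H1[OF assms(1)] m])
    show "\<bar>m x\<bar> \<le> B1 + B2" for x using B(2)[of x] B(3) by linarith
    show "\<bar>m' x\<bar> \<le> B1 + B2" for x using B(4)[of x] B(1) by linarith
  qed
qed

lemma l2_weak_deriv_poincare:
  assumes "l2_weak_deriv u du" "L > 0"
  shows "inner (mulop (indicator {-L..L}) u) u
    \<le> 4 * inner (mulop (indicator {L..2*L}) u) u + 12 * L\<^sup>2 * inner du du"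
  using H1_poincare[OF l2_weak_deriv_H1[OF assms(1)] assms(2)]
  by (simp add: inner_mulop[OF bdd_borel_indicator] inner_rep[of du du])

text \<open>Two weak derivatives of one class differ by a weak derivative of 0, which vanishes
  because the continuous representative of 0 does.\<close>

lemma l2_weak_deriv_unique: assumes "l2_weak_deriv u v" "l2_weak_deriv u v'" shows "v = v'"
proof -
  have "l2_weak_deriv 0 (v - v')" using l2_weak_deriv_diff[OF assms] by simp
  moreover have "AE x in lborel. rep_l2 0 x = 0"
    using rep_abs_l2[OF L2_zero] by (simp add: zero_l2.abs_eq)
  ultimately have "AE x in lborel. rep_l2 (v - v') x = 0"
    using weak_deriv_zero l2_weak_deriv_H1 by blast
  then have "abs_l2 (rep_l2 (v - v')) = abs_l2 (\<lambda>x. 0)"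
    by (subst abs_l2_eq_iff) (auto simp: L2_rep L2_zero)
  then show ?thesis by (simp flip: zero_l2.abs_eq)
qed

section \<open>Differentiation of Hilbert-space-valued functions of time\<close>

lemma inner_DERIV:
  fixes f g :: "real \<Rightarrow> l2"
  assumes "(f has_vector_derivative f') (at t)" "(g has_vector_derivative g') (at t)"
  shows "((\<lambda>s. inner (f s) (g s)) has_real_derivative inner (f t) g' + inner f' (g t)) (at t)"
  using bounded_bilinear.has_vector_derivative[OF bounded_bilinear_inner assms]
  by (simp add: has_real_derivative_iff_has_vector_derivative)

lemma mulop_has_vector_derivative:
  "bdd_borel b \<Longrightarrow> (f has_vector_derivative f') F \<Longrightarrow> ((\<lambda>s. mulop b (f s)) has_vector_derivative mulop b f') F"
  by (rule bounded_linear.has_vector_derivative[OF bounded_linear_mulop])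

lemma mulop_continuous_on: "bdd_borel b \<Longrightarrow> continuous_on S f \<Longrightarrow> continuous_on S (\<lambda>s. mulop b (f s))"
  by (rule bounded_linear.continuous_on[OF bounded_linear_mulop])

lemma mulop_tendsto: "bdd_borel b \<Longrightarrow> (f \<longlongrightarrow> l) F \<Longrightarrow> ((\<lambda>s. mulop b (f s)) \<longlongrightarrow> mulop b l) F"
  by (rule bounded_linear.tendsto[OF bounded_linear_mulop])

section \<open>Multiplier estimates\<close>

text \<open>The smallness condition is \<open>4 C* V(0) \<le> 1\<close> with \<open>C* = 12 L\<^sup>2 (1 + L\<^sup>2)\<close>: the Poincare
  constant \<open>12 L\<^sup>2\<close> times \<open>lam / 2 * V(0)\<close>, \<open>lam = 4 (1 + L\<^sup>2)\<close>, must not exceed \<open>1/2\<close>. The value of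
  \<open>lam\<close> makes \<open>lam / 2 * arctan' \<ge> 2\<close> on \<open>[-L, L]\<close>.\<close>

locale damped =
  fixes L \<epsilon> :: real and a V :: "real \<Rightarrow> real"
  assumes L: "L > 0" and eps: "\<epsilon> > 0"
    and a_BC: "BC a" and a_nonneg: "\<And>x. 0 \<le> a x" and a_ge: "\<And>x. L \<le> \<bar>x\<bar> \<Longrightarrow> \<epsilon> \<le> a x"
    and V_BC1: "BC1 V" and V_pos: "\<And>x. 0 < V x" and V_deriv: "\<And>x. deriv V x * x \<le> 0"
    and V_small: "48 * L\<^sup>2 * (1 + L\<^sup>2) * V 0 \<le> 1"
begin

lemma a_bdd_borel: "bdd_borel a" using a_BC by (rule bdd_borel_BC)

lemma V_bdd_borel: "bdd_borel V" using V_BC1 by (simp add: BC1_def bdd_borel_BC)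

lemma V_DERIV: "(V has_real_derivative deriv V x) (at x)"
  using V_BC1 unfolding BC1_def by (metis DERIV_deriv_iff_real_differentiable)

text \<open>The sign of \<open>deriv V x * x\<close> makes \<open>V\<close> nondecreasing up to 0
  and nonincreasing after it; smallness at the single point 0 is therefore smallness
  everywhere.\<close>

lemma V_le: "V x \<le> V 0"
proof -
  have cont: "continuous_on S V" for S
    using V_BC1 continuous_on_subset unfolding BC1_def BC_def by blast
  show ?thesis
  proof (cases "x \<ge> 0")
    case True
    then show ?thesis
    proof (rule DERIV_nonpos_imp_decreasing_open[OF _ _ cont])
      show "\<exists>d. DERIV V y :> d \<and> d \<le> 0" if "0 < y" for y
        using V_DERIV[of y] V_deriv[of y] that by (auto simp: mult_le_0_iff)
    qed
  next
    case False
    then have "x \<le> 0" by simp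
    then show ?thesis
    proof (rule DERIV_nonneg_imp_increasing_open[OF _ _ cont])
      show "\<exists>d. DERIV V y :> d \<and> 0 \<le> d" if "y < 0" for y
        using V_DERIV[of y] V_deriv[of y] that by (auto simp: mult_le_0_iff)
    qed
  qed
qed

definition sup_a :: real where "sup_a = (SUP x. \<bar>a x\<bar>)"

lemma a_le: "a x \<le> sup_a"
proof -
  obtain B where "\<And>x. \<bar>a x\<bar> \<le> B"
    using a_bdd_borel bdd_borel_bound by metis
  then have "\<bar>a x\<bar> \<le> sup_a"
    unfolding sup_a_def by (intro cSUP_upper bdd_aboveI[where M = B]) auto
  then show ?thesis by simp
qed

definition "lam = 4 * (1 + L\<^sup>2)"
text \<open>Prices of the estimates in \<open>dissipation\<close>. In \<open>c1\<close>,
  \<open>2 / \<epsilon>\<close> pays for the kinetic energy outside \<open>[-L, L]\<close> and the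
  rest for the damping term met by the arctan multiplier. In \<open>c2\<close>,
  \<open>lam / 2\<close> multiplies \<open>V 0 / \<epsilon>\<close> once for the region outside
  \<open>[-L, L]\<close> and four times for the Poincare inequality.\<close>

definition "c1 = 2 / \<epsilon> + 4 * lam\<^sup>2 * sup_a"
definition "c2 = 5 * lam * V 0 / (2 * \<epsilon>)"

abbreviation "A \<equiv> mulop a"
abbreviation "Q \<equiv> mulop V"
abbreviation "H \<equiv> mulop arctan"

text \<open>The derivative of the product of arctan and \<open>V\<close>. Its second summand is
  never positive, since arctan has the sign of its argument.\<close>

definition "hV' x = V x * inverse (1 + x\<^sup>2) + arctan x * deriv V x" for x

definition energy_form :: "l2 \<Rightarrow> l2 \<Rightarrow> l2 \<Rightarrow> real" where
  "energy_form u p w = (inner p p + inner w w + inner (Q u) u) / 2"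
text \<open>Energy of the time integral \<open>y\<close> of \<open>u\<close>, with \<open>u\<close>
  as its time derivative and \<open>z\<close> as its space derivative. The source \<open>F\<close>
  does not depend on time, so \<open>inner F y\<close> acts as a potential and the functional
  decreases at the rate \<open>inner (A u) u\<close>.\<close>

definition integrated_form :: "l2 \<Rightarrow> l2 \<Rightarrow> l2 \<Rightarrow> l2 \<Rightarrow> real" where
  "integrated_form F u y z = (inner u u + inner z z + inner (Q y) y) / 2 - inner F y"
text \<open>The second summand cancels the damping contribution \<open>inner (A p) u\<close> that
  arises when \<open>inner u p\<close> is differentiated.\<close>

definition J :: "l2 \<Rightarrow> l2 \<Rightarrow> real" where
  "J u p = inner u p + inner (A u) u / 2"
definition G :: "l2 \<Rightarrow> l2 \<Rightarrow> real" where
  "G p w = inner p (H w)"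
definition lyapunov :: "l2 \<Rightarrow> l2 \<Rightarrow> l2 \<Rightarrow> l2 \<Rightarrow> l2 \<Rightarrow> l2 \<Rightarrow> real" where
  "lyapunov F u p w y z = J u p + lam * G p w + c1 * energy_form u p w + c2 * integrated_form F u y z"

lemma arctan_le: "\<bar>arctan x\<bar> \<le> 2"
  using arctan_bounded[of x] pi_less_4 by auto

lemma arctan_bdd_borel: "bdd_borel arctan"
  by (rule bdd_borelI[OF _ arctan_le]) (intro borel_measurable_continuous_onI continuous_intros)

lemma inv_bdd_borel: "bdd_borel (\<lambda>x. inverse (1 + x\<^sup>2))"
proof (rule bdd_borelI[where B = 1])
  show "(\<lambda>x::real. inverse (1 + x\<^sup>2)) \<in> borel_measurable borel" by measurable
  show "\<bar>inverse (1 + x\<^sup>2)\<bar> \<le> 1" for x :: real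
    by (simp add: inverse_le_1_iff)
qed

lemma V'_bdd_borel: "bdd_borel (deriv V)" using V_BC1 by (simp add: BC1_def bdd_borel_BC)

lemma hV'_bdd_borel: "bdd_borel hV'"
  unfolding hV'_def by (intro bdd_borel_add bdd_borel_mult V_bdd_borel inv_bdd_borel arctan_bdd_borel V'_bdd_borel)

lemma H_identity: "l2_weak_deriv u w \<Longrightarrow> 2 * inner (H u) w = - inner (mulop (\<lambda>x. inverse (1 + x\<^sup>2)) u) u"
proof (rule l2_weak_deriv_multiplier)
  show "continuous_on UNIV (\<lambda>x::real. inverse (1 + x\<^sup>2))"
    by (intro continuous_intros) (auto simp: add_nonneg_eq_0_iff)
qed (auto simp: DERIV_arctan arctan_bdd_borel inv_bdd_borel)

lemma HV_identity: "l2_weak_deriv u w \<Longrightarrow> 2 * inner (Q u) (H w) = - inner (mulop hV' u) u"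
proof -
  assume "l2_weak_deriv u w"
  then have "2 * inner (mulop (\<lambda>x. arctan x * V x) u) w = - inner (mulop hV' u) u"
  proof (rule l2_weak_deriv_multiplier)
    show "((\<lambda>x. arctan x * V x) has_real_derivative hV' x) (at x)" for x
      using DERIV_mult[OF DERIV_arctan V_DERIV, of x] by (simp add: hV'_def algebra_simps)
    have "continuous_on UNIV (deriv V)" "continuous_on UNIV V"
      using V_BC1 by (auto simp: BC1_def BC_def)
    then show "continuous_on UNIV hV'"
      unfolding hV'_def by (intro continuous_intros) (auto simp: add_nonneg_eq_0_iff)
  qed (auto simp: hV'_bdd_borel bdd_borel_mult arctan_bdd_borel V_bdd_borel)
  then show ?thesis
    by (simp add: mulop_mulop arctan_bdd_borel V_bdd_borel flip: mulop_self_adjoint)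
qed

text \<open>The left side is the time derivative of \<open>J + lam * G\<close> along the equation.
  Of the available \<open>inner w w\<close>, one half is spent on the potential through the Poincare
  inequality and one quarter on the damping cross term; the last quarter is what
  \<open>energy_form / 2\<close> contains.\<close>

lemma dissipation:
  assumes uw: "l2_weak_deriv u w"
  shows "inner p p - inner w w - inner (Q u) u
     + lam / 2 * (inner (mulop hV' u) u - inner (mulop (\<lambda>x. inverse (1 + x\<^sup>2)) w) w
         - inner (mulop (\<lambda>x. inverse (1 + x\<^sup>2)) p) p)
     - lam * inner (A p) (H w)
   \<le> - energy_form u p w / 2 + c1 * inner (A p) p + c2 * inner (A u) u"
proof -
  let ?i = "\<lambda>x::real. inverse (1 + x\<^sup>2)"
  have lam: "lam > 0" unfolding lam_def by (simp add: add_pos_nonneg)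
  have V0: "V 0 > 0" by (rule V_pos)
  have Ai: "inner (A u) u \<ge> 0" for u
    using inner_mulop_mono[OF bdd_borel_const a_bdd_borel, of 0 u] a_nonneg by (simp add: inner_mulop_const)
  \<comment> \<open>The weight 2 instead of 1 pays for the positive kinetic term coming from
    \<open>J\<close> and still leaves \<open>- inner p p\<close> for the energy.\<close>
  have p: "2 * inner p p \<le> lam / 2 * inner (mulop ?i p) p + 2 / \<epsilon> * inner (A p) p"
  proof -
    have "inner (mulop (\<lambda>x. 2) p) p \<le> inner (mulop (\<lambda>x. lam / 2 * ?i x + 2 / \<epsilon> * a x) p) p"
    proof (intro inner_mulop_mono bdd_borel_const bdd_borel_add bdd_borel_mult inv_bdd_borel a_bdd_borel)
      fix x
      show "2 \<le> lam / 2 * ?i x + 2 / \<epsilon> * a x"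
      proof (cases "L \<le> \<bar>x\<bar>")
        case True
        have "2 \<le> 2 / \<epsilon> * a x"
          using a_ge[OF True] eps by (simp add: field_simps)
        moreover have "0 \<le> lam / 2 * ?i x" using lam by simp
        ultimately show ?thesis by linarith
      next
        case False
        then have "x\<^sup>2 \<le> L\<^sup>2"
          using L by (simp add: abs_le_square_iff[symmetric])
        then have "2 \<le> lam / 2 * ?i x"
          unfolding lam_def by (simp add: field_simps add_pos_nonneg)
        moreover have "0 \<le> 2 / \<epsilon> * a x" using eps a_nonneg by simp
        ultimately show ?thesis by linarith
      qed
    qed
    then show ?thesis
      by (simp only: inner_mulop_const inner_mulop_add inner_mulop_scale bdd_borel_mult bdd_borel_const inv_bdd_borel a_bdd_borel)
  qed
  have w0: "0 \<le> inner (mulop ?i w) w"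
    using inner_mulop_mono[OF bdd_borel_const inv_bdd_borel, of 0 w] by (simp add: inner_mulop_const)
  have u: "lam / 2 * inner (mulop hV' u) u \<le> inner w w / 2 + c2 * inner (A u) u"
  proof -
    \<comment> \<open>On \<open>[-L, L]\<close>, where \<open>a\<close> may vanish, only the bound
      by \<open>V 0\<close> is at hand; beyond, the damping dominates \<open>V 0\<close>.\<close>
    have "inner (mulop hV' u) u \<le> inner (mulop (\<lambda>x. V 0 * indicator {-L..L} x + V 0 / \<epsilon> * a x) u) u"
    proof (intro inner_mulop_mono bdd_borel_const bdd_borel_add bdd_borel_mult bdd_borel_indicator a_bdd_borel hV'_bdd_borel)
      fix x
      have "arctan x * deriv V x \<le> 0"
        using V_deriv[of x] by (cases "x > 0"; cases "x = 0") (auto simp: mult_le_0_iff)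
      moreover have "V x * ?i x \<le> V 0 * 1"
        using V_le[of x] V_pos[of x] by (intro mult_mono) (auto simp: inverse_le_1_iff)
      ultimately have m'V: "hV' x \<le> V 0" by (simp add: hV'_def)
      show "hV' x \<le> V 0 * indicator {-L..L} x + V 0 / \<epsilon> * a x"
      proof (cases "x \<in> {-L..L}")
        case True
        then show ?thesis using m'V V0 a_nonneg[of x] eps by (simp add: add_increasing2)
      next
        case False
        then have "\<epsilon> \<le> a x" by (intro a_ge) auto
        then have "V 0 \<le> V 0 / \<epsilon> * a x"
          using eps V0 by (simp add: field_simps)
        then show ?thesis using False m'V by simp
      qed
    qed
    then have 1: "inner (mulop hV' u) u \<le> V 0 * inner (mulop (indicator {-L..L}) u) u + V 0 / \<epsilon> * inner (A u) u"
      by (simp only: inner_mulop_const inner_mulop_add inner_mulop_scale bdd_borel_mult bdd_borel_const bdd_borel_indicator a_bdd_borel)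
    have "inner (mulop (indicator {L..2*L}) u) u \<le> inner (mulop (\<lambda>x. 1 / \<epsilon> * a x) u) u"
    proof (intro inner_mulop_mono bdd_borel_mult bdd_borel_indicator bdd_borel_const a_bdd_borel)
      fix x
      show "indicator {L..2*L} x \<le> 1 / \<epsilon> * a x"
        using a_ge[of x] a_nonneg[of x] eps L by (auto simp: indicator_def field_simps)
    qed
    then have 2: "inner (mulop (indicator {L..2*L}) u) u \<le> inner (A u) u / \<epsilon>"
      by (simp only: inner_mulop_scale a_bdd_borel) simp
    have 3: "inner (mulop (indicator {-L..L}) u) u \<le> 4 * (inner (A u) u / \<epsilon>) + 12 * L\<^sup>2 * inner w w"
      using l2_weak_deriv_poincare[OF uw L] 2 by simp
    have "inner (mulop hV' u) u \<le> V 0 * (4 * (inner (A u) u / \<epsilon>) + 12 * L\<^sup>2 * inner w w) + V 0 / \<epsilon> * inner (A u) u"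
      using 1 mult_left_mono[OF 3, of "V 0"] V0 by linarith
    then have "lam / 2 * inner (mulop hV' u) u
       \<le> lam / 2 * (V 0 * (4 * (inner (A u) u / \<epsilon>) + 12 * L\<^sup>2 * inner w w) + V 0 / \<epsilon> * inner (A u) u)"
      using lam by (intro mult_left_mono) auto
    \<comment> \<open>The coefficient of \<open>inner w w\<close> is
      \<open>lam / 2 * V 0 * 12 * L^2\<close>; written as half of the quantity in
      \<open>V_small\<close>, it is at most \<open>1/2\<close>.\<close>
    also have "\<dots> = c2 * inner (A u) u + (48 * L\<^sup>2 * (1 + L\<^sup>2) * V 0) / 2 * inner w w"
      by (simp add: c2_def lam_def algebra_simps add_divide_distrib)
    also have "\<dots> \<le> c2 * inner (A u) u + 1 / 2 * inner w w"
      by (intro add_left_mono mult_right_mono) (use V_small in linarith, simp)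
    finally show ?thesis by simp
  qed
  have c: "- lam * inner (A p) (H w) \<le> inner w w / 4 + 4 * lam\<^sup>2 * sup_a * inner (A p) p"
  proof -
    \<comment> \<open>Young's inequality for the cross term: the factor \<open>2 * lam\<close> makes
      the price in \<open>w\<close> exactly \<open>inner w w / 4\<close>.\<close>
    define z where "z = (2 * lam) *\<^sub>R H (A p)"
    have "0 \<le> inner (w + z) (w + z)" by simp
    then have "- 2 * inner w z \<le> inner w w + inner z z"
      by (simp add: inner_add_left inner_add_right inner_commute)
    moreover have "inner w z = 2 * lam * inner (A p) (H w)"
      by (simp add: z_def inner_commute mulop_self_adjoint arctan_bdd_borel)
    moreover have "inner z z = 4 * lam\<^sup>2 * inner (mulop (\<lambda>x. (arctan x * a x)\<^sup>2) p) p"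
    proof -
      have "inner z z = 4 * lam\<^sup>2 * (norm (H (A p)))\<^sup>2"
        by (simp add: z_def dot_square_norm[of "H (A p)"] power2_eq_square[of lam])
      then show ?thesis
        by (simp only: mulop_mulop[OF arctan_bdd_borel a_bdd_borel] norm_mulop_square[OF bdd_borel_mult[OF arctan_bdd_borel a_bdd_borel]])
    qed
    \<comment> \<open>One factor \<open>a\<close> is kept, so that the term can be paid by the
      dissipated \<open>inner (A p) p\<close>.\<close>
    moreover have "inner (mulop (\<lambda>x. (arctan x * a x)\<^sup>2) p) p \<le> inner (mulop (\<lambda>x. (4 * sup_a) * a x) p) p"
    proof (rule inner_mulop_mono)
      show "bdd_borel (\<lambda>x. (arctan x * a x)\<^sup>2)"
        unfolding power2_eq_square by (intro bdd_borel_mult arctan_bdd_borel a_bdd_borel)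
      fix x
      have "(arctan x)\<^sup>2 \<le> 2\<^sup>2"
        using power_mono[OF arctan_le[of x], of 2] by simp
      then have "(arctan x)\<^sup>2 * (a x * a x) \<le> 4 * (sup_a * a x)"
        using a_le[of x] a_nonneg[of x] by (intro mult_mono) auto
      then show "(arctan x * a x)\<^sup>2 \<le> (4 * sup_a) * a x"
        by (simp add: power2_eq_square algebra_simps)
    qed (intro bdd_borel_mult bdd_borel_const a_bdd_borel)
    moreover have "inner (mulop (\<lambda>x. (4 * sup_a) * a x) p) p = 4 * sup_a * inner (A p) p"
      by (rule inner_mulop_scale[OF a_bdd_borel])
    ultimately have 1: "- 2 * inner w z \<le> inner w w + inner z z"
      and 2: "inner w z = 2 * lam * inner (A p) (H w)"
      and 3: "inner z z = 4 * lam\<^sup>2 * inner (mulop (\<lambda>x. (arctan x * a x)\<^sup>2) p) p"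
      and 4: "inner (mulop (\<lambda>x. (arctan x * a x)\<^sup>2) p) p \<le> 4 * sup_a * inner (A p) p"
      by auto
    have "inner z z \<le> 4 * lam\<^sup>2 * (4 * sup_a * inner (A p) p)"
      unfolding 3 using 4 by (intro mult_left_mono) auto
    then show ?thesis using 1 2 by (simp add: algebra_simps)
  qed
  have "lam / 2 * inner (mulop ?i w) w \<ge> 0" using w0 lam by simp
  moreover have "c1 * inner (A p) p = 2 / \<epsilon> * inner (A p) p + 4 * lam\<^sup>2 * sup_a * inner (A p) p"
    by (simp add: c1_def distrib_right)
  moreover have "lam / 2 * (inner (mulop hV' u) u - inner (mulop ?i w) w - inner (mulop ?i p) p)
      = lam / 2 * inner (mulop hV' u) u - lam / 2 * inner (mulop ?i w) w - lam / 2 * inner (mulop ?i p) p"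
    by (simp only: right_diff_distrib)
  moreover have "energy_form u p w / 2 = inner p p / 4 + inner w w / 4 + inner (Q u) u / 4"
    by (simp add: energy_form_def add_divide_distrib)
  moreover have "0 \<le> inner (Q u) u"
    using inner_mulop_mono[OF bdd_borel_const V_bdd_borel, of 0 u] V_pos[THEN less_imp_le] by (simp add: inner_mulop_const)
  ultimately show ?thesis
    using p u c inner_ge_zero[of p] inner_ge_zero[of w] by linarith
qed

text \<open>\<open>Y\<close> and \<open>Z\<close> play the role of the time integrals of \<open>U\<close> and \<open>W\<close>, and \<open>F\<close> that of \<open>u\<^sub>1 + a u\<^sub>0\<close>;
  \<open>F\<close> need not be \<open>P 0 + A (U 0)\<close>, which matters for difference quotients.\<close>

lemma Lyapunov_strong:
  assumes wds: "\<And>t. t \<ge> 0 \<Longrightarrow> l2_weak_deriv (U t) (W t)" "\<And>t. t \<ge> 0 \<Longrightarrow> l2_weak_deriv (P t) (X t)"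
      "\<And>t. t \<ge> 0 \<Longrightarrow> l2_weak_deriv (W t) (S t + Q (U t) + A (P t))"
      "\<And>t. t \<ge> 0 \<Longrightarrow> l2_weak_deriv (Z t) (P t + Q (Y t) + A (U t) - F)"
    and der: "\<And>t. t > 0 \<Longrightarrow> (U has_vector_derivative P t) (at t)" "\<And>t. t > 0 \<Longrightarrow> (P has_vector_derivative S t) (at t)"
      "\<And>t. t > 0 \<Longrightarrow> (W has_vector_derivative X t) (at t)" "\<And>t. t > 0 \<Longrightarrow> (Y has_vector_derivative U t) (at t)"
      "\<And>t. t > 0 \<Longrightarrow> (Z has_vector_derivative W t) (at t)"
    and cont: "continuous_on {0..} U" "continuous_on {0..} P" "continuous_on {0..} W"
      "continuous_on {0..} Y" "continuous_on {0..} Z"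
    and "t \<ge> 0"
  shows "energy_form (U t) (P t) (W t) \<le> energy_form (U 0) (P 0) (W 0)" (is ?e)
    and "integrated_form F (U t) (Y t) (Z t) \<le> integrated_form F (U 0) (Y 0) (Z 0)" (is ?p)
    and "t * energy_form (U t) (P t) (W t) / 2 + lyapunov F (U t) (P t) (W t) (Y t) (Z t)
      \<le> lyapunov F (U 0) (P 0) (W 0) (Y 0) (Z 0)" (is ?l)
proof -
  let ?i = "\<lambda>x::real. inverse (1 + x\<^sup>2)"
  note D = inner_DERIV mulop_has_vector_derivative[OF a_bdd_borel] mulop_has_vector_derivative[OF V_bdd_borel]
    mulop_has_vector_derivative[OF arctan_bdd_borel] has_vector_derivative_const der
  have sym: "inner (mulop b u) v = inner (mulop b v) u" if "bdd_borel b" for b and u v :: l2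
    by (metis mulop_self_adjoint that inner_commute)
  have Ai: "inner (A u) u \<ge> 0" for u
    using inner_mulop_mono[OF bdd_borel_const a_bdd_borel, of 0 u] a_nonneg by (simp add: inner_mulop_const)
  have En0: "energy_form u p w \<ge> 0" for u p w
    using inner_mulop_mono[OF bdd_borel_const V_bdd_borel, of 0 u] V_pos[THEN less_imp_le]
    by (simp add: inner_mulop_const energy_form_def)
  have mono: "f t \<le> f 0" if "\<And>s. s > 0 \<Longrightarrow> \<exists>d. (f has_real_derivative d) (at s) \<and> d \<le> 0"
    "continuous_on {0..} f" for f :: "real \<Rightarrow> real"
  proof (rule DERIV_nonpos_imp_decreasing_open[OF \<open>t \<ge> 0\<close>])
    show "continuous_on {0..t} f" using that(2) by (rule continuous_on_subset) auto
  qed (use that(1) in auto)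
  have dE: "((\<lambda>s. energy_form (U s) (P s) (W s)) has_real_derivative - inner (A (P s)) (P s)) (at s)" if "s > 0" for s
  proof -
    \<comment> \<open>The equation is paired with \<open>P\<close>; skew-symmetry moves the
      derivative onto \<open>P\<close>, whose weak derivative \<open>X\<close> is also the time
      derivative of \<open>W\<close>, so everything but the damping cancels.\<close>
    have "inner (S s + Q (U s) + A (P s)) (P s) = - inner (W s) (X s)"
      by (rule l2_weak_deriv_skew[OF wds(3,2)]) (use that in auto)
    then show ?thesis
      unfolding energy_form_def using inner_commute[of "P s" "S s"] inner_commute[of "X s" "W s"] sym[OF V_bdd_borel, of "P s" "U s"]
      by - (rule DERIV_cong, (rule DERIV_cdivide DERIV_add DERIV_diff D that)+,
          simp add: inner_add_left)
  qed
  have dP: "((\<lambda>s. integrated_form F (U s) (Y s) (Z s)) has_real_derivative - inner (A (U s)) (U s)) (at s)" if "s > 0" for s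
  proof -
    have "inner (P s + Q (Y s) + A (U s) - F) (U s) = - inner (Z s) (W s)"
      by (rule l2_weak_deriv_skew[OF wds(4,1)]) (use that in auto)
    then show ?thesis
      unfolding integrated_form_def using inner_commute[of "U s" "P s"] inner_commute[of "W s" "Z s"] sym[OF V_bdd_borel, of "U s" "Y s"]
      by - (rule DERIV_cong, (rule DERIV_cdivide DERIV_add DERIV_diff D that)+,
          simp add: inner_add_left inner_diff_left add_divide_distrib)
  qed
  have dJ: "((\<lambda>s. J (U s) (P s)) has_real_derivative
      inner (P s) (P s) - inner (W s) (W s) - inner (Q (U s)) (U s)) (at s)" if "s > 0" for s
  proof -
    have "inner (S s + Q (U s) + A (P s)) (U s) = - inner (W s) (W s)"
      by (rule l2_weak_deriv_skew[OF wds(3,1)]) (use that in auto)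
    then show ?thesis
      unfolding J_def using inner_commute[of "U s" "S s"] sym[OF a_bdd_borel, of "P s" "U s"]
      by - (rule DERIV_cong, (rule DERIV_cdivide DERIV_add DERIV_diff D that)+,
          simp add: inner_add_left)
  qed
  have dG: "((\<lambda>s. G (P s) (W s)) has_real_derivative
      (inner (mulop hV' (U s)) (U s) - inner (mulop ?i (W s)) (W s) - inner (mulop ?i (P s)) (P s)) / 2
      - inner (A (P s)) (H (W s))) (at s)" if "s > 0" for s
  proof -
    \<comment> \<open>Multiplier identities for \<open>W\<close> (through the equation), for
      \<open>P\<close> and for the potential. Only the pairing of \<open>A P\<close> with
      \<open>H W\<close> has no exact form and survives as the cross term.\<close>
    have "2 * inner (H (W s)) (S s + Q (U s) + A (P s)) = - inner (mulop ?i (W s)) (W s)"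
      "2 * inner (H (P s)) (X s) = - inner (mulop ?i (P s)) (P s)"
      "2 * inner (Q (U s)) (H (W s)) = - inner (mulop hV' (U s)) (U s)"
      using that by (intro H_identity HV_identity wds; simp)+
    then show ?thesis
      unfolding G_def using inner_commute[of "H (W s)"] mulop_self_adjoint[OF arctan_bdd_borel, of "P s" "X s"]
      by - (rule DERIV_cong, (rule DERIV_cdivide DERIV_add DERIV_diff D that)+,
          simp add: inner_add_right diff_divide_distrib)
  qed
  note C = mulop_continuous_on[OF a_bdd_borel] mulop_continuous_on[OF V_bdd_borel] mulop_continuous_on[OF arctan_bdd_borel] cont
  have cE: "continuous_on {0..} (\<lambda>s. energy_form (U s) (P s) (W s))"
    unfolding energy_form_def by (intro continuous_intros C) auto
  have cP: "continuous_on {0..} (\<lambda>s. integrated_form F (U s) (Y s) (Z s))"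
    unfolding integrated_form_def by (intro continuous_intros C) auto
  show ?e
    by (rule mono[OF _ cE]) (use dE Ai in \<open>meson neg_le_0_iff_le\<close>)
  show ?p
    by (rule mono[OF _ cP]) (use dP Ai in \<open>meson neg_le_0_iff_le\<close>)
  have "t * energy_form (U t) (P t) (W t) / 2 + lyapunov F (U t) (P t) (W t) (Y t) (Z t)
      \<le> 0 * energy_form (U 0) (P 0) (W 0) / 2 + lyapunov F (U 0) (P 0) (W 0) (Y 0) (Z 0)"
  proof (rule mono)
    show "continuous_on {0..} (\<lambda>s. s * energy_form (U s) (P s) (W s) / 2 + lyapunov F (U s) (P s) (W s) (Y s) (Z s))"
      unfolding lyapunov_def J_def G_def by (intro continuous_intros cE cP C) auto
    fix s :: real assume s: "s > 0"
    let ?E = "energy_form (U s) (P s) (W s)"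
    \<comment> \<open>\<open>?E / 2\<close> stems from differentiating the factor \<open>s\<close>,
      and \<open>dissipation\<close> supplies \<open>- ?E / 2\<close> against it. The remaining term
      with the factor \<open>s\<close> comes from the decay of the energy and has a favourable
      sign.\<close>
    define d where "d = (?E - s * inner (A (P s)) (P s)) / 2
      + ((inner (P s) (P s) - inner (W s) (W s) - inner (Q (U s)) (U s))
      + lam * ((inner (mulop hV' (U s)) (U s) - inner (mulop ?i (W s)) (W s) - inner (mulop ?i (P s)) (P s)) / 2
      - inner (A (P s)) (H (W s))) - c1 * inner (A (P s)) (P s) - c2 * inner (A (U s)) (U s))"
    have "((\<lambda>s. s * energy_form (U s) (P s) (W s) / 2 + lyapunov F (U s) (P s) (W s) (Y s) (Z s)) has_real_derivative d) (at s)"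
      unfolding lyapunov_def d_def
      by (auto intro!: derivative_eq_intros dE[OF s] dP[OF s] dJ[OF s] dG[OF s])
    moreover have "d \<le> 0"
      using dissipation[OF wds(1)[of s], of "P s"] s mult_nonneg_nonneg[OF less_imp_le[OF s] Ai[of "P s"]]
      by (simp add: d_def right_diff_distrib diff_divide_distrib)
    ultimately show "\<exists>d. ((\<lambda>s. s * energy_form (U s) (P s) (W s) / 2 + lyapunov F (U s) (P s) (W s) (Y s) (Z s))
        has_real_derivative d) (at s) \<and> d \<le> 0" by blast
  qed
  then show ?l by simp
qed

end

section \<open>Regularisation in time\<close>

text \<open>A forward quotient: for positive \<open>d\<close> it stays inside the half-line of
  nonnegative times, also at time 0.\<close>

definition diff_quot :: "real \<Rightarrow> (real \<Rightarrow> 'a::real_normed_vector) \<Rightarrow> real \<Rightarrow> 'a" where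
  "diff_quot d f t = (1 / d) *\<^sub>R (f (t + d) - f t)"

lemma has_vector_derivative_at_halfline:
  "(f has_vector_derivative f') (at t within {0..}) \<Longrightarrow> t > 0 \<Longrightarrow> (f has_vector_derivative f') (at (t::real))"
  by (subst (asm) at_within_interior) (auto simp: interior_real_atLeast)

lemma diff_quot_has_vector_derivative:
  assumes "\<And>t. t \<ge> 0 \<Longrightarrow> (f has_vector_derivative f' t) (at t within {0..})" "t > 0" "d > 0"
  shows "(diff_quot d f has_vector_derivative diff_quot d f' t) (at t)"
proof -
  have "(f has_vector_derivative f' t) (at t)"
    using assms has_vector_derivative_at_halfline by (meson less_imp_le)
  moreover have "((\<lambda>s. f (s + d)) has_vector_derivative f' (t + d)) (at t)"
  proof -
    have "(f has_vector_derivative f' (t + d)) (at (t + d))"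
      using assms by (intro has_vector_derivative_at_halfline) auto
    then have "((f \<circ> (\<lambda>s. s + d)) has_vector_derivative 1 *\<^sub>R f' (t + d)) (at t)"
      by (intro vector_diff_chain_at) (auto intro!: derivative_eq_intros)
    then show ?thesis by (simp add: o_def)
  qed
  ultimately show ?thesis
    unfolding diff_quot_def by (auto intro!: derivative_eq_intros)
qed

lemma diff_quot_continuous:
  assumes "continuous_on {0..} f" "d > 0" shows "continuous_on {0..} (diff_quot d f)"
proof -
  have "continuous_on {0..} (\<lambda>s. f (s + d))"
    by (rule continuous_on_compose2[OF assms(1)]) (use assms(2) in \<open>auto intro!: continuous_intros\<close>)
  then show ?thesis
    unfolding diff_quot_def by (intro continuous_intros assms)
qed

lemma diff_quot_tendsto:
  assumes "(f has_vector_derivative f') (at t within {0..})" "t \<ge> 0"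
  shows "((\<lambda>d. diff_quot d f t) \<longlongrightarrow> f') (at_right 0)"
proof -
  have "((\<lambda>y. norm (f y - f t - (y - t) *\<^sub>R f') / norm (y - t)) \<longlongrightarrow> 0) (at t within {0..})"
    using assms(1) by (simp add: has_vector_derivative_def has_derivative_iff_norm)
  then have "((\<lambda>y. norm (f y - f t - (y - t) *\<^sub>R f') / norm (y - t)) \<longlongrightarrow> 0) (at_right t)"
    by (rule tendsto_within_subset) (use assms(2) in auto)
  then have "((\<lambda>d. norm (f (t + d) - f t - d *\<^sub>R f') / norm d) \<longlongrightarrow> 0) (at_right 0)"
    by (subst (asm) filterlim_at_right_to_0) (simp add: add.commute)
  moreover have "\<forall>\<^sub>F d in at_right 0. norm (f (t + d) - f t - d *\<^sub>R f') / norm d = norm (diff_quot d f t - f')"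
    using eventually_at_right_less
  proof eventually_elim
    case (elim d)
    then have "diff_quot d f t - f' = (1 / d) *\<^sub>R (f (t + d) - f t - d *\<^sub>R f')"
      by (simp add: diff_quot_def algebra_simps)
    then show ?case using elim by simp
  qed
  ultimately have "((\<lambda>d. norm (diff_quot d f t - f')) \<longlongrightarrow> 0) (at_right 0)"
    by (rule Lim_transform_eventually)
  then show ?thesis
    using LIM_zero_cancel tendsto_norm_zero_iff by blast
qed

definition itg :: "(real \<Rightarrow> 'a::banach) \<Rightarrow> real \<Rightarrow> 'a" where "itg f t = integral {0..t} f"

lemma itg_has_vector_derivative:
  assumes "continuous_on {0..} f" "t \<ge> 0"
  shows "(itg f has_vector_derivative f t) (at t within {0..})"
proof -
  have "continuous_on {0..t+1} f"
    using assms(1) by (rule continuous_on_subset) auto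
  then have "((\<lambda>s. integral {0..s} f) has_vector_derivative f t) (at t within {0..t+1})"
    by (rule integral_has_vector_derivative) (use assms(2) in auto)
  moreover have "at t within {0..t+1} = at t within {0..}"
    by (rule at_within_nhd[where S = "{..<t+1}"]) auto
  ultimately show ?thesis by (simp add: itg_def[abs_def])
qed

lemma itg_continuous:
  assumes "continuous_on {0..} f" shows "continuous_on {0..} (itg f)"
  unfolding continuous_on_eq_continuous_within
proof
  show "continuous (at t within {0..}) (itg f)" if "t \<in> {0..}" for t
    by (rule has_vector_derivative_continuous[OF itg_has_vector_derivative[OF assms]]) (use that in simp)
qed

lemma itg_0 [simp]: "itg f 0 = 0"
  by (simp add: itg_def)

lemma l2_weak_deriv_itg:
  assumes "\<And>t. t \<ge> 0 \<Longrightarrow> l2_weak_deriv (f t) (g t)" "continuous_on {0..} f" "continuous_on {0..} g" "t \<ge> 0"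
  shows "l2_weak_deriv (itg f t) (itg g t)"
  unfolding itg_def
  by (rule l2_weak_deriv_integral) (use assms in \<open>auto intro: continuous_on_subset\<close>)

lemma l2_weak_deriv_diff_quot:
  assumes "\<And>t. t \<ge> 0 \<Longrightarrow> l2_weak_deriv (f t) (g t)" "t \<ge> 0" "d > 0"
  shows "l2_weak_deriv (diff_quot d f t) (diff_quot d g t)"
  unfolding diff_quot_def by (intro l2_weak_deriv_scale l2_weak_deriv_diff assms) (use assms in auto)

lemma diff_quot_add: "diff_quot d (\<lambda>t. f t + g t) t = diff_quot d f t + diff_quot d g t"
  by (simp add: diff_quot_def algebra_simps)

lemma diff_quot_diff: "diff_quot d (\<lambda>t. f t - g t) t = diff_quot d f t - diff_quot d g t"
  by (simp add: diff_quot_def algebra_simps)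

lemma diff_quot_const: "diff_quot d (\<lambda>t. c) t = 0"
  by (simp add: diff_quot_def)

text \<open>Integration in time turns the constant source \<open>F\<close> into
  \<open>t *\<^sub>R F\<close>; the quotient recovers \<open>F\<close> exactly.\<close>

lemma diff_quot_scaleR: "d \<noteq> 0 \<Longrightarrow> diff_quot d (\<lambda>t. t *\<^sub>R c) t = c"
  by (simp add: diff_quot_def flip: scaleR_diff_left)

lemma diff_quot_mulop: "bdd_borel b \<Longrightarrow> diff_quot d (\<lambda>t. mulop b (f t)) t = mulop b (diff_quot d f t)"
  unfolding diff_quot_def
  by (simp add: linear_diff linear_scale bounded_linear.linear[OF bounded_linear_mulop])

lemma itg_mulop:
  assumes "bdd_borel b" "continuous_on {0..} f"
  shows "itg (\<lambda>t. mulop b (f t)) t = mulop b (itg f t)"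
proof -
  have "f integrable_on {0..t}"
    by (intro integrable_continuous_real continuous_on_subset[OF assms(2)]) auto
  then show ?thesis
    using integral_linear[OF _ bounded_linear_mulop[OF assms(1)]] by (simp add: itg_def o_def)
qed

section \<open>Transfer of the estimates to weak solutions, and the decay bounds\<close>

context damped
begin

lemma energy_form_tendsto:
  assumes "(u \<longlongrightarrow> u') F" "(p \<longlongrightarrow> p') F" "(w \<longlongrightarrow> w') F"
  shows "((\<lambda>d. energy_form (u d) (p d) (w d)) \<longlongrightarrow> energy_form u' p' w') F"
  unfolding energy_form_def by (intro tendsto_intros assms mulop_tendsto V_bdd_borel) auto

lemma integrated_form_tendsto:
  assumes "(u \<longlongrightarrow> u') F" "(y \<longlongrightarrow> y') F" "(z \<longlongrightarrow> z') F"
  shows "((\<lambda>d. integrated_form f (u d) (y d) (z d)) \<longlongrightarrow> integrated_form f u' y' z') F"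
  unfolding integrated_form_def by (intro tendsto_intros assms mulop_tendsto V_bdd_borel) auto

lemma lyapunov_tendsto:
  assumes "(u \<longlongrightarrow> u') F" "(p \<longlongrightarrow> p') F" "(w \<longlongrightarrow> w') F" "(y \<longlongrightarrow> y') F" "(z \<longlongrightarrow> z') F"
  shows "((\<lambda>d. lyapunov f (u d) (p d) (w d) (y d) (z d)) \<longlongrightarrow> lyapunov f u' p' w' y' z') F"
  unfolding lyapunov_def J_def G_def
  by (intro tendsto_intros assms mulop_tendsto V_bdd_borel a_bdd_borel arctan_bdd_borel energy_form_tendsto integrated_form_tendsto) auto

text \<open>The quotient of \<open>itg U\<close> approximates \<open>U\<close> and is regular
  enough: its time derivative is the quotient of \<open>U\<close>, which is again weakly
  differentiable, and the quotient of \<open>itg W\<close> has a weak derivative by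
  \<open>eq\<close>. In the quotient of \<open>eq\<close> the source \<open>F\<close> drops out; in
  that of the equation integrated once more it remains.\<close>

lemma Lyapunov_weak:
  fixes U P W :: "real \<Rightarrow> l2" and F :: l2
  assumes uw: "\<And>t. t \<ge> 0 \<Longrightarrow> l2_weak_deriv (U t) (W t)"
    and eq: "\<And>t. t \<ge> 0 \<Longrightarrow> l2_weak_deriv (itg W t) (P t + Q (itg U t) + A (U t) - F)"
    and cont: "continuous_on {0..} U" "continuous_on {0..} P" "continuous_on {0..} W"
    and der: "\<And>t. t \<ge> 0 \<Longrightarrow> (U has_vector_derivative P t) (at t within {0..})"
    and t: "t \<ge> 0"
  shows "energy_form (U t) (P t) (W t) \<le> energy_form (U 0) (P 0) (W 0)" (is ?e)
    and "integrated_form F (U t) (itg U t) (itg W t) \<le> integrated_form F (U 0) 0 0" (is ?p)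
    and "t * energy_form (U t) (P t) (W t) / 2 + lyapunov F (U t) (P t) (W t) (itg U t) (itg W t)
      \<le> lyapunov F (U 0) (P 0) (W 0) 0 0" (is ?l)
proof -
  define Y where "Y = itg U"
  define Z where "Z = itg W"
  have cY: "continuous_on {0..} Y" and cZ: "continuous_on {0..} Z"
    unfolding Y_def Z_def by (intro itg_continuous cont)+
  have dY: "(Y has_vector_derivative U t) (at t within {0..})"
    and dZ: "(Z has_vector_derivative W t) (at t within {0..})"
    and dIY: "(itg Y has_vector_derivative Y t) (at t within {0..})"
    and dIZ: "(itg Z has_vector_derivative Z t) (at t within {0..})" if "t \<ge> 0" for t
    unfolding Y_def Z_def using that
    by (intro itg_has_vector_derivative itg_continuous cont; assumption)+
  have wYZ: "l2_weak_deriv (Y t) (Z t)" if "t \<ge> 0" for t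
    unfolding Y_def Z_def using uw cont(1,3) that by (rule l2_weak_deriv_itg)
  \<comment> \<open>The equation integrated once more in time. The integral of \<open>P\<close>
    contributes \<open>U t - U 0\<close>, whose constant part the quotient removes.\<close>
  have int_eq: "l2_weak_deriv (itg Z t) ((U t - U 0) + Q (itg Y t) + A (Y t) - t *\<^sub>R F)" if t: "t \<ge> 0" for t
  proof -
    have c: "continuous_on {0..} (\<lambda>t. P t + Q (Y t) + A (U t) - F)"
      by (intro continuous_intros cont mulop_continuous_on a_bdd_borel V_bdd_borel cY)
    have "l2_weak_deriv (itg Z t) (itg (\<lambda>t. P t + Q (Y t) + A (U t) - F) t)"
      using eq by (intro l2_weak_deriv_itg cZ c t) (simp add: Y_def Z_def)
    also have "itg (\<lambda>t. P t + Q (Y t) + A (U t) - F) t = (U t - U 0) + Q (itg Y t) + A (Y t) - t *\<^sub>R F"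
    proof -
      have i: "f integrable_on {0..t}" if "continuous_on {0..} f" for f :: "real \<Rightarrow> l2"
        by (intro integrable_continuous_real continuous_on_subset[OF that]) auto
      have "itg (\<lambda>t. P t + Q (Y t) + A (U t) - F) t
          = itg P t + itg (\<lambda>t. Q (Y t)) t + itg (\<lambda>t. A (U t)) t - integral {0..t} (\<lambda>_. F)"
        unfolding itg_def
        by (simp add: Henstock_Kurzweil_Integration.integral_add Henstock_Kurzweil_Integration.integral_diff
            integrable_add i cont mulop_continuous_on a_bdd_borel V_bdd_borel cY)
      moreover have "itg P t = U t - U 0"
        unfolding itg_def
      proof (rule integral_unique, rule fundamental_theorem_of_calculus[OF t])
        fix s assume "s \<in> {0..t}"
        then show "(U has_vector_derivative P s) (at s within {0..t})"
          by (intro has_vector_derivative_within_subset[OF der]) auto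
      qed
      ultimately show ?thesis
        using t by (simp add: itg_mulop a_bdd_borel V_bdd_borel cont cY flip: Y_def)
    qed
    finally show ?thesis .
  qed
  have str: "energy_form (diff_quot d Y t) (diff_quot d U t) (diff_quot d Z t) \<le> energy_form (diff_quot d Y 0) (diff_quot d U 0) (diff_quot d Z 0)"
    "integrated_form F (diff_quot d Y t) (diff_quot d (itg Y) t) (diff_quot d (itg Z) t) \<le> integrated_form F (diff_quot d Y 0) (diff_quot d (itg Y) 0) (diff_quot d (itg Z) 0)"
    "t * energy_form (diff_quot d Y t) (diff_quot d U t) (diff_quot d Z t) / 2 + lyapunov F (diff_quot d Y t) (diff_quot d U t) (diff_quot d Z t) (diff_quot d (itg Y) t) (diff_quot d (itg Z) t)
      \<le> lyapunov F (diff_quot d Y 0) (diff_quot d U 0) (diff_quot d Z 0) (diff_quot d (itg Y) 0) (diff_quot d (itg Z) 0)"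
    if d: "d > 0" for d
  proof -
    have 1: "l2_weak_deriv (diff_quot d Y t) (diff_quot d Z t)" if "t \<ge> 0" for t
      using wYZ that d by (rule l2_weak_deriv_diff_quot)
    have 2: "l2_weak_deriv (diff_quot d U t) (diff_quot d W t)" if "t \<ge> 0" for t
      using uw that d by (rule l2_weak_deriv_diff_quot)
    have 3: "l2_weak_deriv (diff_quot d Z t) (diff_quot d P t + Q (diff_quot d Y t) + A (diff_quot d U t))" if "t \<ge> 0" for t
    proof -
      have "l2_weak_deriv (diff_quot d Z t) (diff_quot d (\<lambda>t. P t + Q (Y t) + A (U t) - F) t)"
        using eq that d by (intro l2_weak_deriv_diff_quot) (simp_all add: Y_def Z_def)
      then show ?thesis by (simp add: diff_quot_add diff_quot_diff diff_quot_const diff_quot_mulop a_bdd_borel V_bdd_borel)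
    qed
    have 4: "l2_weak_deriv (diff_quot d (itg Z) t) (diff_quot d U t + Q (diff_quot d (itg Y) t) + A (diff_quot d Y t) - F)" if "t \<ge> 0" for t
    proof -
      have "l2_weak_deriv (diff_quot d (itg Z) t) (diff_quot d (\<lambda>t. (U t - U 0) + Q (itg Y t) + A (Y t) - t *\<^sub>R F) t)"
        using int_eq that d by (rule l2_weak_deriv_diff_quot)
      then show ?thesis
        using d by (simp add: diff_quot_add diff_quot_diff diff_quot_const diff_quot_mulop diff_quot_scaleR a_bdd_borel V_bdd_borel)
    qed
    note dd = diff_quot_has_vector_derivative[OF _ _ d]
    note cc = diff_quot_continuous[OF _ d]
    note L = Lyapunov_strong[where U = "diff_quot d Y" and P = "diff_quot d U" and W = "diff_quot d Z" and S = "diff_quot d P"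
        and X = "diff_quot d W" and Y = "diff_quot d (itg Y)" and Z = "diff_quot d (itg Z)" and F = F and t = t,
        OF 1 2 3 4 dd[OF dY] dd[OF der] dd[OF dZ] dd[OF dIY] dd[OF dIZ]
          cc[OF cY] cc[OF cont(1)] cc[OF cZ] cc[OF itg_continuous[OF cY]] cc[OF itg_continuous[OF cZ]] t]
    show "energy_form (diff_quot d Y t) (diff_quot d U t) (diff_quot d Z t) \<le> energy_form (diff_quot d Y 0) (diff_quot d U 0) (diff_quot d Z 0)"
      by (rule L(1))
    show "integrated_form F (diff_quot d Y t) (diff_quot d (itg Y) t) (diff_quot d (itg Z) t) \<le> integrated_form F (diff_quot d Y 0) (diff_quot d (itg Y) 0) (diff_quot d (itg Z) 0)"
      by (rule L(2))
    show "t * energy_form (diff_quot d Y t) (diff_quot d U t) (diff_quot d Z t) / 2 + lyapunov F (diff_quot d Y t) (diff_quot d U t) (diff_quot d Z t) (diff_quot d (itg Y) t) (diff_quot d (itg Z) t)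
      \<le> lyapunov F (diff_quot d Y 0) (diff_quot d U 0) (diff_quot d Z 0) (diff_quot d (itg Y) 0) (diff_quot d (itg Z) 0)"
      by (rule L(3))
  qed
  have pos: "\<forall>\<^sub>F d in at_right (0::real). d > 0"
    by (rule eventually_at_right_less)
  note lim = diff_quot_tendsto[OF dY] diff_quot_tendsto[OF der] diff_quot_tendsto[OF dZ] diff_quot_tendsto[OF dIY] diff_quot_tendsto[OF dIZ]
  have lt: "((\<lambda>d. diff_quot d Y t) \<longlongrightarrow> U t) (at_right 0)" "((\<lambda>d. diff_quot d U t) \<longlongrightarrow> P t) (at_right 0)"
    "((\<lambda>d. diff_quot d Z t) \<longlongrightarrow> W t) (at_right 0)" "((\<lambda>d. diff_quot d (itg Y) t) \<longlongrightarrow> Y t) (at_right 0)"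
    "((\<lambda>d. diff_quot d (itg Z) t) \<longlongrightarrow> Z t) (at_right 0)"
    using t by (intro lim; assumption)+
  \<comment> \<open>At time 0 the quotients of the second time integrals need not vanish, but they
    tend to \<open>Y 0 = 0\<close> and \<open>Z 0 = 0\<close>.\<close>
  have l0: "((\<lambda>d. diff_quot d Y 0) \<longlongrightarrow> U 0) (at_right 0)" "((\<lambda>d. diff_quot d U 0) \<longlongrightarrow> P 0) (at_right 0)"
    "((\<lambda>d. diff_quot d Z 0) \<longlongrightarrow> W 0) (at_right 0)" "((\<lambda>d. diff_quot d (itg Y) 0) \<longlongrightarrow> 0) (at_right 0)"
    "((\<lambda>d. diff_quot d (itg Z) 0) \<longlongrightarrow> 0) (at_right 0)"
    using lim[of 0] by (simp_all add: Y_def Z_def)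
  note le = tendsto_le[OF trivial_limit_at_right_real]
  show ?e
    by (rule le[OF energy_form_tendsto[OF l0(1-3)] energy_form_tendsto[OF lt(1-3)]])
       (use pos in eventually_elim, rule str(1))
  show ?p
    unfolding Y_def[symmetric] Z_def[symmetric]
    by (rule le[OF integrated_form_tendsto[OF l0(1,4,5)] integrated_form_tendsto[OF lt(1,4,5)]])
       (use pos in eventually_elim, rule str(2))
  have "((\<lambda>d. t * energy_form (diff_quot d Y t) (diff_quot d U t) (diff_quot d Z t) / 2 + lyapunov F (diff_quot d Y t) (diff_quot d U t) (diff_quot d Z t) (diff_quot d (itg Y) t) (diff_quot d (itg Z) t))
    \<longlongrightarrow> t * energy_form (U t) (P t) (W t) / 2 + lyapunov F (U t) (P t) (W t) (Y t) (Z t)) (at_right 0)"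
    by (intro tendsto_intros energy_form_tendsto lyapunov_tendsto lt) auto
  then show ?l
    unfolding Y_def[symmetric] Z_def[symmetric]
    by (rule le[OF lyapunov_tendsto[OF l0]])
       (use pos in eventually_elim, rule str(3))
qed

lemma a_form: "0 \<le> inner (A u) u" "inner (A u) u \<le> sup_a * inner u u"
  using inner_mulop_mono[OF bdd_borel_const a_bdd_borel, of 0 u] inner_mulop_mono[OF a_bdd_borel bdd_borel_const, of sup_a u] a_nonneg a_le
  by (simp_all add: inner_mulop_const)

lemma V_form: "0 \<le> inner (Q u) u" "inner (Q u) u \<le> V 0 * inner u u"
  using inner_mulop_mono[OF bdd_borel_const V_bdd_borel, of 0 u] inner_mulop_mono[OF V_bdd_borel bdd_borel_const, of "V 0" u]
    V_pos[THEN less_imp_le] V_le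
  by (simp_all add: inner_mulop_const)

lemma sqrtV_bdd_borel: "bdd_borel (\<lambda>x. sqrt (V x))"
proof (rule bdd_borelI)
  show "(\<lambda>x. sqrt (V x)) \<in> borel_measurable borel"
    using V_bdd_borel by (auto simp: bdd_borel_def)
  show "\<bar>sqrt (V x)\<bar> \<le> sqrt (V 0)" for x
    using V_le[of x] V_pos[of x] by simp
qed

lemma Q_sqrt: "inner (Q u) u = (norm (mulop (\<lambda>x. sqrt (V x)) u))\<^sup>2"
  by (simp add: norm_mulop_square[OF sqrtV_bdd_borel] V_pos less_imp_le)

text \<open>The outcome of the bookkeeping in \<open>decay\<close>, with 13/2 rounded up to
  7.\<close>

definition "decay_const = 7 + 4 * sup_a + 4 * lam + c1 + 4 * c2"

text \<open>The bound on \<open>U\<close> needs only monotonicity of \<open>integrated_form\<close>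
  and a lower bound for it. For the decay, \<open>lyapunov\<close> is bounded below at
  \<open>t\<close> and above at 0 by the data, and \<open>t * E / 2\<close> is at most the
  difference.\<close>

lemma decay:
  fixes U P W :: "real \<Rightarrow> l2" and q :: l2
  assumes uw: "\<And>t. t \<ge> 0 \<Longrightarrow> l2_weak_deriv (U t) (W t)"
    and eq: "\<And>t. t \<ge> 0 \<Longrightarrow> l2_weak_deriv (itg W t) (P t + Q (itg U t) + A (U t) - mulop (\<lambda>x. sqrt (V x)) q)"
    and cont: "continuous_on {0..} U" "continuous_on {0..} P" "continuous_on {0..} W"
    and der: "\<And>t. t \<ge> 0 \<Longrightarrow> (U has_vector_derivative P t) (at t within {0..})"
    and t: "t \<ge> 0"
  shows "(norm (U t))\<^sup>2 \<le> (norm (U 0))\<^sup>2 + 2 * (norm q)\<^sup>2" (is ?bdd)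
    and "(1 + t) * energy_form (U t) (P t) (W t) \<le> decay_const * ((1 + V 0)
      * ((norm (U 0))\<^sup>2 + (norm (W 0))\<^sup>2 + (norm (P 0))\<^sup>2 + (norm q)\<^sup>2))" (is ?dec)
proof -
  let ?F = "mulop (\<lambda>x. sqrt (V x)) q"
  note Ly = Lyapunov_weak[OF uw eq cont der t]
  define E where "E = energy_form (U t) (P t) (W t)"
  define E0 where "E0 = energy_form (U 0) (P 0) (W 0)"
  define N where "N = (norm (U 0))\<^sup>2 + (norm (W 0))\<^sup>2 + (norm (P 0))\<^sup>2 + (norm q)\<^sup>2"
  have lam: "lam > 0" unfolding lam_def by (simp add: add_pos_nonneg)
  have sup_a: "sup_a \<ge> 0" using a_le[of 0] a_nonneg[of 0] by simp
  have V0: "V 0 > 0" by (rule V_pos)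
  have c1: "c1 \<ge> 0" and c2: "c2 \<ge> 0"
    unfolding c1_def c2_def using eps lam sup_a V0 by auto
  \<comment> \<open>Writing the source as \<open>sqrt V\<close> times \<open>q\<close> moves
    \<open>sqrt V\<close> onto \<open>y\<close>, where the potential term absorbs it; no bound on
    the norm of \<open>y\<close> enters.\<close>
  have Phl: "integrated_form ?F u y z \<ge> inner u u / 2 - (norm q)\<^sup>2" for u y z
  proof -
    let ?y = "mulop (\<lambda>x. sqrt (V x)) y"
    \<comment> \<open>The factor 2 leads to a quarter of \<open>inner (Q y) y\<close>, within the
      half that \<open>integrated_form\<close> offers.\<close>
    have "0 \<le> (norm (2 *\<^sub>R q - ?y))\<^sup>2" by simp
    also have "\<dots> = 4 * (norm q)\<^sup>2 - 4 * inner q ?y + (norm ?y)\<^sup>2"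
      by (simp add: power2_norm_eq_inner inner_diff_left inner_diff_right inner_commute)
    finally have "inner ?F y \<le> (norm q)\<^sup>2 + inner (Q y) y / 4"
      by (simp add: Q_sqrt mulop_self_adjoint sqrtV_bdd_borel)
    moreover have "0 \<le> inner (Q y) y" by (rule V_form)
    ultimately show ?thesis
      unfolding integrated_form_def add_divide_distrib using inner_ge_zero[of z] by linarith
  qed
  have bdd: "inner (U t) (U t) \<le> inner (U 0) (U 0) + 2 * (norm q)\<^sup>2"
  proof -
    have "integrated_form ?F (U 0) 0 0 = inner (U 0) (U 0) / 2" by (simp add: integrated_form_def)
    then show ?thesis
      using Phl[of "U t" "itg U t" "itg W t"] Ly(2) by linarith
  qed
  then show ?bdd by (simp add: power2_norm_eq_inner)
  have E0N: "2 * E0 \<le> (1 + V 0) * N"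
  proof -
    have "2 * E0 \<le> inner (P 0) (P 0) + inner (W 0) (W 0) + V 0 * inner (U 0) (U 0)"
      using V_form(2)[of "U 0"] by (simp add: E0_def energy_form_def)
    also have "\<dots> \<le> N + V 0 * N"
    proof (rule add_mono)
      show "inner (P 0) (P 0) + inner (W 0) (W 0) \<le> N"
        unfolding N_def power2_norm_eq_inner by simp
      show "V 0 * inner (U 0) (U 0) \<le> V 0 * N"
        unfolding N_def power2_norm_eq_inner using V0 by (intro mult_left_mono) auto
    qed
    finally show ?thesis by (simp add: algebra_simps)
  qed
  \<comment> \<open>\<open>J\<close> needs the norm of \<open>u\<close> besides the energy, which is
    why the bound on \<open>U t\<close> comes before; \<open>G\<close> is controlled by the energy
    because arctan is bounded.\<close>
  have JG: "\<bar>J u p\<bar> \<le> (1 + sup_a) * inner u u / 2 + energy_form u p w" "\<bar>G p w\<bar> \<le> 2 * energy_form u p w" for u p w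
  proof -
    have up: "\<bar>inner u p\<bar> \<le> (inner u u + inner p p) / 2"
      using Cauchy_Schwarz_ineq2[of u p] sum_squares_bound[of "norm u" "norm p"]
      by (simp add: power2_norm_eq_inner)
    have pp: "inner p p / 2 \<le> energy_form u p w"
      using V_form(1)[of u] by (simp add: energy_form_def)
    show "\<bar>J u p\<bar> \<le> (1 + sup_a) * inner u u / 2 + energy_form u p w"
      using up pp a_form[of u] by (simp add: J_def distrib_right add_divide_distrib)
    have "\<bar>inner p (H w)\<bar> \<le> norm p * (2 * norm w)"
      using Cauchy_Schwarz_ineq2[of p "H w"] norm_mulop_le[OF arctan_bdd_borel arctan_le, of w]
      by (meson mult_left_mono norm_ge_zero order_trans)
    also have "\<dots> \<le> inner p p + inner w w"
      using sum_squares_bound[of "norm p" "norm w"] by (simp add: power2_norm_eq_inner)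
    also have "\<dots> \<le> 2 * energy_form u p w"
      using V_form(1)[of u] by (simp add: energy_form_def)
    finally show "\<bar>G p w\<bar> \<le> 2 * energy_form u p w" by (simp add: G_def)
  qed
  have En0: "0 \<le> energy_form u p w" for u p w
    using V_form(1)[of u] by (simp add: energy_form_def)
  have "E \<le> E0" using Ly(1) by (simp add: E_def E0_def)
  have U0: "inner (U 0) (U 0) \<le> N" "(norm q)\<^sup>2 \<le> N" and N: "0 \<le> N"
    by (auto simp: N_def power2_norm_eq_inner)
  have Ut: "inner (U t) (U t) \<le> 2 * N"
  proof -
    have "inner (U 0) (U 0) + 2 * (norm q)\<^sup>2 \<le> 2 * N"
      unfolding N_def power2_norm_eq_inner by simp
    then show ?thesis using bdd by linarith
  qed
  have lower: "lyapunov ?F (U t) (P t) (W t) (itg U t) (itg W t) \<ge> - ((1 + sup_a) * N + (1 + 2 * lam) * E0 + c2 * N)"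
  proof -
    have "J (U t) (P t) \<ge> - ((1 + sup_a) * N + E0)"
    proof -
      have "(1 + sup_a) * inner (U t) (U t) / 2 \<le> (1 + sup_a) * N"
        using mult_left_mono[OF Ut, of "1 + sup_a"] sup_a by simp
      then show ?thesis
        using JG(1)[of "U t" "P t" "W t"] \<open>E \<le> E0\<close> unfolding E_def by linarith
    qed
    moreover have "lam * G (P t) (W t) \<ge> lam * (- 2 * E0)"
      using JG(2)[of "P t" "W t" "U t"] \<open>E \<le> E0\<close> lam unfolding E_def by (intro mult_left_mono) auto
    moreover have "c1 * energy_form (U t) (P t) (W t) \<ge> 0"
      using c1 En0 by simp
    moreover have "c2 * integrated_form ?F (U t) (itg U t) (itg W t) \<ge> c2 * (- N)"
      using Phl[of "U t" "itg U t" "itg W t"] U0(2) c2 inner_ge_zero[of "U t"] by (intro mult_left_mono) linarith+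
    ultimately show ?thesis unfolding lyapunov_def by (simp add: algebra_simps)
  qed
  have upper: "lyapunov ?F (U 0) (P 0) (W 0) 0 0 \<le> (1 + sup_a) * N + (1 + 2 * lam) * E0 + c1 * E0 + c2 * N"
  proof -
    have "J (U 0) (P 0) \<le> (1 + sup_a) * N + E0"
    proof -
      have "(1 + sup_a) * inner (U 0) (U 0) / 2 \<le> (1 + sup_a) * N"
        using mult_left_mono[OF U0(1), of "1 + sup_a"] sup_a N by simp
      then show ?thesis
        using JG(1)[of "U 0" "P 0" "W 0"] unfolding E0_def by linarith
    qed
    moreover have "lam * G (P 0) (W 0) \<le> lam * (2 * E0)"
      using JG(2)[of "P 0" "W 0" "U 0"] lam unfolding E0_def by (intro mult_left_mono) auto
    moreover have "c2 * integrated_form ?F (U 0) 0 0 \<le> c2 * N"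
      using U0(1) N c2 by (intro mult_left_mono) (auto simp: integrated_form_def)
    ultimately show ?thesis unfolding lyapunov_def E0_def by (simp add: algebra_simps)
  qed
  \<comment> \<open>Twice the gap between the two bounds, the 2 coming from
    \<open>t * E / 2\<close>. Adding \<open>E \<le> E0\<close> then turns \<open>t\<close> into
    \<open>1 + t\<close>, also near time 0.\<close>
  have "t * E \<le> 2 * (2 * ((1 + sup_a) * N + (1 + 2 * lam) * E0 + c2 * N) + c1 * E0)"
    using lower upper Ly(3) by (simp add: E_def)
  then have "(1 + t) * E \<le> (5 + 8 * lam + 2 * c1) * E0 + (4 + 4 * sup_a + 4 * c2) * N"
    using \<open>E \<le> E0\<close> by (simp add: algebra_simps)
  also have "\<dots> \<le> (5 + 8 * lam + 2 * c1) * ((1 + V 0) * N / 2) + (4 + 4 * sup_a + 4 * c2) * N"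
    using E0N lam c1 by (intro add_right_mono mult_left_mono) auto
  also have "\<dots> \<le> (5 + 8 * lam + 2 * c1) * ((1 + V 0) * N / 2) + (4 + 4 * sup_a + 4 * c2) * ((1 + V 0) * N)"
    using V0 N sup_a c2 by (intro add_left_mono mult_left_mono) (auto simp: algebra_simps)
  also have "\<dots> = (13 / 2 + 4 * sup_a + 4 * lam + c1 + 4 * c2) * ((1 + V 0) * N)"
    by (simp add: algebra_simps add_divide_distrib)
  also have "\<dots> \<le> decay_const * ((1 + V 0) * N)"
    unfolding decay_const_def using V0 N lam c1 by (intro mult_right_mono) auto
  finally show ?dec by (simp add: E_def N_def mult.assoc)
qed

end

section \<open>Weak solutions\<close>

text \<open>\<open>weight V x - 1\<close> is \<open>1 / V x\<close>, so the weighted condition makes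
  \<open>f / sqrt V\<close> square-integrable, and multiplication by the bounded \<open>a\<close>
  preserves this.\<close>

lemma L2w_quotient:
  assumes V: "BC1 V" "\<And>x. 0 < V x" and a: "BC a" and u: "L2w V u0" "L2w V u1"
  shows "L2 (\<lambda>x. (u1 x + a x * u0 x) / sqrt (V x))"
proof -
  have [measurable]: "V \<in> borel_measurable borel" "a \<in> borel_measurable borel"
    using bdd_borel_BC V(1) a by (auto simp: BC1_def bdd_borel_def)
  have "L2 (\<lambda>x. f x / sqrt (V x))" if "L2w V f" for f
  proof -
    have [measurable]: "f \<in> borel_measurable borel"
      using that by (simp add: L2w_def L2_def)
    have "integrable lborel (\<lambda>x. (f x)\<^sup>2 * weight V x - (f x)\<^sup>2)"
      using that by (intro Bochner_Integration.integrable_diff) (auto simp: L2w_def L2_def)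
    also have "(\<lambda>x. (f x)\<^sup>2 * weight V x - (f x)\<^sup>2) = (\<lambda>x. (f x / sqrt (V x))\<^sup>2)"
      using V(2) by (auto simp: weight_def power_divide less_imp_le field_simps)
    finally show ?thesis by (simp add: L2_def)
  qed
  then have "L2 (\<lambda>x. u1 x / sqrt (V x) + a x * (u0 x / sqrt (V x)))"
    using u by (intro L2_add L2_bdd_borel bdd_borel_BC a) auto
  then show ?thesis by (simp add: add_divide_distrib)
qed

lemma L2norm_nonneg: "0 \<le> L2norm f"
  by (simp add: L2norm_def)

lemma L2norm_zero_AE: assumes "L2 f" "L2norm f = 0" shows "AE x in lborel. f x = 0"
proof -
  have "abs_l2 f = 0"
    using norm_abs_l2[OF assms(1)] assms(2) by simp
  then show ?thesis
    using abs_l2_eq_iff[OF assms(1) L2_zero] by (simp add: zero_l2.abs_eq)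
qed

section \<open>From the weak formulation to the equation in the Hilbert space\<close>

context
  fixes V a u0 u1 :: "real \<Rightarrow> real" and u ut ux :: "real \<Rightarrow> real \<Rightarrow> real"
  assumes sol: "weak_solution V a u0 u1 u ut ux"
begin

lemma sol_L2: "t \<ge> 0 \<Longrightarrow> L2 (u t)" "t \<ge> 0 \<Longrightarrow> L2 (ut t)" "t \<ge> 0 \<Longrightarrow> L2 (ux t)"
  using sol by (auto simp: weak_solution_def H1_def)

lemma sol_weak_deriv: "t \<ge> 0 \<Longrightarrow> l2_weak_deriv (abs_l2 (u t)) (abs_l2 (ux t))"
  using sol by (auto simp: weak_solution_def H1_def l2_weak_deriv_abs)

lemma abs_l2_continuous:
  fixes f :: "real \<Rightarrow> real \<Rightarrow> real"
  assumes "\<And>t. t \<ge> 0 \<Longrightarrow> L2 (f t)"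
    and lim: "\<And>t. t \<ge> 0 \<Longrightarrow> ((\<lambda>s. L2norm (\<lambda>x. f s x - f t x)) \<longlongrightarrow> 0) (at t within {0..})"
  shows "continuous_on {0..} (\<lambda>t. abs_l2 (f t))"
  unfolding continuous_on_def
proof
  fix t :: real assume "t \<in> {0..}"
  then have t: "t \<ge> 0" by simp
  then have "\<forall>\<^sub>F s in at t within {0..}. L2norm (\<lambda>x. f s x - f t x) = dist (abs_l2 (f s)) (abs_l2 (f t))"
    by (auto simp: eventually_at_filter dist_abs_l2 assms(1))
  with lim[OF t] have "((\<lambda>s. dist (abs_l2 (f s)) (abs_l2 (f t))) \<longlongrightarrow> 0) (at t within {0..})"
    by (rule Lim_transform_eventually)
  then show "((\<lambda>t. abs_l2 (f t)) \<longlongrightarrow> abs_l2 (f t)) (at t within {0..})"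
    by (subst tendsto_dist_iff)
qed

lemma sol_continuous:
  "continuous_on {0..} (\<lambda>t. abs_l2 (u t))" "continuous_on {0..} (\<lambda>t. abs_l2 (ut t))"
  "continuous_on {0..} (\<lambda>t. abs_l2 (ux t))"
proof -
  have sum: "((\<lambda>s. L2norm (\<lambda>x. u s x - u t x) + L2norm (\<lambda>x. ux s x - ux t x)) \<longlongrightarrow> 0) (at t within {0..})"
    if "t \<ge> 0" for t
    using sol that by (auto simp: weak_solution_def)
  have lim: "((\<lambda>s. L2norm (\<lambda>x. u s x - u t x)) \<longlongrightarrow> 0) (at t within {0..})"
    "((\<lambda>s. L2norm (\<lambda>x. ux s x - ux t x)) \<longlongrightarrow> 0) (at t within {0..})" if "t \<ge> 0" for t
    by (rule tendsto_sandwich[OF _ _ tendsto_const sum[OF that]]; simp add: L2norm_nonneg)+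
  show "continuous_on {0..} (\<lambda>t. abs_l2 (u t))"
    by (rule abs_l2_continuous[OF sol_L2(1) lim(1)])
  show "continuous_on {0..} (\<lambda>t. abs_l2 (ux t))"
    by (rule abs_l2_continuous[OF sol_L2(3) lim(2)])
  show "continuous_on {0..} (\<lambda>t. abs_l2 (ut t))"
    by (intro abs_l2_continuous sol_L2) (use sol in \<open>auto simp: weak_solution_def\<close>)
qed

lemma sol_derivative:
  assumes "t \<ge> 0"
  shows "((\<lambda>t. abs_l2 (u t)) has_vector_derivative abs_l2 (ut t)) (at t within {0..})"
proof -
  have "((\<lambda>s. L2norm (\<lambda>x. (u s x - u t x) / (s - t) - ut t x)) \<longlongrightarrow> 0) (at t within {0..})"
    using sol assms by (auto simp: weak_solution_def)
  moreover have "\<forall>\<^sub>F s in at t within {0..}. L2norm (\<lambda>x. (u s x - u t x) / (s - t) - ut t x)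
      = norm (abs_l2 (u s) - abs_l2 (u t) - (s - t) *\<^sub>R abs_l2 (ut t)) / norm (s - t)"
    unfolding eventually_at_filter
  proof (intro always_eventually allI impI)
    fix s assume s: "s \<noteq> t" "s \<in> {0..}"
    have L: "L2 (\<lambda>x. u s x - u t x - (s - t) * ut t x)"
      using s assms by (intro L2_diff L2_scale sol_L2) auto
    have "abs_l2 (u s) - abs_l2 (u t) - (s - t) *\<^sub>R abs_l2 (ut t) = abs_l2 (\<lambda>x. u s x - u t x - (s - t) * ut t x)"
      using s assms by (simp add: abs_l2_simps scaleR_abs_l2 sol_L2 L2_diff L2_scale)
    then have "norm (abs_l2 (u s) - abs_l2 (u t) - (s - t) *\<^sub>R abs_l2 (ut t)) / norm (s - t)
        = norm ((1 / (s - t)) *\<^sub>R abs_l2 (\<lambda>x. u s x - u t x - (s - t) * ut t x))"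
      by simp
    also have "(1 / (s - t)) *\<^sub>R abs_l2 (\<lambda>x. u s x - u t x - (s - t) * ut t x)
        = abs_l2 (\<lambda>x. (1 / (s - t)) * (u s x - u t x - (s - t) * ut t x))"
      using L by (rule scaleR_abs_l2)
    also have "(\<lambda>x. (1 / (s - t)) * (u s x - u t x - (s - t) * ut t x)) = (\<lambda>x. (u s x - u t x) / (s - t) - ut t x)"
      using s by (auto simp: diff_divide_distrib)
    also have "norm (abs_l2 (\<lambda>x. (u s x - u t x) / (s - t) - ut t x)) = L2norm (\<lambda>x. (u s x - u t x) / (s - t) - ut t x)"
    proof (rule norm_abs_l2)
      have "L2 (\<lambda>x. (1 / (s - t)) * (u s x - u t x) - ut t x)"
        using s assms by (intro L2_diff L2_scale sol_L2) auto
      then show "L2 (\<lambda>x. (u s x - u t x) / (s - t) - ut t x)" by simp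
    qed
    finally show "L2norm (\<lambda>x. (u s x - u t x) / (s - t) - ut t x)
      = norm (abs_l2 (u s) - abs_l2 (u t) - (s - t) *\<^sub>R abs_l2 (ut t)) / norm (s - t)" ..
  qed
  ultimately have "((\<lambda>s. norm (abs_l2 (u s) - abs_l2 (u t) - (s - t) *\<^sub>R abs_l2 (ut t)) / norm (s - t)) \<longlongrightarrow> 0) (at t within {0..})"
    by (rule Lim_transform_eventually)
  then show ?thesis
    by (simp add: has_vector_derivative_def has_derivative_iff_norm bounded_linear_scaleR_left)
qed

text \<open>For a fixed test function, \<open>k\<close> collects the equation integrated in time;
  its derivative vanishes by the weak formulation. Comparing \<open>k t\<close> with
  \<open>k 0\<close> leaves the value of \<open>u_t + a u\<close> at time 0 as a constant
  source.\<close>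

lemma sol_integrated_equation:
  assumes "bdd_borel V" "bdd_borel a" "t \<ge> 0"
  shows "l2_weak_deriv (itg (\<lambda>t. abs_l2 (ux t)) t) (abs_l2 (ut t) + mulop V (itg (\<lambda>t. abs_l2 (u t)) t)
     + mulop a (abs_l2 (u t)) - (abs_l2 (ut 0) + mulop a (abs_l2 (u 0))))"
  unfolding l2_weak_deriv_def
proof (intro allI impI)
  fix \<phi> assume \<phi>: "test_fun \<phi>"
  let ?U = "\<lambda>t. abs_l2 (u t)" and ?P = "\<lambda>t. abs_l2 (ut t)" and ?W = "\<lambda>t. abs_l2 (ux t)"
  let ?f = "abs_l2 \<phi>" and ?g = "abs_l2 (deriv \<phi>)"
  define k where "k s = inner (?P s) ?f + inner (itg ?W s) ?g + inner (mulop V (itg ?U s)) ?f + inner (mulop a (?U s)) ?f" for s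
  have L2\<phi>: "L2 \<phi>" "L2 (deriv \<phi>)"
    using \<phi> by (auto intro: L2_test_fun test_fun_deriv)
  have "continuous_on {0..} k"
    unfolding k_def by (intro continuous_intros itg_continuous mulop_continuous_on assms sol_continuous)
  moreover have "(k has_real_derivative 0) (at s)" if s: "s > 0" for s
  proof -
    have "((\<lambda>s. LINT x|lborel. ut s x * \<phi> x) has_real_derivative
           (- (LINT x|lborel. ux s x * deriv \<phi> x) - (LINT x|lborel. V x * u s x * \<phi> x)
            - (LINT x|lborel. a x * ut s x * \<phi> x))) (at s)"
      using sol s \<phi> by (auto simp: weak_solution_def)
    moreover have "(LINT x|lborel. ux s x * deriv \<phi> x) = inner (?W s) ?g"
      "(LINT x|lborel. V x * u s x * \<phi> x) = inner (mulop V (?U s)) ?f"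
      "(LINT x|lborel. a x * ut s x * \<phi> x) = inner (mulop a (?P s)) ?f"
      using s L2\<phi> by (simp_all add: abs_l2_simps mulop_abs assms sol_L2 L2_bdd_borel)
    ultimately have "((\<lambda>s. LINT x|lborel. ut s x * \<phi> x) has_real_derivative
        (- inner (?W s) ?g - inner (mulop V (?U s)) ?f - inner (mulop a (?P s)) ?f)) (at s)"
      by simp
    then have 1: "((\<lambda>s. inner (?P s) ?f) has_real_derivative
        (- inner (?W s) ?g - inner (mulop V (?U s)) ?f - inner (mulop a (?P s)) ?f)) (at s)"
    proof (rule has_field_derivative_transform_within_open[where S = "{0<..}"])
      show "(LINT x|lborel. ut s x * \<phi> x) = inner (?P s) ?f" if "s \<in> {0<..}" for s
        using that L2\<phi> by (simp add: abs_l2_simps sol_L2)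
    qed (use s in auto)
    have d: "(itg ?W has_vector_derivative ?W s) (at s)" "(itg ?U has_vector_derivative ?U s) (at s)"
      "(?U has_vector_derivative ?P s) (at s)"
      using s by (intro has_vector_derivative_at_halfline itg_has_vector_derivative sol_continuous sol_derivative; simp)+
    show ?thesis
      unfolding k_def
      by (rule DERIV_cong, (rule DERIV_add 1 inner_DERIV mulop_has_vector_derivative[OF assms(1)]
           mulop_has_vector_derivative[OF assms(2)] has_vector_derivative_const d)+, simp)
  qed
  \<comment> \<open>\<open>k\<close> is differentiated at positive times only; continuity at 0
    closes the gap.\<close>
  ultimately have "k t = k 0"
  proof (cases "t = 0")
    case False
    assume k: "continuous_on {0..} k" and "\<And>s. s > 0 \<Longrightarrow> (k has_real_derivative 0) (at s)"
    moreover have "continuous_on {0..t} k" using k by (rule continuous_on_subset) auto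
    ultimately show ?thesis
      using False \<open>t \<ge> 0\<close> by (intro DERIV_isconst2[of 0 t]) auto
  qed simp
  then show "inner (itg ?W t) ?g = - inner (?P t + mulop V (itg ?U t) + mulop a (?U t) - (?P 0 + mulop a (?U 0))) ?f"
    using linear_0[OF bounded_linear.linear[OF bounded_linear_mulop[OF assms(1)]]]
    by (simp add: k_def inner_add_left inner_diff_left)
qed

end

lemma (in damped) solution_bounds:
  assumes H: "H1 u0 du0" "L2w V u0" "L2w V u1" and sol: "weak_solution V a u0 u1 u ut ux" and t: "t \<ge> 0"
  defines "N \<equiv> (H1norm u0 du0)\<^sup>2 + (L2norm u1)\<^sup>2 + (L2norm (\<lambda>x. (u1 x + a x * u0 x) / sqrt (V x)))\<^sup>2"
  shows "(L2norm (u t))\<^sup>2 \<le> 2 * N" and "energy V u ut ux t \<le> (decay_const * (1 + V 0)) * N * inverse (1 + t)"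
proof -
  let ?U = "\<lambda>t. abs_l2 (u t)" and ?P = "\<lambda>t. abs_l2 (ut t)" and ?W = "\<lambda>t. abs_l2 (ux t)"
  define q where "q = (\<lambda>x. (u1 x + a x * u0 x) / sqrt (V x))"
  have L2: "L2 u0" "L2 du0" "L2 u1" and Lq: "L2 q"
    using H L2w_quotient[OF V_BC1 V_pos a_BC H(2,3)] by (auto simp: H1_def L2w_def q_def)
  note sL2 = sol_L2[OF sol]
  have U0: "?U 0 = abs_l2 u0"
    using sol L2norm_zero_AE[OF L2_diff[OF sL2(1)[of 0] L2(1)]]
    by (subst abs_l2_eq_iff) (auto simp: weak_solution_def sL2 L2)
  have P0: "?P 0 = abs_l2 u1"
    using sol L2norm_zero_AE[OF L2_diff[OF sL2(2)[of 0] L2(3)]]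
    by (subst abs_l2_eq_iff) (auto simp: weak_solution_def sL2 L2)
  \<comment> \<open>\<open>weak_solution\<close> prescribes \<open>u 0\<close> and
    \<open>ut 0\<close>; the class of \<open>ux 0\<close> is identified through uniqueness of the
    weak derivative.\<close>
  have W0: "?W 0 = abs_l2 du0"
  proof (rule l2_weak_deriv_unique)
    show "l2_weak_deriv (abs_l2 u0) (?W 0)" using sol_weak_deriv[OF sol, of 0] U0 by simp
    show "l2_weak_deriv (abs_l2 u0) (abs_l2 du0)" using H(1) by (simp add: H1_def l2_weak_deriv_abs)
  qed
  \<comment> \<open>Here the third summand of the data norm enters: the source is
    \<open>sqrt V\<close> times the square-integrable \<open>q\<close>, the form that
    \<open>decay\<close> asks for.\<close>
  have F: "?P 0 + A (?U 0) = mulop (\<lambda>x. sqrt (V x)) (abs_l2 q)"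
  proof -
    have "sqrt (V x) * q x = u1 x + a x * u0 x" for x
      using V_pos[of x] by (simp add: q_def)
    then show ?thesis
      unfolding U0 P0 by (simp add: mulop_abs a_bdd_borel sqrtV_bdd_borel abs_l2_simps L2 Lq L2_bdd_borel)
  qed
  have eq: "l2_weak_deriv (itg ?W s) (?P s + Q (itg ?U s) + A (?U s) - mulop (\<lambda>x. sqrt (V x)) (abs_l2 q))" if "s \<ge> 0" for s
    using sol_integrated_equation[OF sol V_bdd_borel a_bdd_borel that] by (simp only: F)
  note dec = decay[OF sol_weak_deriv[OF sol] eq sol_continuous[OF sol] sol_derivative[OF sol] t]
  have N: "N = (norm (?U 0))\<^sup>2 + (norm (?W 0))\<^sup>2 + (norm (?P 0))\<^sup>2 + (norm (abs_l2 q))\<^sup>2"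
    unfolding U0 P0 W0 using L2norm_nonneg
    by (simp add: N_def norm_abs_l2 L2 Lq H1norm_def flip: q_def)
  show "(L2norm (u t))\<^sup>2 \<le> 2 * N"
  proof -
    have "(norm (?U 0))\<^sup>2 + 2 * (norm (abs_l2 q))\<^sup>2 \<le> 2 * N"
      unfolding N by simp
    then show ?thesis
      using dec(1) norm_abs_l2[OF sL2(1)[OF t]] by simp
  qed
  have "energy V u ut ux t = energy_form (?U t) (?P t) (?W t)"
  proof -
    have "(L2norm (\<lambda>x. sqrt (V x) * u t x))\<^sup>2 = inner (Q (?U t)) (?U t)"
      unfolding Q_sqrt using t by (simp add: mulop_abs sqrtV_bdd_borel sL2 norm_abs_l2 L2_bdd_borel)
    then show ?thesis
      using t by (simp add: energy_def energy_form_def norm_abs_l2 sL2 flip: power2_norm_eq_inner)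
  qed
  moreover have "(1 + t) * energy_form (?U t) (?P t) (?W t) \<le> decay_const * ((1 + V 0) * N)"
    using dec(2) by (simp add: N)
  ultimately show "energy V u ut ux t \<le> (decay_const * (1 + V 0)) * N * inverse (1 + t)"
    using t by (simp add: field_simps)
qed

theorem theorem1p1:
  "\<forall>L::real. L > 0 \<longrightarrow> (\<exists>Cstar::real. Cstar > 0 \<and>
    (\<forall>(a::real \<Rightarrow> real) (\<epsilon>1::real) (V::real \<Rightarrow> real).
       BC a \<and> (\<forall>x. a x \<ge> 0) \<and> \<epsilon>1 > 0 \<and> (\<forall>x. \<bar>x\<bar> \<ge> L \<longrightarrow> a x \<ge> \<epsilon>1)
       \<and> BC1 V \<and> (\<forall>x. V x > 0) \<and> (\<forall>x. deriv V x * x \<le> 0)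
       \<and> V 0 < inverse (4 * Cstar) \<longrightarrow>
       (\<exists>C::real. C > 0 \<and>
         (\<forall>u0 du0 u1 u ut ux.
            H1 u0 du0 \<and> L2w V u0 \<and> L2w V u1 \<and> weak_solution V a u0 u1 u ut ux \<longrightarrow>
            (\<forall>t::real. t \<ge> 0 \<longrightarrow>
               L2norm (u t) \<le> C * I0pow 1 V a u0 du0 u1 \<and>
               energy V u ut ux t \<le> C * I0pow 2 V a u0 du0 u1 * inverse (1 + t))))))"
proof (intro allI impI)
  fix L :: real assume L: "L > 0"
  \<comment> \<open>\<open>4 * Cs * V 0\<close> is the quantity bounded in \<open>V_small\<close>,
    and \<open>Cs\<close> is built from \<open>L\<close> alone.\<close>
  define Cs where "Cs = 12 * L\<^sup>2 * (1 + L\<^sup>2)"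
  have Cs: "Cs > 0" unfolding Cs_def using L by (simp add: add_pos_nonneg)
  have main: "\<exists>C::real. C > 0 \<and>
         (\<forall>u0 du0 u1 u ut ux.
            H1 u0 du0 \<and> L2w V u0 \<and> L2w V u1 \<and> weak_solution V a u0 u1 u ut ux \<longrightarrow>
            (\<forall>t::real. t \<ge> 0 \<longrightarrow>
               L2norm (u t) \<le> C * I0pow 1 V a u0 du0 u1 \<and>
               energy V u ut ux t \<le> C * I0pow 2 V a u0 du0 u1 * inverse (1 + t)))"
    if H: "BC a \<and> (\<forall>x. a x \<ge> 0) \<and> \<epsilon> > 0 \<and> (\<forall>x. \<bar>x\<bar> \<ge> L \<longrightarrow> a x \<ge> \<epsilon>)
       \<and> BC1 V \<and> (\<forall>x. V x > 0) \<and> (\<forall>x. deriv V x * x \<le> 0)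
       \<and> V 0 < inverse (4 * Cs)" for a \<epsilon> V
  proof -
    have "48 * L\<^sup>2 * (1 + L\<^sup>2) * V 0 = (4 * Cs) * V 0"
      by (simp add: Cs_def)
    also have "\<dots> \<le> (4 * Cs) * inverse (4 * Cs)"
      using H Cs by (intro mult_left_mono) auto
    finally interpret damped L \<epsilon> a V
      using L H Cs by unfold_locales auto
    \<comment> \<open>The entry 2 serves the norm, through
      \<open>2 * (p^2 + q^2 + r^2) \<le> (2 * (p + q + r))^2\<close>; the other one serves the
      energy. Neither involves the initial data.\<close>
    define C where "C = max 2 (decay_const * (1 + V 0))"
    have "C > 0" by (simp add: C_def)
    moreover have "L2norm (u t) \<le> C * I0pow 1 V a u0 du0 u1 \<and>
               energy V u ut ux t \<le> C * I0pow 2 V a u0 du0 u1 * inverse (1 + t)"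
      if S: "H1 u0 du0 \<and> L2w V u0 \<and> L2w V u1 \<and> weak_solution V a u0 u1 u ut ux" and t: "t \<ge> 0"
      for u0 du0 u1 u ut ux and t :: real
    proof -
      define p q r where "p = H1norm u0 du0" and "q = L2norm u1"
        and "r = L2norm (\<lambda>x. (u1 x + a x * u0 x) / sqrt (V x))"
      have nn: "0 \<le> p" "0 \<le> q" "0 \<le> r"
        by (auto simp: p_def q_def r_def L2norm_nonneg H1norm_def)
      have b: "(L2norm (u t))\<^sup>2 \<le> 2 * (p\<^sup>2 + q\<^sup>2 + r\<^sup>2)"
        "energy V u ut ux t \<le> (decay_const * (1 + V 0)) * (p\<^sup>2 + q\<^sup>2 + r\<^sup>2) * inverse (1 + t)"
        using solution_bounds[of u0 du0 u1 u ut ux t] S t by (auto simp: p_def q_def r_def)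
      have "2 * (p\<^sup>2 + q\<^sup>2 + r\<^sup>2) \<le> (2 * (p + q + r))\<^sup>2"
        using nn by (simp add: power2_eq_square algebra_simps)
      with b(1) have "(L2norm (u t))\<^sup>2 \<le> (2 * (p + q + r))\<^sup>2"
        by linarith
      then have "L2norm (u t) \<le> 2 * (p + q + r)"
        by (rule power2_le_imp_le) (use nn in simp)
      also have "\<dots> \<le> C * (p + q + r)"
        using nn by (intro mult_right_mono) (auto simp: C_def)
      finally have "L2norm (u t) \<le> C * I0pow 1 V a u0 du0 u1"
        by (simp add: I0pow_def p_def q_def r_def)
      moreover have "(decay_const * (1 + V 0)) * (p\<^sup>2 + q\<^sup>2 + r\<^sup>2) * inverse (1 + t) \<le> C * (p\<^sup>2 + q\<^sup>2 + r\<^sup>2) * inverse (1 + t)"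
        using t by (intro mult_right_mono) (auto simp: C_def)
      ultimately show ?thesis
        using b(2) by (simp add: I0pow_def p_def q_def r_def)
    qed
    ultimately show ?thesis by blast
  qed
  show "\<exists>Cstar::real. Cstar > 0 \<and>
    (\<forall>(a::real \<Rightarrow> real) (\<epsilon>1::real) (V::real \<Rightarrow> real).
       BC a \<and> (\<forall>x. a x \<ge> 0) \<and> \<epsilon>1 > 0 \<and> (\<forall>x. \<bar>x\<bar> \<ge> L \<longrightarrow> a x \<ge> \<epsilon>1)
       \<and> BC1 V \<and> (\<forall>x. V x > 0) \<and> (\<forall>x. deriv V x * x \<le> 0)
       \<and> V 0 < inverse (4 * Cstar) \<longrightarrow>
       (\<exists>C::real. C > 0 \<and>
         (\<forall>u0 du0 u1 u ut ux.
            H1 u0 du0 \<and> L2w V u0 \<and> L2w V u1 \<and> weak_solution V a u0 u1 u ut ux \<longrightarrow>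
            (\<forall>t::real. t \<ge> 0 \<longrightarrow>
               L2norm (u t) \<le> C * I0pow 1 V a u0 du0 u1 \<and>
               energy V u ut ux t \<le> C * I0pow 2 V a u0 du0 u1 * inverse (1 + t)))))"
    using Cs main by blast
qed

end
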